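(* Let $k_1,k_2\in\mathbb{Z}$ be such that $k_1>0$ or $k_1=-1$, and let $\varphi(r)$ be a nonzero radial T-function on $D$. Then on $L_h^2$ the following statements hold. (a) The commutator $[T_{e^{ik_1\theta}r^{k_1}},T_{e^{ik_2\theta}\varphi}]$ has finite rank if and only if $k_2>-2$ and $\varphi(r)=Cr^{k_2}$ for some constant $C$. (b) The commutator $[T_{e^{-ik_1\theta}r^{k_1}},T_{e^{ik_2\theta}\varphi}]$ has finite rank if and only if $k_2<2$ and $\varphi(r)=Cr^{-k_2}$ for some constant $C$.
   Context: $D$ is the open unit disk in $\mathbb{C}$ and $dA$ is Lebesgue area measure on $D$ normalized so that $D$ has measure $1$. $L_h^2$ is the harmonic Bergman space: the closed subspace of $L^2(D,dA)$ consisting of (complex-valued) harmonic functions. $Q$ is the orthogonal projection of $L^2(D,dA)$ onto $L_h^2$, given by $Qf(z)=\int_D\left(\frac{1}{(1-z\bar w)^2}+\frac{1}{(1-\bar z w)^2}-1\right)f(w)\,dA(w)$; the integral formula extends $Q$ to $L^1(D,dA)$. For $u\in L^1(D,dA)$ the operator $h\mapsto Q(uh)$ is densely defined on the harmonic polynomials in $L_h^2$. $u$ is called a T-function if this operator is bounded in the $L_h^2$ norm; then the Toeplitz operator $T_u:L_h^2\to L_h^2$ is its continuous extension. (Every $u \in L^1(D,dA)$ essentially bounded on some annulus $r_0<|z|<1$ is a T-function.) Points of $D$ are written $re^{i\theta}$; a radial T-function is a T-function depending only on $r$, and for $k\in\mathbb{Z}$, $e^{ik\theta}\varphi(r)$ is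 a T-function iff $\varphi$ is. $[A,B]=AB-BA$. A bounded operator has finite rank if the closure of its range is finite dimensional. *)

theory Defs
  imports "HOL-Analysis.Analysis"
begin

abbreviation unit_disk :: "complex set" where
  "unit_disk \<equiv> ball 0 1"

text \<open>Lebesgue area measure on the disk, divided by the area of the disk.\<close>

definition disk_area :: "complex measure" where
  "disk_area = density (lebesgue_on unit_disk) (\<lambda>_. ennreal (1 / pi))"

lemma emeasure_disk_area: "emeasure disk_area unit_disk = 1"
proof -
  have "emeasure disk_area unit_disk = ennreal (1 / pi) * emeasure lebesgue unit_disk"
    by (simp add: disk_area_def emeasure_density_const emeasure_restrict_space)
  also have "\<dots> = ennreal (1 / pi) * ennreal pi"
    by (simp add: emeasure_ball eval_unit_ball_vol)
  also have "\<dots> = 1"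
    by (simp flip: ennreal_mult)
  finally show ?thesis .
qed

text \<open>\<open>f' z\<close> is the real total derivative of \<open>f\<close> at \<open>z\<close>, and \<open>f'' z u v\<close> is the second
  derivative in the directions \<open>u\<close> and \<open>v\<close>; so the Laplacian is \<open>f'' z 1 1 + f'' z \<i> \<i>\<close>.\<close>

definition harmonic_on :: "(complex \<Rightarrow> complex) \<Rightarrow> complex set \<Rightarrow> bool" where
  "harmonic_on f S \<longleftrightarrow>
     (\<exists>f' f''.
        (\<forall>z\<in>S. (f has_derivative f' z) (at z)) \<and>
        (\<forall>z\<in>S. \<forall>v. ((\<lambda>w. f' w v) has_derivative (\<lambda>u. f'' z u v)) (at z)) \<and>
        (\<forall>u v. continuous_on S (\<lambda>z. f'' z u v)) \<and>
        (\<forall>z\<in>S. f'' z 1 1 + f'' z \<i> \<i> = 0))"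

text \<open>Functions on the disk are represented by total functions. A harmonic function is the unique
  continuous representative of its class in \<open>L\<^sup>2\<close>; requiring the value \<open>0\<close> off the disk
  makes equality of elements of the space equality of HOL functions.\<close>

definition harmonic_bergman :: "(complex \<Rightarrow> complex) set" where
  "harmonic_bergman =
     {f. harmonic_on f unit_disk \<and> integrable disk_area (\<lambda>z. (norm (f z))\<^sup>2) \<and>
         (\<forall>z. z \<notin> unit_disk \<longrightarrow> f z = 0)}"

definition bergman_norm :: "(complex \<Rightarrow> complex) \<Rightarrow> real" where
  "bergman_norm f = sqrt (\<integral>z. (norm (f z))\<^sup>2 \<partial>disk_area)"

definition harmonic_polynomials :: "(complex \<Rightarrow> complex) set" where
  "harmonic_polynomials =
     {p. \<exists>n a b. p = (\<lambda>z. if z \<in> unit_disk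
                          then (\<Sum>k\<le>n. a k * z ^ k) + (\<Sum>k\<le>n. b k * cnj z ^ k) else 0)}"

text \<open>The integral formula for the orthogonal projection of \<open>L\<^sup>2\<close> onto the harmonic Bergman space,
  which makes sense on \<open>L\<^sup>1\<close>.\<close>

definition bergman_Q :: "(complex \<Rightarrow> complex) \<Rightarrow> complex \<Rightarrow> complex" where
  "bergman_Q f z =
     (if z \<in> unit_disk
      then \<integral>w. (1 / (1 - z * cnj w)\<^sup>2 + 1 / (1 - cnj z * w)\<^sup>2 - 1) * f w \<partial>disk_area
      else 0)"

definition T_function :: "(complex \<Rightarrow> complex) \<Rightarrow> bool" where
  "T_function u \<longleftrightarrow>
     integrable disk_area u \<and>
     (\<exists>C. \<forall>p\<in>harmonic_polynomials.
        bergman_Q (\<lambda>z. u z * p z) \<in> harmonic_bergman \<and>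
        bergman_norm (bergman_Q (\<lambda>z. u z * p z)) \<le> C * bergman_norm p)"

text \<open>As with functions on the disk, operators are made unique as HOL functions, here by fixing
  their (irrelevant) values outside the space.\<close>

definition bounded_operator :: "((complex \<Rightarrow> complex) \<Rightarrow> (complex \<Rightarrow> complex)) \<Rightarrow> bool" where
  "bounded_operator T \<longleftrightarrow>
     T \<in> harmonic_bergman \<rightarrow>\<^sub>E harmonic_bergman \<and>
     (\<forall>f\<in>harmonic_bergman. \<forall>g\<in>harmonic_bergman. T (\<lambda>z. f z + g z) = (\<lambda>z. T f z + T g z)) \<and>
     (\<forall>c. \<forall>f\<in>harmonic_bergman. T (\<lambda>z. c * f z) = (\<lambda>z. c * T f z)) \<and>
     (\<exists>C. \<forall>f\<in>harmonic_bergman. bergman_norm (T f) \<le> C * bergman_norm f)"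

text \<open>Meaningful for T-functions \<open>u\<close>: the continuous extension from the (dense) harmonic
  polynomials.\<close>

definition toeplitz ::
  "(complex \<Rightarrow> complex) \<Rightarrow> (complex \<Rightarrow> complex) \<Rightarrow> (complex \<Rightarrow> complex)" where
  "toeplitz u =
     (THE T. bounded_operator T \<and>
             (\<forall>p\<in>harmonic_polynomials. T p = bergman_Q (\<lambda>z. u z * p z)))"

definition commutator ::
  "((complex \<Rightarrow> complex) \<Rightarrow> (complex \<Rightarrow> complex)) \<Rightarrow>
   ((complex \<Rightarrow> complex) \<Rightarrow> (complex \<Rightarrow> complex)) \<Rightarrow>
   (complex \<Rightarrow> complex) \<Rightarrow> (complex \<Rightarrow> complex)" where
  "commutator A B = (\<lambda>f\<in>harmonic_bergman. \<lambda>z. A (B f) z - B (A f) z)"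

definition bergman_closure :: "(complex \<Rightarrow> complex) set \<Rightarrow> (complex \<Rightarrow> complex) set" where
  "bergman_closure S =
     {g \<in> harmonic_bergman. \<forall>e>0. \<exists>f\<in>S. bergman_norm (\<lambda>z. f z - g z) < e}"

definition finite_dimensional :: "(complex \<Rightarrow> complex) set \<Rightarrow> bool" where
  "finite_dimensional V \<longleftrightarrow>
     (\<exists>B. finite B \<and> B \<subseteq> V \<and> (\<forall>f\<in>V. \<exists>c. f = (\<lambda>z. \<Sum>b\<in>B. c b * b z)))"

definition finite_rank :: "((complex \<Rightarrow> complex) \<Rightarrow> (complex \<Rightarrow> complex)) \<Rightarrow> bool" where
  "finite_rank A \<longleftrightarrow> finite_dimensional (bergman_closure (A ` harmonic_bergman))"

text \<open>The function \<open>e\<^bsup>ik\<theta>\<^esup> \<phi>(r)\<close> of \<open>z = re\<^bsup>i\<theta>\<^esup>\<close>.\<close>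

definition quasihomogeneous :: "int \<Rightarrow> (real \<Rightarrow> complex) \<Rightarrow> complex \<Rightarrow> complex" where
  "quasihomogeneous k \<phi> z = cis (of_int k * Arg z) * \<phi> (norm z)"

end

theory Submission
  imports Defs "HOL-Complex_Analysis.Complex_Analysis" "HOL-Library.Function_Algebras"
begin

text \<open>The harmonic monomials \<open>e\<^sub>n = r\<^bsup>|n|\<^esup> e\<^bsup>in\<theta>\<^esup>\<close>, \<open>n \<in> \<int>\<close>, form an orthogonal basis of the harmonic
  Bergman space with \<open>\<parallel>e\<^sub>n\<parallel>\<^sup>2 = 1 / (|n| + 1)\<close>, and in this basis the Toeplitz operator with symbol
  \<open>e\<^bsup>ik\<theta>\<^esup> \<phi>(r)\<close> is a weighted shift: \<open>e\<^sub>n\<close> goes to \<open>w\<^sub>n e\<^bsub>n+k\<^esub>\<close> with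
  \<open>w\<^sub>n = (|n + k| + 1) M(|n| + |n + k|)\<close>, where \<open>M(m)\<close> is the integral of \<open>\<phi>(|z|) |z|\<^sup>m\<close> over the disk
  (\<open>toeplitz_quasihomogeneous\<close>). The commutator of two weighted shifts is again a weighted shift, with
  weights \<open>d\<^sub>n\<close> built from the two weight sequences, and a weighted shift has finite rank iff only
  finitely many of its weights are nonzero (\<open>commutator_wshift\<close>, \<open>finite_rank_wshift_iff\<close>). So the
  theorem is a statement about two sequences of moments.

  For \<open>k > -2\<close> the symbol \<open>e\<^bsup>ik\<theta>\<^esup> r\<^sup>k\<close> has weight \<open>1\<close> at \<open>n \<ge> |k|\<close> and \<open>(1 - n - k) / (1 - n)\<close> at
  \<open>n \<le> -|k|\<close>. For two such symbols the products of weights in \<open>d\<^sub>n\<close> telescope to the same value as soon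
  as \<open>|n|\<close> is large, which gives finite rank. Conversely, let \<open>d\<^sub>n = 0\<close> for all large \<open>n\<close>. There the
  weights of \<open>e\<^bsup>ik1\<theta>\<^esup> r\<^bsup>k1\<^esup>\<close> are \<open>1\<close>, so the equations say that the weights of \<open>e\<^bsup>ik2\<theta>\<^esup> \<phi>\<close> are
  eventually periodic with period \<open>|k1|\<close>. Along an arithmetic progression they are then constant,
  and this means that \<open>\<phi>\<close> and \<open>c r\<^bsup>k2\<^esup>\<close> have the same moments along an arithmetic progression of
  exponents. By the Weierstrass approximation theorem the two functions agree almost everywhere
  (\<open>AE_radial_eq_0\<close>). As \<open>\<phi>\<close> is integrable and nonzero, \<open>r\<^bsup>k2\<^esup>\<close> is integrable over the disk, that is
  \<open>k2 > -2\<close>. Part (b) is part (a) for \<open>-k2\<close>, since replacing \<open>k\<close> by \<open>-k\<close> reverses the weight sequence.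

  That \<open>e\<^bsup>ik2\<theta>\<^esup> \<phi>\<close> defines a bounded operator at all has to be derived from the hypothesis on \<open>\<phi>\<close>.
  Applied to the monomials, boundedness of the radial operator bounds \<open>(m + 2) M(m)\<close> for even \<open>m\<close>.
  Because \<open>r\<^sup>m (1 - r) \<le> 1 / (m + 1)\<close>, consecutive moments of an integrable function differ by
  \<open>O(1/m)\<close>, so the bound extends to odd \<open>m\<close> (\<open>T_function_moment_bound\<close>), and every weight sequence of
  \<open>\<phi>\<close> is bounded.

  The passage between functions and coefficient sequences rests on two facts. A harmonic function on
  the disk is \<open>G + cnj H\<close> with \<open>G\<close> and \<open>H\<close> holomorphic, hence the sum of a series in the \<open>e\<^sub>n\<close>; and
  Parseval's identity holds for such a series, by orthogonality on smaller disks and monotone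
  convergence. All orthogonality relations come from the invariance of area under rotations.\<close>

section \<open>Area measure on the disk: rotations and radial integrals\<close>

lemma space_disk_area [simp]: "space disk_area = unit_disk"
  by (simp add: disk_area_def)

lemma sets_disk_area: "sets disk_area = sets (lebesgue_on unit_disk)"
  by (simp add: disk_area_def)

lemma measurable_disk_area:
  "borel_measurable disk_area = borel_measurable (lebesgue_on unit_disk)"
  by (rule measurable_cong_sets) (simp_all add: sets_disk_area)

lemma id_measurable_disk_area [measurable]: "(\<lambda>z. z) \<in> borel_measurable disk_area"
  unfolding measurable_disk_area by (rule continuous_imp_measurable_on_sets_lebesgue) auto

lemma finite_measure_disk_area: "finite_measure disk_area"
  by (rule finite_measureI) (simp add: emeasure_disk_area)

lemma emeasure_disk_area_eq:
  assumes "A \<in> sets disk_area"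
  shows "emeasure disk_area A = ennreal (1 / pi) * emeasure lebesgue A"
proof -
  have A: "A \<in> sets (lebesgue_on unit_disk)" using assms by (simp add: sets_disk_area)
  then have "A \<subseteq> unit_disk" using sets.sets_into_space by fastforce
  have "emeasure disk_area A = ennreal (1 / pi) * emeasure (lebesgue_on unit_disk) A"
    using A by (simp add: disk_area_def emeasure_density_const)
  also have "emeasure (lebesgue_on unit_disk) A = emeasure lebesgue A"
    using A \<open>A \<subseteq> unit_disk\<close> by (subst emeasure_restrict_space) auto
  finally show ?thesis .
qed

text \<open>Transfers the behaviour of Lebesgue measure under orthogonal maps, known on \<open>\<real>\<^sup>2\<close>, to \<open>\<complex>\<close>.\<close>
lemma distr_lborel_vec2_complex:
  "distr lborel borel (\<lambda>v::real^2. Complex (v$1) (v$2)) = lborel"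
proof (rule lborel_eqI[symmetric])
  let ?T = "\<lambda>v::real^2. Complex (v$1) (v$2)"
  have cont: "continuous_on UNIV ?T"
    by (simp add: Complex_eq) (intro continuous_intros)
  then have meas: "?T \<in> borel_measurable borel"
    by (rule borel_measurable_continuous_onI)
  fix l u :: complex assume lu: "\<And>b. b \<in> Basis \<Longrightarrow> l \<bullet> b \<le> u \<bullet> b"
  have le: "Re l \<le> Re u" "Im l \<le> Im u" using lu[of 1] lu[of \<i>] by (auto simp: Basis_complex_def)
  let ?a = "vector [Re l, Im l] :: real^2" and ?b = "vector [Re u, Im u] :: real^2"
  have pre: "?T -` box l u = box ?a ?b"
    by (auto simp: box_def Basis_complex_def Basis_vec_def inner_axis UNIV_2 inner_complex_def)
  have "emeasure (distr lborel borel ?T) (box l u) = emeasure lborel (box ?a ?b)"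
    using meas by (subst emeasure_distr) (auto simp: pre)
  also have "\<dots> = (\<Prod>b\<in>Basis. (?b - ?a) \<bullet> b)"
    by (subst emeasure_lborel_box) (use le in \<open>auto simp: Basis_vec_def inner_axis UNIV_2\<close>)
  also have "(\<Prod>b\<in>Basis. (?b - ?a) \<bullet> b) = (Re u - Re l) * (Im u - Im l)"
  proof -
    have B: "(Basis :: (real^2) set) = {axis 1 1, axis 2 1}"
      by (auto simp: Basis_vec_def UNIV_2)
    have "axis 1 1 \<noteq> (axis 2 1 :: real^2)" by (simp add: axis_eq_axis)
    then show ?thesis by (simp add: B inner_axis algebra_simps)
  qed
  also have "\<dots> = (\<Prod>b\<in>Basis. (u - l) \<bullet> b)"
    by (simp add: Basis_complex_def inner_complex_def)
  finally show "emeasure (distr lborel borel ?T) (box l u) = (\<Prod>b\<in>Basis. (u - l) \<bullet> b)" .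
qed simp

text \<open>Multiplication by \<open>c\<close> is an orthogonal map of the plane. Measures on \<open>\<complex>\<close> are determined by boxes,
  and the preimage of a box is carried to \<open>\<real>\<^sup>2\<close>, where it is the image of a box under a rotation.\<close>
lemma distr_lborel_rotation:
  fixes c :: complex assumes c: "norm c = 1"
  shows "distr lborel borel ((*) c) = lborel"
proof (rule lborel_eqI[symmetric])
  let ?T = "\<lambda>v::real^2. Complex (v$1) (v$2)"
  let ?U = "\<lambda>z. vector [Re z, Im z] :: real^2"
  let ?\<rho> = "\<lambda>v. ?U (cnj c * ?T v)"
  have TU: "?T (?U z) = z" for z by (simp add: complex_eq_iff)
  have UT: "?U (?T v) = v" for v by (simp add: vec_eq_iff forall_2)
  have cc: "c * cnj c = 1" using c by (simp add: complex_norm_square[symmetric])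
  then have cc': "cnj c * c = 1" by (simp add: mult.commute)
  have "linear ?\<rho>"
    by (rule linearI) (auto simp: vec_eq_iff forall_2 algebra_simps)
  moreover have nT: "norm (?T v) = norm v" for v
    by (simp add: norm_vec_def L2_set_def UNIV_2 cmod_def)
  then have "norm (?\<rho> v) = norm v" for v
    by (metis TU c complex_mod_cnj mult_1 norm_mult)
  ultimately have orth: "orthogonal_transformation ?\<rho>"
    by (simp add: orthogonal_transformation)
  have measT: "?T \<in> borel_measurable borel"
    by (intro borel_measurable_continuous_onI) (simp add: Complex_eq, intro continuous_intros)
  have measc: "(*) c \<in> borel_measurable borel" by measurable
  fix l u :: complex assume lu: "\<And>b. b \<in> Basis \<Longrightarrow> l \<bullet> b \<le> u \<bullet> b"
  define S where "S = ?T -` box l u"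
  have sS: "S \<in> sets borel" using measurable_sets[OF measT, of "box l u"] by (simp add: S_def)
  have eS: "emeasure lborel S = emeasure lborel (box l u)"
    using measT by (subst distr_lborel_vec2_complex[symmetric], subst emeasure_distr) (auto simp: S_def)
  then have "emeasure lborel S < \<infinity>" by (simp add: emeasure_lborel_box_eq)
  then have Sl: "S \<in> lmeasurable" using sS by (intro fmeasurableI) auto
  have img: "?T -` ((*) c -` box l u) = ?\<rho> ` S"
  proof (intro set_eqI iffI)
    fix v assume "v \<in> ?T -` ((*) c -` box l u)"
    then have S: "?U (c * ?T v) \<in> S" by (simp only: S_def vimage_eq TU)
    have "?\<rho> (?U (c * ?T v)) = v"
      by (simp only: TU mult.assoc[symmetric] cc' mult_1 UT)
    then show "v \<in> ?\<rho> ` S" using imageI[OF S, of ?\<rho>] by (simp only:)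
  next
    fix v assume "v \<in> ?\<rho> ` S"
    then obtain w where w: "w \<in> S" "v = ?\<rho> w" by blast
    then have "c * ?T v = ?T w" by (simp only: TU mult.assoc[symmetric] cc mult_1)
    with w show "v \<in> ?T -` ((*) c -` box l u)" by (simp only: S_def vimage_eq)
  qed
  have "emeasure (distr lborel borel ((*) c)) (box l u) = emeasure lborel ((*) c -` box l u)"
    using measc by (subst emeasure_distr) auto
  also have "\<dots> = emeasure lborel (?T -` ((*) c -` box l u))"
    using measT measurable_sets[OF measc, of "box l u"]
    by (subst distr_lborel_vec2_complex[symmetric], subst emeasure_distr) auto
  also have "\<dots> = emeasure lebesgue (?\<rho> ` S)"
    unfolding img[symmetric]
    using measurable_sets[OF measc, of "box l u"]
      measurable_sets[OF measT, of "(*) c -` box l u"] by simp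
  also have "\<dots> = emeasure lebesgue S"
    using measurable_orthogonal_image[OF orth Sl] measure_orthogonal_image[OF orth Sl] Sl
    by (simp add: emeasure_eq_measure2)
  also have "\<dots> = emeasure lborel (box l u)" using eS sS by simp
  also have "\<dots> = (\<Prod>b\<in>Basis. (u - l) \<bullet> b)"
    using lu by (subst emeasure_lborel_box) auto
  finally show "emeasure (distr lborel borel ((*) c)) (box l u) = (\<Prod>b\<in>Basis. (u - l) \<bullet> b)" .
qed simp

lemma distr_lebesgue_rotation:
  fixes c :: complex assumes c: "norm c = 1"
  shows "(*) c \<in> lebesgue \<rightarrow>\<^sub>M lebesgue" "distr lebesgue lebesgue ((*) c) = lebesgue"
proof -
  have b: "(*) c \<in> lborel \<rightarrow>\<^sub>M lborel" by simp
  have eq: "distr lebesgue lborel ((*) c) = lborel"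
    using distr_lborel_rotation[OF c] b
    by (simp add: distr_completion cong: distr_cong)
  then have null: "null_sets (distr lebesgue lborel ((*) c)) = null_sets lborel" by simp
  show "(*) c \<in> lebesgue \<rightarrow>\<^sub>M lebesgue"
    using b by (simp add: completion.measurable_completion2 null measurable_completion)
  show "distr lebesgue lebesgue ((*) c) = lebesgue"
    using completion.completion_distr_eq[OF measurable_completion[OF b] null] eq by simp
qed

lemma rotation_disk_area:
  fixes c :: complex assumes c: "norm c = 1"
  shows measurable_rotation_disk_area: "(*) c \<in> disk_area \<rightarrow>\<^sub>M disk_area"
    and distr_disk_area_rotation: "distr disk_area disk_area ((*) c) = disk_area"
proof -
  have sets_iff: "A \<in> sets disk_area \<longleftrightarrow> A \<in> sets lebesgue \<and> A \<subseteq> unit_disk" for A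
    by (auto simp: sets_disk_area sets_restrict_space_iff)
  have pre: "(*) c -` A \<in> sets disk_area" if "A \<in> sets disk_area" for A
    using that c measurable_sets[OF distr_lebesgue_rotation(1)[OF c], of A]
    by (auto simp: sets_iff norm_mult subset_iff)
  show m: "(*) c \<in> disk_area \<rightarrow>\<^sub>M disk_area"
  proof (rule measurableI)
    show "(*) c -` A \<inter> space disk_area \<in> sets disk_area" if "A \<in> sets disk_area" for A
      using pre[OF that] sets.top[of disk_area] by (intro sets.Int) auto
  qed (use c in \<open>auto simp: norm_mult\<close>)
  show "distr disk_area disk_area ((*) c) = disk_area"
  proof (rule measure_eqI)
    fix A assume "A \<in> sets (distr disk_area disk_area ((*) c))"
    then have A: "A \<in> sets disk_area" by simp
    have "(*) c -` A \<inter> space disk_area = (*) c -` A"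
      using pre[OF A] by (auto simp: sets_iff)
    then have "emeasure (distr disk_area disk_area ((*) c)) A = emeasure disk_area ((*) c -` A)"
      using A m by (simp add: emeasure_distr)
    also have "\<dots> = ennreal (1 / pi) * emeasure lebesgue ((*) c -` A)"
      by (rule emeasure_disk_area_eq[OF pre[OF A]])
    also have "emeasure lebesgue ((*) c -` A) = emeasure (distr lebesgue lebesgue ((*) c)) A"
      using A distr_lebesgue_rotation(1)[OF c] by (subst emeasure_distr) (auto simp: sets_iff)
    also have "ennreal (1 / pi) * \<dots> = emeasure disk_area A"
      by (simp add: distr_lebesgue_rotation(2)[OF c] emeasure_disk_area_eq[OF A])
    finally show "emeasure (distr disk_area disk_area ((*) c)) A = emeasure disk_area A" .
  qed simp
qed

lemma integral_disk_area_rotate: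
  fixes f :: "complex \<Rightarrow> complex"
  assumes "norm c = 1" "f \<in> borel_measurable disk_area"
  shows "(\<integral>z. f (c * z) \<partial>disk_area) = (\<integral>z. f z \<partial>disk_area)"
  using integral_distr[OF measurable_rotation_disk_area[OF assms(1)] assms(2)]
  by (simp add: distr_disk_area_rotation[OF assms(1)])
lemma emeasure_disk_area_norm_le:
  assumes "0 \<le> r" "r \<le> 1"
  shows "emeasure disk_area {z \<in> unit_disk. norm z \<le> r} = ennreal (r\<^sup>2)"
proof (cases "r = 1")
  case True
  then have "{z \<in> unit_disk. norm z \<le> r} = unit_disk" by auto
  with True show ?thesis by (simp add: emeasure_disk_area)
next
  case False
  with assms have eq: "{z \<in> unit_disk. norm z \<le> r} = cball 0 r" by auto
  have "cball (0::complex) r \<in> sets disk_area"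
    using False assms by (auto simp: sets_disk_area sets_restrict_space_iff)
  then have "emeasure disk_area (cball 0 r) = ennreal (1 / pi) * emeasure lebesgue (cball (0::complex) r)"
    by (rule emeasure_disk_area_eq)
  also have "\<dots> = ennreal (1 / pi) * ennreal (pi * r\<^sup>2)"
    using assms by (simp add: emeasure_cball eval_unit_ball_vol)
  also have "\<dots> = ennreal (r\<^sup>2)"
    using assms by (simp flip: ennreal_mult)
  finally show ?thesis by (simp only: eq)
qed

text \<open>Polar coordinates for radial functions: the disk of radius \<open>a \<le> 1\<close> has measure \<open>a\<^sup>2\<close>, so \<open>|z|\<close> is
  distributed with density \<open>2r\<close> on \<open>[0,1]\<close>.\<close>
lemma distr_disk_area_norm:
  "distr disk_area borel norm = density lborel (\<lambda>r. ennreal (indicator {0..1} r * (2 * r)))"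
    (is "?L = ?R")
proof (rule measure_eqI_generator_eq)
  let ?E = "range (atMost :: real \<Rightarrow> _)"
  show "Int_stable ?E" by (auto simp: Int_stable_def)
  show "?E \<subseteq> Pow UNIV" "sets ?L = sigma_sets UNIV ?E" "sets ?R = sigma_sets UNIV ?E"
    by (simp_all add: borel_eq_atMost)
  show "range (\<lambda>n::nat. {..real n}) \<subseteq> ?E" by auto
  show "(\<Union>n. {..real n}) = UNIV"
    by (auto intro: real_arch_simple)
  have L: "emeasure ?L {..a} = emeasure disk_area {z \<in> unit_disk. norm z \<le> a}" for a
    by (subst emeasure_distr) (auto intro!: arg_cong[where f = "emeasure disk_area"])
  show "emeasure ?L {..real n} \<noteq> \<infinity>" for n
    using finite_measure.emeasure_finite[OF finite_measure_disk_area] by (simp add: L top_unique)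
  fix X :: "real set" assume "X \<in> ?E"
  then obtain a where X: "X = {..a}" by auto
  show "emeasure ?L X = emeasure ?R X"
  proof (cases "a < 0")
    case True
    then have "{z \<in> unit_disk. norm z \<le> a} = {}" by (auto simp: not_le intro: less_le_trans)
    moreover have "indicator {0..1} r * (2 * r) * indicator {..a} r = (0::real)" for r
      using True by (auto simp: indicator_def)
    then have "(\<integral>\<^sup>+ r. ennreal (indicator {0..1} r * (2 * r) * indicator {..a} r) \<partial>lborel) = 0"
      by (simp only:) simp
    then have "emeasure ?R {..a} = 0"
      by (subst emeasure_density) (auto simp: ennreal_indicator[symmetric] ennreal_mult''[symmetric])
    ultimately show ?thesis by (simp only: X L) simp
  next
    case False
    define b where "b = min a 1"
    have b: "0 \<le> b" "b \<le> 1" using False by (auto simp: b_def)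
    have "{z \<in> unit_disk. norm z \<le> a} = {z \<in> unit_disk. norm z \<le> b}"
      by (auto simp: b_def)
    then have 1: "emeasure ?L X = ennreal (b\<^sup>2)"
      using emeasure_disk_area_norm_le[OF b] by (simp add: X L)
    have "((\<lambda>r. 2 * r) has_integral b\<^sup>2 - 0\<^sup>2) {0..b}"
      by (rule fundamental_theorem_of_calculus[OF b(1)])
        (auto intro!: derivative_eq_intros simp: has_real_derivative_iff_has_vector_derivative[symmetric])
    then have "(\<integral>\<^sup>+ r. ennreal (indicator {0..b} r * (2 * r)) \<partial>lborel) = ennreal (b\<^sup>2)"
      by (intro nn_integral_has_integral_lebesgue) auto
    moreover have "emeasure ?R X = (\<integral>\<^sup>+ r. ennreal (indicator {0..b} r * (2 * r)) \<partial>lborel)"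
      unfolding X
      by (subst emeasure_density)
        (auto intro!: nn_integral_cong simp: indicator_def b_def ennreal_indicator[symmetric] ennreal_mult''[symmetric])
    ultimately show ?thesis using 1 by simp
  qed
qed

lemma nn_integral_norm_powr:
  assumes "s > -2"
  shows "(\<integral>\<^sup>+ z. ennreal (norm z powr s) \<partial>disk_area) = ennreal (2 / (s + 2))"
proof -
  have "(\<integral>\<^sup>+ z. ennreal (norm z powr s) \<partial>disk_area) = (\<integral>\<^sup>+ r. ennreal (r powr s) \<partial>distr disk_area borel norm)"
    by (subst nn_integral_distr) auto
  also have "\<dots> = (\<integral>\<^sup>+ r. ennreal (indicator {0..1} r * (2 * r)) * ennreal (r powr s) \<partial>lborel)"
    unfolding distr_disk_area_norm by (subst nn_integral_density) auto
  also have "\<dots> = (\<integral>\<^sup>+ r. ennreal (indicator {0..1} r * (2 * r powr (s + 1))) \<partial>lborel)"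
  proof (rule nn_integral_cong)
    fix r :: real
    have "r * r powr s = r powr (s + 1)" if "r \<ge> 0"
      using that by (cases "r = 0") (auto simp: powr_add)
    then show "ennreal (indicator {0..1} r * (2 * r)) * ennreal (r powr s)
        = ennreal (indicator {0..1} r * (2 * r powr (s + 1)))"
      by (auto simp: indicator_def ennreal_mult''[symmetric])
  qed
  also have "\<dots> = ennreal (2 / (s + 2))"
  proof (rule nn_integral_has_integral_lebesgue)
    have "((\<lambda>r. 2 * r powr (s + 1)) has_integral 2 * (1 powr (s + 1 + 1) / (s + 1 + 1))) {0..1}"
      by (intro has_integral_mult_right has_integral_powr_from_0) (use assms in auto)
    then show "((\<lambda>r. 2 * r powr (s + 1)) has_integral 2 / (s + 2)) {0..1}" by (simp add: add.assoc)
  qed auto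
  finally show ?thesis .
qed

text \<open>Non-integrability at and below the exponent \<open>-2\<close> follows from the values above it: the
  integral would dominate \<open>2 / d\<close> for every \<open>d > 0\<close>.\<close>
lemma integrable_norm_powr_iff: "integrable disk_area (\<lambda>z. norm z powr s) \<longleftrightarrow> s > -2"
proof
  assume "s > -2"
  then show "integrable disk_area (\<lambda>z. norm z powr s)"
    by (intro integrableI_bounded) (use nn_integral_norm_powr[of s] in \<open>auto\<close>)
next
  assume int: "integrable disk_area (\<lambda>z. norm z powr s)"
  show "s > -2"
  proof (rule ccontr)
    assume "\<not> s > -2"
    define I where "I = (\<integral>z. norm z powr s \<partial>disk_area)"
    have I: "(\<integral>\<^sup>+ z. ennreal (norm z powr s) \<partial>disk_area) = ennreal I"
      unfolding I_def by (rule nn_integral_eq_integral[OF int]) auto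
    have "I \<ge> 0" unfolding I_def by simp
    have *: "2 / d \<le> I" if "d > 0" for d
    proof -
      have "ennreal (2 / d) = (\<integral>\<^sup>+ z. ennreal (norm z powr (d - 2)) \<partial>disk_area)"
        using nn_integral_norm_powr[of "d - 2"] that by simp
      also have "\<dots> \<le> (\<integral>\<^sup>+ z. ennreal (norm z powr s) \<partial>disk_area)"
        using \<open>\<not> s > -2\<close> that
        by (intro nn_integral_mono ennreal_leI powr_mono') auto
      finally show ?thesis using \<open>I \<ge> 0\<close> by (simp add: I)
    qed
    \<comment> \<open>the choice \<open>d = 1 / (I + 1)\<close> gives \<open>2 (I + 1) \<le> I\<close>\<close>
    have "2 / (1 / (I + 1)) \<le> I" by (rule *) (use \<open>I \<ge> 0\<close> in auto)
    then show False using \<open>I \<ge> 0\<close> by simp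
  qed
qed

lemma integral_norm_powr:
  assumes "s > -2"
  shows "(\<integral>z. norm z powr s \<partial>disk_area) = 2 / (s + 2)"
  using assms by (intro integral_eq_nn_integral[THEN trans])
    (auto simp: nn_integral_norm_powr)

lemma AE_disk_area_nonzero: "AE z in disk_area. z \<in> unit_disk \<and> z \<noteq> 0"
proof -
  have "emeasure disk_area {z \<in> unit_disk. norm z \<le> 0} = 0"
    using emeasure_disk_area_norm_le[of 0] by simp
  moreover have "{z \<in> unit_disk. norm z \<le> 0} = {0::complex}" by auto
  ultimately have "{0::complex} \<in> null_sets disk_area"
    by (auto simp: null_sets_def sets_disk_area sets_restrict_space_iff)
  then have "AE z in disk_area. z \<notin> {0}" by (rule AE_not_in)
  moreover have "AE z in disk_area. z \<in> unit_disk" by (rule AE_I2) simp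
  ultimately show ?thesis by eventually_elim auto
qed

lemma borel_measurable_powi [measurable (raw)]:
  fixes f :: "'a \<Rightarrow> 'b :: {real_normed_div_algebra, second_countable_topology}"
  assumes "f \<in> borel_measurable M"
  shows "(\<lambda>x. f x powi k) \<in> borel_measurable M"
  unfolding power_int_def using assms by (cases "k \<ge> 0") auto

lemma AE_norm_powi_eq_powr: "AE z in disk_area. norm z powi k = norm z powr real_of_int k"
  using AE_disk_area_nonzero by eventually_elim (simp add: powr_real_of_int')

lemma integrable_norm_powi_iff:
  "integrable disk_area (\<lambda>z. norm z powi k) \<longleftrightarrow> k > -2"
proof -
  have "integrable disk_area (\<lambda>z. norm z powi k) \<longleftrightarrow> integrable disk_area (\<lambda>z. norm z powr real_of_int k)"
    by (intro integrable_cong_AE AE_norm_powi_eq_powr) measurable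
  also have "\<dots> \<longleftrightarrow> k > -2"
    unfolding integrable_norm_powr_iff by linarith
  finally show ?thesis .
qed

lemma integral_norm_powi:
  assumes "k > -2"
  shows "(\<integral>z. norm z powi k \<partial>disk_area) = 2 / (real_of_int k + 2)"
proof -
  have "(\<integral>z. norm z powi k \<partial>disk_area) = (\<integral>z. norm z powr real_of_int k \<partial>disk_area)"
    by (intro integral_cong_AE AE_norm_powi_eq_powr) measurable
  also have "\<dots> = 2 / (real_of_int k + 2)" using assms by (intro integral_norm_powr) simp
  finally show ?thesis .
qed

section \<open>Harmonic monomials and vanishing moments\<close>

text \<open>The harmonic monomial \<open>r\<^bsup>|n|\<^esup> e\<^bsup>in\<theta>\<^esup>\<close>.\<close>
definition hmono :: "int \<Rightarrow> complex \<Rightarrow> complex" where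
  "hmono n z = (if n \<ge> 0 then z ^ nat n else cnj z ^ nat (-n))"

lemma norm_hmono: "norm (hmono n z) = norm z ^ nat \<bar>n\<bar>"
  by (simp add: hmono_def norm_power)

lemma cnj_hmono: "cnj (hmono n z) = hmono (-n) z"
  by (auto simp: hmono_def)

lemma continuous_on_hmono [continuous_intros]: "continuous_on S (hmono n)"
  unfolding hmono_def by (cases "n \<ge> 0") (auto intro!: continuous_intros)

lemma hmono_rotate:
  assumes "norm c = 1"
  shows "hmono n (c * z) = c powi n * hmono n z"
proof -
  have "c * cnj c = 1" using assms by (simp add: complex_norm_square[symmetric])
  then have "cnj c = inverse c" by (metis inverse_unique)
  then show ?thesis by (simp add: hmono_def power_int_def power_mult_distrib)
qed

text \<open>A rotation by the angle \<open>\<pi>/m\<close> changes the sign of \<open>f\<close> and preserves area. The origin is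
  excluded because \<open>e\<^bsup>ik\<theta>\<^esup> \<phi>(r)\<close> has the value \<open>\<phi>(0)\<close> there, which is not homogeneous.\<close>
lemma integral_homogeneous_eq_0:
  fixes f :: "complex \<Rightarrow> complex"
  assumes f [measurable]: "f \<in> borel_measurable disk_area" and m: "m \<noteq> 0"
    and hom: "\<And>c z. norm c = 1 \<Longrightarrow> z \<in> unit_disk \<Longrightarrow> z \<noteq> 0 \<Longrightarrow> f (c * z) = c powi m * f z"
  shows "(\<integral>z. f z \<partial>disk_area) = 0"
proof -
  define c where "c = cis (pi / of_int m)"
  have c: "norm c = 1" "c powi m = -1"
    using m by (simp_all add: c_def cis_power_int)
  note [measurable] = measurable_rotation_disk_area[OF c(1)]
  have "(\<integral>z. f z \<partial>disk_area) = (\<integral>z. f (c * z) \<partial>disk_area)"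
    using c f by (simp add: integral_disk_area_rotate)
  also have "\<dots> = (\<integral>z. - f z \<partial>disk_area)"
  proof (rule integral_cong_AE)
    show "AE z in disk_area. f (c * z) = - f z"
      using AE_disk_area_nonzero by eventually_elim (simp add: hom c)
  qed measurable
  finally show ?thesis by simp
qed

lemma integrable_disk_area_mult_bounded:
  fixes g h :: "complex \<Rightarrow> complex"
  assumes "integrable disk_area g" "h \<in> borel_measurable disk_area"
    and "\<And>z. z \<in> unit_disk \<Longrightarrow> norm (h z) \<le> B"
  shows "integrable disk_area (\<lambda>z. g z * h z)"
proof (rule Bochner_Integration.integrable_bound)
  show "integrable disk_area (\<lambda>z. B * norm (g z))" using assms(1) by simp
  show "(\<lambda>z. g z * h z) \<in> borel_measurable disk_area"
    using assms by (intro borel_measurable_times) auto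
  have "norm (g z * h z) \<le> norm (B * norm (g z))" if "z \<in> unit_disk" for z
  proof -
    have "0 \<le> B" using assms(3)[OF that] norm_ge_zero order_trans by blast
    then show ?thesis
      using mult_left_mono[OF assms(3)[OF that], of "norm (g z)"] by (simp add: norm_mult mult.commute)
  qed
  then show "AE z in disk_area. norm (g z * h z) \<le> norm (B * norm (g z))"
    by (intro AE_I2) simp
qed

lemma continuous_measurable_disk_area:
  fixes h :: "complex \<Rightarrow> 'b :: euclidean_space"
  assumes "continuous_on unit_disk h"
  shows "h \<in> borel_measurable disk_area"
  unfolding measurable_disk_area
  by (rule continuous_imp_measurable_on_sets_lebesgue) (use assms in auto)

lemma integrable_disk_area_mult_continuous:
  fixes g h :: "complex \<Rightarrow> complex"
  assumes "integrable disk_area g" "continuous_on (cball 0 1) h"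
  shows "integrable disk_area (\<lambda>z. g z * h z)"
proof -
  have "compact (h ` cball 0 1)" by (rule compact_continuous_image) (use assms in auto)
  then obtain B where "\<And>z. z \<in> cball 0 1 \<Longrightarrow> norm (h z) \<le> B"
    using compact_imp_bounded bounded_iff by (metis image_eqI)
  moreover have "h \<in> borel_measurable disk_area"
    by (rule continuous_measurable_disk_area) (use assms continuous_on_subset in fastforce)
  ultimately show ?thesis using assms(1)
    by (intro integrable_disk_area_mult_bounded[where B = B]) auto
qed

lemma integral_eq_0_approx:
  fixes g f :: "complex \<Rightarrow> complex"
  assumes g: "integrable disk_area g" and f: "continuous_on (cball 0 1) f"
    and approx: "\<And>e. e > 0 \<Longrightarrow> \<exists>p. continuous_on (cball 0 1) p \<and>
        (\<forall>z\<in>unit_disk. norm (f z - p z) \<le> e) \<and> (\<integral>z. g z * p z \<partial>disk_area) = 0"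
  shows "(\<integral>z. g z * f z \<partial>disk_area) = 0"
proof -
  define I where "I = (\<integral>z. norm (g z) \<partial>disk_area)"
  have "I \<ge> 0" by (simp add: I_def)
  have "norm (\<integral>z. g z * f z \<partial>disk_area) \<le> e" if "e > 0" for e
  proof -
    have e': "e / (I + 1) > 0" using \<open>I \<ge> 0\<close> that by simp
    obtain p where p: "continuous_on (cball 0 1) p" "\<And>z. z \<in> unit_disk \<Longrightarrow> norm (f z - p z) \<le> e / (I + 1)"
      "(\<integral>z. g z * p z \<partial>disk_area) = 0" using approx[OF e'] by blast
    have int: "integrable disk_area (\<lambda>z. g z * (f z - p z))"
      by (intro integrable_disk_area_mult_continuous g continuous_intros f p)
    have "(\<integral>z. g z * f z \<partial>disk_area) = (\<integral>z. g z * (f z - p z) \<partial>disk_area)"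
      using integrable_disk_area_mult_continuous[OF g f] integrable_disk_area_mult_continuous[OF g p(1)] p(3)
      by (simp add: right_diff_distrib)
    also have "norm \<dots> \<le> (\<integral>z. norm (g z * (f z - p z)) \<partial>disk_area)"
      by (rule integral_norm_bound)
    also have "\<dots> \<le> (\<integral>z. norm (g z) * (e / (I + 1)) \<partial>disk_area)"
    proof (rule integral_mono)
      show "integrable disk_area (\<lambda>z. norm (g z) * (e / (I + 1)))" using g by simp
      show "norm (g z * (f z - p z)) \<le> norm (g z) * (e / (I + 1))" if "z \<in> space disk_area" for z
        unfolding norm_mult using p(2) that by (intro mult_left_mono) auto
    qed (use int in simp)
    also have "\<dots> = I * (e / (I + 1))" by (simp add: I_def)
    also have "\<dots> \<le> e" using \<open>I \<ge> 0\<close> that by (simp add: field_simps)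
    finally show ?thesis .
  qed
  then have "norm (\<integral>z. g z * f z \<partial>disk_area) \<le> 0" by (rule field_le_epsilon[where y = 0, simplified]) 
  then show ?thesis by simp
qed

text \<open>The functions \<open>h\<close> for which \<open>g h\<close> is orthogonal to all \<open>z\<^sup>a cnj z\<^sup>b\<close> are closed under sums and under
  multiplication by \<open>z\<close> and \<open>cnj z\<close>. So they are closed under multiplication by real polynomials in
  the two real coordinates, which is proved by induction on the polynomial.\<close>
lemma integral_polynomial_eq_0:
  fixes g :: "complex \<Rightarrow> complex"
  assumes g: "integrable disk_area g"
    and mom: "\<And>a b. (\<integral>z. g z * (z ^ a * cnj z ^ b) \<partial>disk_area) = 0"
    and p: "real_polynomial_function p"
  shows "(\<integral>z. g z * of_real (p z) \<partial>disk_area) = 0"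
proof -
  define V where "V h \<longleftrightarrow> continuous_on UNIV h \<and>
     (\<forall>a b. (\<integral>z. g z * (h z * (z ^ a * cnj z ^ b)) \<partial>disk_area) = 0)" for h
  have int: "integrable disk_area (\<lambda>z. g z * h z)" if "continuous_on UNIV h" for h
    using g that by (intro integrable_disk_area_mult_continuous) (auto intro: continuous_on_subset)
  have V_add: "V (\<lambda>z. h z + k z)" if "V h" "V k" for h k
    using that unfolding V_def
    by (auto simp: distrib_left distrib_right intro!: continuous_intros)
       (subst Bochner_Integration.integral_add; auto intro!: int continuous_intros)
  have V_scale: "V (\<lambda>z. h z * c)" if "V h" for h c
  proof -
    have eq: "g z * (h z * c * (z ^ a * cnj z ^ b)) = g z * (h z * (z ^ a * cnj z ^ b)) * c" for z a b
      by (simp add: mult_ac)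
    show ?thesis using that unfolding V_def eq by (auto intro!: continuous_intros simp del: power_Suc)
  qed
  have V_z: "V (\<lambda>z. h z * z)" if "V h" for h
  proof -
    have eq: "g z * (h z * z * (z ^ a * cnj z ^ b)) = g z * (h z * (z ^ Suc a * cnj z ^ b))" for z a b
      by (simp add: mult_ac)
    show ?thesis using that unfolding V_def eq by (auto intro!: continuous_intros simp del: power_Suc)
  qed
  have V_cnj: "V (\<lambda>z. h z * cnj z)" if "V h" for h
  proof -
    have eq: "g z * (h z * cnj z * (z ^ a * cnj z ^ b)) = g z * (h z * (z ^ a * cnj z ^ Suc b))" for z a b
      by (simp add: mult_ac)
    show ?thesis using that unfolding V_def eq by (auto intro!: continuous_intros simp del: power_Suc)
  qed
  have "\<forall>h. V h \<longrightarrow> V (\<lambda>z. h z * of_real (p z))"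
    using p
  proof induction
    case (linear f)
    define \<alpha> where "\<alpha> = Complex (f 1 / 2) (- f \<i> / 2)"
    have fz: "f z = Re z * f 1 + Im z * f \<i>" for z
    proof -
      have "f z = f (Re z *\<^sub>R 1 + Im z *\<^sub>R \<i>)"
        by (rule arg_cong[where f = f]) (simp add: complex_eq_iff)
      also have "\<dots> = Re z * f 1 + Im z * f \<i>"
        by (simp add: linear_simps[OF linear])
      finally show ?thesis .
    qed
    have f: "of_real (f z) = z * \<alpha> + cnj z * cnj \<alpha>" for z
      by (subst fz) (simp add: \<alpha>_def complex_eq_iff)
    show ?case
    proof (intro allI impI)
      fix h assume h: "V h"
      have "V (\<lambda>z. (h z * z) * \<alpha> + (h z * cnj z) * cnj \<alpha>)"
        by (intro V_add V_scale V_z V_cnj h)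
      then show "V (\<lambda>z. h z * of_real (f z))" by (simp add: f algebra_simps)
    qed
  next
    case (const c)
    show ?case using V_scale by blast
  next
    case (add f1 f2)
    then show ?case using V_add by (simp add: distrib_left)
  next
    case (mult f1 f2)
    show ?case
    proof (intro allI impI)
      fix h assume "V h"
      then have "V (\<lambda>z. h z * of_real (f1 z) * of_real (f2 z))" using mult.IH by blast
      then show "V (\<lambda>z. h z * of_real (f1 z * f2 z))" by (simp add: mult.assoc)
    qed
  qed
  moreover have "V (\<lambda>_. 1)" using mom by (simp add: V_def)
  ultimately have V: "V (\<lambda>z. 1 * of_real (p z))" by blast
  show ?thesis
    using V[unfolded V_def, THEN conjunct2, rule_format, of 0 0] by simp
qed

text \<open>By the Stone--Weierstrass theorem \<open>g\<close> is orthogonal to all continuous functions. A measurable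
  function is an almost everywhere limit of continuous ones; taking such a sequence for the
  unimodular function \<open>cnj (sgn g)\<close>, cut off to have modulus at most \<open>1\<close>, dominated convergence
  yields that the integral of \<open>|g|\<close> is zero.\<close>
lemma AE_eq_0_if_moments_eq_0:
  fixes g :: "complex \<Rightarrow> complex"
  assumes g: "integrable disk_area g"
    and mom: "\<And>a b. (\<integral>z. g z * (z ^ a * cnj z ^ b) \<partial>disk_area) = 0"
  shows "AE z in disk_area. g z = 0"
proof -
  have real0: "(\<integral>z. g z * of_real (f z) \<partial>disk_area) = 0" if f: "continuous_on UNIV f" for f :: "complex \<Rightarrow> real"
  proof (rule integral_eq_0_approx[OF g])
    show "continuous_on (cball 0 1) (\<lambda>z. complex_of_real (f z))"
      by (intro continuous_intros continuous_on_subset[OF f]) auto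
    fix e :: real assume "e > 0"
    have "compact (cball (0::complex) 1)" by simp
    moreover have "continuous_on (cball 0 1) f" using f continuous_on_subset by blast
    ultimately obtain p where p: "real_polynomial_function p" "\<And>z. z \<in> cball 0 1 \<Longrightarrow> \<bar>f z - p z\<bar> < e"
      using Stone_Weierstrass_real_polynomial_function \<open>e > 0\<close> by metis
    show "\<exists>p. continuous_on (cball 0 1) p \<and> (\<forall>z\<in>unit_disk. norm (complex_of_real (f z) - p z) \<le> e) \<and>
          (\<integral>z. g z * p z \<partial>disk_area) = 0"
    proof (intro exI[of _ "\<lambda>z. of_real (p z)"] conjI ballI)
      show "continuous_on (cball 0 1) (\<lambda>z. complex_of_real (p z))"
        using continuous_real_polymonial_function[OF p(1)]
        by (intro continuous_intros continuous_at_imp_continuous_on) auto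
      show "norm (complex_of_real (f z) - of_real (p z)) \<le> e" if "z \<in> unit_disk" for z
        using p(2)[of z] that by (simp flip: of_real_diff)
      show "(\<integral>z. g z * of_real (p z) \<partial>disk_area) = 0"
        by (rule integral_polynomial_eq_0[OF g mom p(1)])
    qed
  qed
  have cplx0: "(\<integral>z. g z * h z \<partial>disk_area) = 0" if h: "continuous_on UNIV h" for h :: "complex \<Rightarrow> complex"
  proof -
    have c: "continuous_on UNIV (\<lambda>z. Re (h z))" "continuous_on UNIV (\<lambda>z. Im (h z))"
      using h by (auto intro!: continuous_intros)
    have i: "integrable disk_area (\<lambda>z. g z * of_real (Re (h z)))"
      "integrable disk_area (\<lambda>z. g z * of_real (Im (h z)))"
      by (intro integrable_disk_area_mult_continuous[OF g] continuous_on_of_real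
          continuous_on_subset[OF c(1)] continuous_on_subset[OF c(2)]; simp)+
    have "g z * h z = g z * of_real (Re (h z)) + g z * of_real (Im (h z)) * \<i>" for z
      by (simp add: complex_eq_iff algebra_simps)
    then show ?thesis using i real0[OF c(1)] real0[OF c(2)] by simp
  qed
  define s where "s z = cnj (sgn (g z))" for z
  have gm: "g \<in> borel_measurable disk_area" using g by simp
  then have "(\<lambda>z. sgn (g z)) \<in> borel_measurable disk_area" unfolding sgn_div_norm
    by (intro borel_measurable_scaleR borel_measurable_inverse
        measurable_compose[OF _ borel_measurable_norm])
  moreover have "cnj \<in> borel_measurable borel"
    by (rule borel_measurable_continuous_onI[OF linear_continuous_on[OF bounded_linear_cnj]])
  ultimately have sm: "s \<in> borel_measurable disk_area" unfolding s_def by (rule measurable_compose)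
  then have "s measurable_on unit_disk"
    by (subst measurable_on_iff_borel_measurable) (auto simp: measurable_disk_area)
  then obtain N h where N: "negligible N" and h: "\<And>n. continuous_on UNIV (h n)"
    and lim: "\<And>z. z \<notin> N \<Longrightarrow> (\<lambda>n. h n z) \<longlonglongrightarrow> (if z \<in> unit_disk then s z else 0)"
    unfolding measurable_on_def by blast
  \<comment> \<open>cutting off at modulus \<open>1\<close> keeps the limit, since \<open>|s| \<le> 1\<close>, and provides a dominating function\<close>
  define h' where "h' n z = h n z / of_real (max 1 (norm (h n z)))" for n z
  have h'c: "continuous_on UNIV (h' n)" for n
    unfolding h'_def using h by (auto intro!: continuous_intros)
  have h'n: "norm (h' n z) \<le> 1" for n z
    by (simp add: h'_def norm_divide field_simps)
  have "AE z in lebesgue. z \<notin> N"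
    using N by (intro AE_not_in) (simp add: negligible_iff_null_sets)
  then have "AE z in lebesgue_on unit_disk. z \<notin> N"
    by (subst AE_restrict_space_iff) auto
  then have "AE z in disk_area. z \<notin> N"
    unfolding disk_area_def by (subst AE_density) auto
  then have AE: "AE z in disk_area. z \<notin> N \<and> z \<in> unit_disk"
    using AE_disk_area_nonzero by eventually_elim simp
  have "(\<lambda>n. \<integral>z. g z * h' n z \<partial>disk_area) \<longlonglongrightarrow> (\<integral>z. g z * s z \<partial>disk_area)"
  proof (rule integral_dominated_convergence[where w = "\<lambda>z. norm (g z)"])
    show "AE z in disk_area. (\<lambda>n. g z * h' n z) \<longlonglongrightarrow> g z * s z"
      using AE
    proof eventually_elim
      case (elim z)
      then have "(\<lambda>n. h n z) \<longlonglongrightarrow> s z" using lim[of z] by simp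
      then have "(\<lambda>n. h' n z) \<longlonglongrightarrow> s z / of_real (max 1 (norm (s z)))"
        unfolding h'_def by (intro tendsto_intros) auto
      moreover have "norm (s z) \<le> 1" by (simp add: s_def norm_sgn)
      ultimately have "(\<lambda>n. h' n z) \<longlonglongrightarrow> s z" by (simp add: max_absorb1)
      then show ?case by (intro tendsto_intros)
    qed
    show "AE z in disk_area. norm (g z * h' n z) \<le> norm (g z)" for n
      using h'n by (intro AE_I2) (simp add: norm_mult mult_left_le)
    show "(\<lambda>z. g z * h' n z) \<in> borel_measurable disk_area" for n
      using gm continuous_measurable_disk_area[OF continuous_on_subset[OF h'c]] by measurable
  qed (use g gm sm in auto)
  then have "(\<integral>z. g z * s z \<partial>disk_area) = 0"
    using cplx0[OF h'c] by (simp add: LIMSEQ_const_iff)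
  moreover have "g z * s z = of_real (norm (g z))" for z
    by (cases "g z = 0") (auto simp: s_def sgn_div_norm scaleR_conv_of_real complex_norm_square[symmetric] power2_eq_square field_simps)
  ultimately have "(\<integral>z. norm (g z) \<partial>disk_area) = 0" by simp
  then show ?thesis
    using g by (subst (asm) integral_nonneg_eq_0_iff_AE) auto
qed

text \<open>A radial function is orthogonal to \<open>z\<^sup>a cnj z\<^sup>b\<close> for \<open>a \<noteq> b\<close> by rotation. For \<open>a = b\<close> the function
  \<open>|z|\<^bsup>2a\<^esup>\<close> is a continuous function of \<open>|z|\<^bsup>2k\<^esup>\<close>, hence by Weierstrass a uniform limit of polynomials
  in \<open>|z|\<^bsup>2k\<^esup>\<close>. So the moments along one arithmetic progression determine all of them.\<close>
lemma AE_radial_eq_0: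
  fixes \<psi> :: "real \<Rightarrow> complex"
  assumes \<psi>: "integrable disk_area (\<lambda>z. \<psi> (norm z))" and k: "k > 0"
    and mom: "\<And>j. (\<integral>z. \<psi> (norm z) * of_real (norm z ^ (2 * k * j)) \<partial>disk_area) = 0"
  shows "AE z in disk_area. \<psi> (norm z) = 0"
proof (rule AE_eq_0_if_moments_eq_0[OF \<psi>])
  fix a b :: nat
  show "(\<integral>z. \<psi> (norm z) * (z ^ a * cnj z ^ b) \<partial>disk_area) = 0"
  proof (cases "a = b")
    case False
    have \<psi>m [measurable]: "(\<lambda>z. \<psi> (norm z)) \<in> borel_measurable disk_area" using \<psi> by simp
    show ?thesis
    proof (rule integral_homogeneous_eq_0[where m = "int a - int b"])
      have "(\<lambda>z. z ^ a * cnj z ^ b) \<in> borel_measurable disk_area" 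
        by (intro continuous_measurable_disk_area continuous_intros)
      then show "(\<lambda>z. \<psi> (norm z) * (z ^ a * cnj z ^ b)) \<in> borel_measurable disk_area"
        by measurable
      fix c z :: complex assume c: "norm c = 1"
      have "c * cnj c = 1" using c by (simp add: complex_norm_square[symmetric])
      then have "cnj c = inverse c" by (metis inverse_unique)
      then have "c powi (int a - int b) = c ^ a * cnj c ^ b"
        using c by (subst power_int_diff) (auto simp: field_simps)
      then show "\<psi> (norm (c * z)) * ((c * z) ^ a * cnj (c * z) ^ b)
          = c powi (int a - int b) * (\<psi> (norm z) * (z ^ a * cnj z ^ b))"
        using c by (simp add: norm_mult power_mult_distrib mult_ac)
    qed (use False in auto)
  next
    case True
    have eq: "z ^ a * cnj z ^ b = of_real (root k (norm z ^ (2 * k)) ^ a)" for z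
    proof -
      have "root k (norm z ^ (2 * k)) = (norm z)\<^sup>2"
        using k by (simp add: power_mult real_root_power_cancel)
      then show ?thesis unfolding True
        by (simp only:) (subst of_real_power, subst complex_norm_square, rule power_mult_distrib[symmetric])
    qed
    show ?thesis unfolding eq
    proof (rule integral_eq_0_approx[OF \<psi>])
      show "continuous_on (cball 0 1) (\<lambda>z::complex. complex_of_real (root k (norm z ^ (2 * k)) ^ a))"
        by (intro continuous_intros)
      fix e :: real assume "e > 0"
      have "continuous_on {0..1} (\<lambda>x. root k x ^ a)" by (intro continuous_intros)
      then obtain p where p: "real_polynomial_function p" "\<And>x. x \<in> {0..1} \<Longrightarrow> \<bar>root k x ^ a - p x\<bar> < e"
        using Stone_Weierstrass_real_polynomial_function[of "{0..1::real}"] \<open>e > 0\<close> compact_Icc by metis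
      then obtain c n where pc: "p = (\<lambda>x. \<Sum>i\<le>n. c i * x ^ i)"
        unfolding real_polynomial_function_iff_sum by blast
      let ?p = "\<lambda>z. complex_of_real (p (norm z ^ (2 * k)))"
      show "\<exists>p. continuous_on (cball 0 1) p \<and>
         (\<forall>z\<in>unit_disk. norm (complex_of_real (root k (norm z ^ (2 * k)) ^ a) - p z) \<le> e) \<and>
         (\<integral>z. \<psi> (norm z) * p z \<partial>disk_area) = 0"
      proof (intro exI[of _ ?p] conjI ballI)
        show "continuous_on (cball 0 1) ?p" unfolding pc by (intro continuous_intros)
        show "norm (complex_of_real (root k (norm z ^ (2 * k)) ^ a) - ?p z) \<le> e" if "z \<in> unit_disk" for z
        proof -
          have "norm z ^ (2 * k) \<in> {0..1}" using that by (auto intro: power_le_one)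
          from p(2)[OF this] show ?thesis
            by (simp only: of_real_diff[symmetric] norm_of_real less_imp_le)
        qed
        have "\<psi> (norm z) * ?p z = (\<Sum>i\<le>n. of_real (c i) * (\<psi> (norm z) * of_real (norm z ^ (2 * k * i))))" for z :: complex
          by (simp add: pc sum_distrib_left mult_ac flip: power_mult)
        moreover have "integrable disk_area (\<lambda>z. \<psi> (norm z) * of_real (norm z ^ (2 * k * i)))" for i
          by (intro integrable_disk_area_mult_continuous \<psi> continuous_intros)
        ultimately show "(\<integral>z. \<psi> (norm z) * ?p z \<partial>disk_area) = 0"
          using mom by simp
      qed
    qed
  qed
qed

section \<open>Harmonic functions and holomorphic functions\<close>

lemma has_real_derivative_along_line:
  fixes F :: "'a::real_normed_vector \<Rightarrow> real"
  assumes "(F has_derivative F') (at (a + x *\<^sub>R u))"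
  shows "((\<lambda>s. F (a + s *\<^sub>R u)) has_real_derivative F' u) (at x)"
proof -
  have "((\<lambda>s. a + s *\<^sub>R u) has_derivative (\<lambda>h. h *\<^sub>R u)) (at x)"
    by (auto intro!: derivative_eq_intros)
  from has_derivative_compose[OF this assms]
  have "((\<lambda>s. F (a + s *\<^sub>R u)) has_derivative (\<lambda>h. F' (h *\<^sub>R u))) (at x)" .
  moreover have "(\<lambda>h. F' (h *\<^sub>R u)) = (*) (F' u)"
    using has_derivative_linear[OF assms] by (simp add: linear_scale mult.commute fun_eq_iff)
  ultimately show ?thesis by (simp add: has_field_derivative_def)
qed

text \<open>The mean value theorem, first in the direction \<open>u\<close> and then in the direction \<open>v\<close>. The left-hand
  side is symmetric in \<open>u\<close> and \<open>v\<close>, which is what makes second derivatives symmetric.\<close>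
lemma second_difference_eq_second_derivative:
  fixes F :: "'a::real_normed_vector \<Rightarrow> real"
  assumes t: "t > 0"
    and mem: "\<And>r s. 0 \<le> r \<Longrightarrow> r \<le> t \<Longrightarrow> 0 \<le> s \<Longrightarrow> s \<le> t \<Longrightarrow> z + r *\<^sub>R u + s *\<^sub>R v \<in> S"
    and F': "\<And>w. w \<in> S \<Longrightarrow> (F has_derivative F' w) (at w)"
    and F'': "\<And>w v. w \<in> S \<Longrightarrow> ((\<lambda>w. F' w v) has_derivative (\<lambda>u. F'' w u v)) (at w)"
  shows "\<exists>r s. 0 \<le> r \<and> r \<le> t \<and> 0 \<le> s \<and> s \<le> t \<and>
    F (z + t *\<^sub>R u + t *\<^sub>R v) - F (z + t *\<^sub>R u) - F (z + t *\<^sub>R v) + F z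
      = t * (t * F'' (z + r *\<^sub>R u + s *\<^sub>R v) v u)"
proof -
  define p where "p s = F ((z + t *\<^sub>R v) + s *\<^sub>R u) - F (z + s *\<^sub>R u)" for s
  have "\<exists>r>0. r < t \<and> p t - p 0 = (t - 0) * (F' ((z + t *\<^sub>R v) + r *\<^sub>R u) u - F' (z + r *\<^sub>R u) u)"
  proof (rule MVT2[OF t])
    fix x assume x: "0 \<le> x" "x \<le> t"
    have "(z + t *\<^sub>R v) + x *\<^sub>R u \<in> S" "z + x *\<^sub>R u \<in> S"
      using mem[OF x, of t] mem[OF x, of 0] t by (auto simp: add_ac)
    then show "(p has_real_derivative F' ((z + t *\<^sub>R v) + x *\<^sub>R u) u - F' (z + x *\<^sub>R u) u) (at x)"
      unfolding p_def by (intro DERIV_diff has_real_derivative_along_line F')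
  qed
  then obtain r where r: "0 < r" "r < t"
    and p: "p t - p 0 = t * (F' ((z + t *\<^sub>R v) + r *\<^sub>R u) u - F' (z + r *\<^sub>R u) u)" by auto
  have "\<exists>s>0. s < t \<and> F' (z + r *\<^sub>R u + t *\<^sub>R v) u - F' (z + r *\<^sub>R u + 0 *\<^sub>R v) u
      = (t - 0) * F'' (z + r *\<^sub>R u + s *\<^sub>R v) v u"
  proof (rule MVT2[OF t])
    fix x assume "0 \<le> x" "x \<le> t"
    then have "z + r *\<^sub>R u + x *\<^sub>R v \<in> S" using mem r by auto
    then show "((\<lambda>s. F' (z + r *\<^sub>R u + s *\<^sub>R v) u) has_real_derivative
        F'' (z + r *\<^sub>R u + x *\<^sub>R v) v u) (at x)"
      by (intro has_real_derivative_along_line F'')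
  qed
  then obtain s where s: "0 < s" "s < t"
    and q: "F' (z + r *\<^sub>R u + t *\<^sub>R v) u - F' (z + r *\<^sub>R u) u = t * F'' (z + r *\<^sub>R u + s *\<^sub>R v) v u" by auto
  have "p t - p 0 = t * (t * F'' (z + r *\<^sub>R u + s *\<^sub>R v) v u)"
    using p q by (simp add: add_ac)
  then show ?thesis using r s
    by (intro exI[of _ r] exI[of _ s]) (simp add: p_def add_ac)
qed

lemma symmetric_second_derivative_real:
  fixes F :: "'a::real_normed_vector \<Rightarrow> real"
  assumes S: "open S" "z \<in> S"
    and F': "\<And>w. w \<in> S \<Longrightarrow> (F has_derivative F' w) (at w)"
    and F'': "\<And>w v. w \<in> S \<Longrightarrow> ((\<lambda>w. F' w v) has_derivative (\<lambda>u. F'' w u v)) (at w)"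
    and cont: "\<And>u v. continuous_on S (\<lambda>w. F'' w u v)"
  shows "F'' z u v = F'' z v u"
proof -
  have "\<bar>F'' z u v - F'' z v u\<bar> \<le> e" if e: "e > 0" for e
  proof -
    have "isCont (\<lambda>w. F'' w u v) z" for u v
      using cont S continuous_on_eq_continuous_at by blast
    then have lim: "((\<lambda>w. F'' w u v) \<longlongrightarrow> F'' z u v) (nhds z)" for u v
      unfolding isCont_def
      by (subst (asm) tendsto_at_iff_tendsto_nhds[where g = "\<lambda>w. F'' w u v" for u v])
    have "\<forall>\<^sub>F w in nhds z. w \<in> S \<and> \<bar>F'' w u v - F'' z u v\<bar> < e / 2 \<and> \<bar>F'' w v u - F'' z v u\<bar> < e / 2"
    proof (intro eventually_conj)
      show "\<forall>\<^sub>F w in nhds z. w \<in> S" using S by (rule eventually_nhds_in_open)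
      show "\<forall>\<^sub>F w in nhds z. \<bar>F'' w u v - F'' z u v\<bar> < e / 2"
        using tendstoD[OF lim[of u v], of "e / 2"] e by (simp add: dist_real_def)
      show "\<forall>\<^sub>F w in nhds z. \<bar>F'' w v u - F'' z v u\<bar> < e / 2"
        using tendstoD[OF lim[of v u], of "e / 2"] e by (simp add: dist_real_def)
    qed
    then obtain d where d: "d > 0" and near: "\<And>w. dist w z < d \<Longrightarrow>
        w \<in> S \<and> \<bar>F'' w u v - F'' z u v\<bar> < e / 2 \<and> \<bar>F'' w v u - F'' z v u\<bar> < e / 2"
      unfolding eventually_nhds_metric by blast
    \<comment> \<open>small enough that the parallelogram spanned by \<open>t u\<close> and \<open>t v\<close> stays within distance \<open>d\<close>\<close>
    define t where "t = d / (2 * (norm u + norm v + 1))"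
    have pos: "norm u + norm v + 1 > 0" by (simp add: add_nonneg_pos)
    have t: "t > 0" using d pos by (simp add: t_def)
    have ball: "dist (z + r *\<^sub>R a + s *\<^sub>R b) z < d"
      if "0 \<le> r" "r \<le> t" "0 \<le> s" "s \<le> t" and ab: "norm a + norm b = norm u + norm v" for r s a b
    proof -
      have "dist (z + r *\<^sub>R a + s *\<^sub>R b) z \<le> r * norm a + s * norm b"
        using that norm_triangle_ineq[of "r *\<^sub>R a" "s *\<^sub>R b"] by (simp add: dist_norm add.assoc)
      also have "\<dots> \<le> t * norm a + t * norm b"
        using that by (intro add_mono mult_right_mono) auto
      also have "\<dots> = t * (norm u + norm v)" by (simp add: ab flip: distrib_left)
      also have "\<dots> < t * (2 * (norm u + norm v + 1))"
        using t by (intro mult_strict_left_mono) (auto simp: add_nonneg_pos intro: add_nonneg_pos)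
      also have "\<dots> = d" using pos by (simp add: t_def)
      finally show ?thesis .
    qed
    let ?D = "F (z + t *\<^sub>R u + t *\<^sub>R v) - F (z + t *\<^sub>R u) - F (z + t *\<^sub>R v) + F z"
    have mem: "z + r *\<^sub>R u + s *\<^sub>R v \<in> S" "z + r *\<^sub>R v + s *\<^sub>R u \<in> S"
      if "0 \<le> r" "r \<le> t" "0 \<le> s" "s \<le> t" for r s
      using near ball[OF that, of u v] ball[OF that, of v u] by auto
    obtain r s where 1: "0 \<le> r" "r \<le> t" "0 \<le> s" "s \<le> t" "?D = t * (t * F'' (z + r *\<^sub>R u + s *\<^sub>R v) v u)"
      using second_difference_eq_second_derivative[of t z u v S F F' F'', OF t mem(1) F' F''] by blast
    obtain r' s' where 2: "0 \<le> r'" "r' \<le> t" "0 \<le> s'" "s' \<le> t"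
      "F (z + t *\<^sub>R v + t *\<^sub>R u) - F (z + t *\<^sub>R v) - F (z + t *\<^sub>R u) + F z
        = t * (t * F'' (z + r' *\<^sub>R v + s' *\<^sub>R u) u v)"
      using second_difference_eq_second_derivative[of t z v u S F F' F'', OF t mem(2) F' F''] by blast
    have "t * (t * F'' (z + r *\<^sub>R u + s *\<^sub>R v) v u) = t * (t * F'' (z + r' *\<^sub>R v + s' *\<^sub>R u) u v)"
    proof -
      have "z + t *\<^sub>R u + t *\<^sub>R v = z + t *\<^sub>R v + t *\<^sub>R u" by (simp add: add_ac)
      then show ?thesis using 1(5) 2(5) by (simp only:)
    qed
    then have "F'' (z + r *\<^sub>R u + s *\<^sub>R v) v u = F'' (z + r' *\<^sub>R v + s' *\<^sub>R u) u v" using t by simp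
    moreover have "\<bar>F'' (z + r *\<^sub>R u + s *\<^sub>R v) v u - F'' z v u\<bar> < e / 2"
      using near ball[OF 1(1-4), of u v] by blast
    moreover have "\<bar>F'' (z + r' *\<^sub>R v + s' *\<^sub>R u) u v - F'' z u v\<bar> < e / 2"
      using near ball[OF 2(1-4), of v u] by (simp add: add.commute)
    ultimately show ?thesis by linarith
  qed
  then have "\<bar>F'' z u v - F'' z v u\<bar> \<le> 0" by (rule field_le_epsilon[where y = 0, simplified])
  then show ?thesis by simp
qed

lemma symmetric_second_derivative:
  fixes f :: "complex \<Rightarrow> complex"
  assumes S: "open S" "z \<in> S"
    and f': "\<And>w. w \<in> S \<Longrightarrow> (f has_derivative f' w) (at w)"
    and f'': "\<And>w v. w \<in> S \<Longrightarrow> ((\<lambda>w. f' w v) has_derivative (\<lambda>u. f'' w u v)) (at w)"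
    and cont: "\<And>u v. continuous_on S (\<lambda>w. f'' w u v)"
  shows "f'' z u v = f'' z v u"
proof (rule complex_eqI)
  show "Re (f'' z u v) = Re (f'' z v u)"
    by (rule symmetric_second_derivative_real[OF S, where F = "\<lambda>z. Re (f z)" and F' = "\<lambda>z v. Re (f' z v)"
          and F'' = "\<lambda>z u v. Re (f'' z u v)",
          OF has_derivative_Re[OF f'] has_derivative_Re[OF f''] continuous_on_Re[OF cont]])
  show "Im (f'' z u v) = Im (f'' z v u)"
    by (rule symmetric_second_derivative_real[OF S, where F = "\<lambda>z. Im (f z)" and F' = "\<lambda>z v. Im (f' z v)"
          and F'' = "\<lambda>z u v. Im (f'' z u v)",
          OF has_derivative_Im[OF f'] has_derivative_Im[OF f''] continuous_on_Im[OF cont]])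
qed

lemma harmonic_on_holomorphic_add_cnj:
  assumes S: "open S" and G: "G holomorphic_on S" and H: "H holomorphic_on S"
    and f: "\<And>z. z \<in> S \<Longrightarrow> f z = G z + cnj (H z)"
  shows "harmonic_on f S"
proof -
  have d: "((\<lambda>w. g w * a + cnj (h w * a)) has_derivative (\<lambda>u. deriv g z * u * a + cnj (deriv h z * u * a))) (at z)"
    if "g holomorphic_on S" "h holomorphic_on S" "z \<in> S" for g h z a
  proof -
    have "(g has_derivative (\<lambda>u. deriv g z * u)) (at z)" "(h has_derivative (\<lambda>u. deriv h z * u)) (at z)"
      using holomorphic_derivI[OF that(1) S that(3)] holomorphic_derivI[OF that(2) S that(3)]
      by (simp_all add: has_field_derivative_def)
    then show ?thesis
      by (intro has_derivative_add has_derivative_mult_left bounded_linear.has_derivative[OF bounded_linear_cnj])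
  qed
  have hol: "deriv G holomorphic_on S" "deriv H holomorphic_on S"
    using G H S by (auto intro: holomorphic_deriv)
  have hol2: "deriv (deriv G) holomorphic_on S" "deriv (deriv H) holomorphic_on S"
    using hol S by (auto intro: holomorphic_deriv)
  show ?thesis
    unfolding harmonic_on_def
  proof (intro exI[of _ "\<lambda>z v. deriv G z * v + cnj (deriv H z * v)"]
      exI[of _ "\<lambda>z u v. deriv (deriv G) z * u * v + cnj (deriv (deriv H) z * u * v)"] conjI ballI allI)
    fix z assume z: "z \<in> S"
    show "(f has_derivative (\<lambda>v. deriv G z * v + cnj (deriv H z * v))) (at z)"
      by (rule has_derivative_transform_within_open[OF _ S z]) (use d[OF G H z, of 1] f in auto)
    show "((\<lambda>w. deriv G w * v + cnj (deriv H w * v)) has_derivative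
        (\<lambda>u. deriv (deriv G) z * u * v + cnj (deriv (deriv H) z * u * v))) (at z)" for v
      by (rule d[OF hol z])
    show "deriv (deriv G) z * 1 * 1 + cnj (deriv (deriv H) z * 1 * 1) +
         (deriv (deriv G) z * \<i> * \<i> + cnj (deriv (deriv H) z * \<i> * \<i>)) = 0"
      by (simp add: mult.assoc)
  next
    show "continuous_on S (\<lambda>z. deriv (deriv G) z * u * v + cnj (deriv (deriv H) z * u * v))" for u v
      using hol2[THEN holomorphic_on_imp_continuous_on] by (intro continuous_intros)
  qed
qed

text \<open>The Wirtinger derivative \<open>(\<partial>\<^sub>x f - \<i> \<partial>\<^sub>y f) / 2\<close> of a harmonic function satisfies the Cauchy--Riemann
  equations, by the Laplace equation and the symmetry of second derivatives, and so does the
  conjugate of \<open>(\<partial>\<^sub>x f + \<i> \<partial>\<^sub>y f) / 2\<close>. With primitives \<open>G\<close> and \<open>H\<close> of the two functions,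
  \<open>f - G - cnj H\<close> has derivative zero on the disk.\<close>
lemma harmonic_on_disk_decomposition:
  assumes "harmonic_on f unit_disk"
  obtains G H where "G holomorphic_on unit_disk" "H holomorphic_on unit_disk" "H 0 = 0"
    "\<And>z. z \<in> unit_disk \<Longrightarrow> f z = G z + cnj (H z)"
proof -
  obtain f' f'' where f': "\<And>z. z \<in> unit_disk \<Longrightarrow> (f has_derivative f' z) (at z)"
    and f'': "\<And>z v. z \<in> unit_disk \<Longrightarrow> ((\<lambda>w. f' w v) has_derivative (\<lambda>u. f'' z u v)) (at z)"
    and cont: "\<And>u v. continuous_on unit_disk (\<lambda>z. f'' z u v)"
    and lap: "\<And>z. z \<in> unit_disk \<Longrightarrow> f'' z 1 1 + f'' z \<i> \<i> = 0"
    using assms unfolding harmonic_on_def by blast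
  have sym: "f'' z \<i> 1 = f'' z 1 \<i>" if "z \<in> unit_disk" for z
    by (rule symmetric_second_derivative[OF _ that f' f'' cont]) auto
  have lap': "f'' z \<i> \<i> = - f'' z 1 1" if "z \<in> unit_disk" for z
    using lap[OF that] by (simp add: add_eq_0_iff2)
  define g where "g z = (f' z 1 - \<i> * f' z \<i>) / 2" for z
  define h where "h z = cnj ((f' z 1 + \<i> * f' z \<i>) / 2)" for z
  have lin: "linear (\<lambda>u. f'' z u v)" if "z \<in> unit_disk" for z v
    using f''[OF that] by (rule has_derivative_linear)
  have expand: "L u = of_real (Re u) * L 1 + of_real (Im u) * L \<i>" if "linear L" for L :: "complex \<Rightarrow> complex" and u
  proof -
    have "L u = L (Re u *\<^sub>R 1 + Im u *\<^sub>R \<i>)"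
      by (rule arg_cong[where f = L]) (simp add: complex_eq_iff)
    then show ?thesis
      unfolding linear_add[OF that] linear_scale[OF that] by (simp add: scaleR_conv_of_real)
  qed
  have f''1: "f'' z u 1 = of_real (Re u) * f'' z 1 1 + of_real (Im u) * f'' z 1 \<i>" if z: "z \<in> unit_disk" for z u
    using expand[OF lin[OF z, of 1], of u] unfolding sym[OF z] .
  have f''i: "f'' z u \<i> = of_real (Re u) * f'' z 1 \<i> - of_real (Im u) * f'' z 1 1" if z: "z \<in> unit_disk" for z u
    using expand[OF lin[OF z, of \<i>], of u] unfolding lap'[OF z] by simp
  have alg1: "x * A + y * B - \<i> * (x * B - y * A) = (A - \<i> * B) * (x + \<i> * y)"
    and alg2: "x * A + y * B + \<i> * (x * B - y * A) = (A + \<i> * B) * (x - \<i> * y)"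
    and alg3: "(A - \<i> * B) * (x + \<i> * y) + (A + \<i> * B) * (x - \<i> * y) = 2 * (x * A + y * B)" for x y A B
    using i_squared by algebra+
  have g: "(g has_field_derivative (f'' z 1 1 - \<i> * f'' z 1 \<i>) / 2) (at z)" if z: "z \<in> unit_disk" for z
  proof -
    have "(g has_derivative (\<lambda>u. (f'' z u 1 - \<i> * f'' z u \<i>) / 2)) (at z)"
      unfolding g_def by (intro bounded_linear.has_derivative[OF bounded_linear_divide] has_derivative_diff has_derivative_mult_right f''[OF z])
    moreover have "(f'' z u 1 - \<i> * f'' z u \<i>) / 2 = (f'' z 1 1 - \<i> * f'' z 1 \<i>) / 2 * u" for u
    proof -
      have "(f'' z u 1 - \<i> * f'' z u \<i>) / 2
          = (f'' z 1 1 - \<i> * f'' z 1 \<i>) / 2 * (of_real (Re u) + \<i> * of_real (Im u))"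
        unfolding f''1[OF z, of u] f''i[OF z, of u] alg1 by simp
      then show ?thesis unfolding complex_eq[symmetric] .
    qed
    then have "(\<lambda>u. (f'' z u 1 - \<i> * f'' z u \<i>) / 2) = (*) ((f'' z 1 1 - \<i> * f'' z 1 \<i>) / 2)"
      by (rule ext)
    ultimately show ?thesis unfolding has_field_derivative_def by (simp only:)
  qed
  have h: "(h has_field_derivative cnj ((f'' z 1 1 + \<i> * f'' z 1 \<i>) / 2)) (at z)" if z: "z \<in> unit_disk" for z
  proof -
    have "(h has_derivative (\<lambda>u. cnj ((f'' z u 1 + \<i> * f'' z u \<i>) / 2))) (at z)"
      unfolding h_def by (intro bounded_linear.has_derivative[OF bounded_linear_cnj]
          bounded_linear.has_derivative[OF bounded_linear_divide] has_derivative_add has_derivative_mult_right f''[OF z])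
    moreover have "cnj ((f'' z u 1 + \<i> * f'' z u \<i>) / 2) = cnj ((f'' z 1 1 + \<i> * f'' z 1 \<i>) / 2) * u" for u
    proof -
      have "(f'' z u 1 + \<i> * f'' z u \<i>) / 2
          = (f'' z 1 1 + \<i> * f'' z 1 \<i>) / 2 * (of_real (Re u) - \<i> * of_real (Im u))"
        unfolding f''1[OF z, of u] f''i[OF z, of u] alg2 by simp
      also have "of_real (Re u) - \<i> * of_real (Im u) = cnj u"
        by (simp add: complex_eq_iff)
      finally show ?thesis by (simp only: complex_cnj_mult complex_cnj_cnj)
    qed
    then have "(\<lambda>u. cnj ((f'' z u 1 + \<i> * f'' z u \<i>) / 2)) = (*) (cnj ((f'' z 1 1 + \<i> * f'' z 1 \<i>) / 2))"
      by (rule ext)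
    ultimately show ?thesis unfolding has_field_derivative_def by (simp only:)
  qed
  have "g holomorphic_on unit_disk" "h holomorphic_on unit_disk"
    unfolding holomorphic_on_open[OF open_ball] using g h by blast+
  then obtain G H where G: "\<And>z. z \<in> unit_disk \<Longrightarrow> (G has_field_derivative g z) (at z within unit_disk)"
    and H: "\<And>z. z \<in> unit_disk \<Longrightarrow> (H has_field_derivative h z) (at z within unit_disk)"
    using holomorphic_convex_primitive'[OF convex_ball open_ball] by metis
  have "((\<lambda>z. f z - G z - cnj (H z)) has_derivative (\<lambda>v. 0)) (at z within unit_disk)" if z: "z \<in> unit_disk" for z
  proof -
    have "((\<lambda>z. f z - G z - cnj (H z)) has_derivative (\<lambda>v. f' z v - g z * v - cnj (h z * v))) (at z within unit_disk)"
      using f'[OF z, THEN has_derivative_at_withinI] G[OF z] H[OF z]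
      unfolding has_field_derivative_def
      by (intro has_derivative_diff bounded_linear.has_derivative[OF bounded_linear_cnj])
    moreover have "f' z v - g z * v - cnj (h z * v) = 0" for v
    proof -
      have v: "v = of_real (Re v) + \<i> * of_real (Im v)" by (rule complex_eq)
      have "cnj (h z * v) = (f' z 1 + \<i> * f' z \<i>) / 2 * cnj v"
        by (simp only: complex_cnj_mult h_def complex_cnj_cnj)
      also have "cnj v = of_real (Re v) - \<i> * of_real (Im v)" by (simp add: complex_eq_iff)
      finally have hv: "cnj (h z * v) = (f' z 1 + \<i> * f' z \<i>) / 2 * (of_real (Re v) - \<i> * of_real (Im v))" .
      have "g z * v = (f' z 1 - \<i> * f' z \<i>) / 2 * (of_real (Re v) + \<i> * of_real (Im v))"
        unfolding complex_eq[symmetric] by (simp only: g_def)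
      then have "g z * v + cnj (h z * v) = ((f' z 1 - \<i> * f' z \<i>) * (of_real (Re v) + \<i> * of_real (Im v))
          + (f' z 1 + \<i> * f' z \<i>) * (of_real (Re v) - \<i> * of_real (Im v))) / 2"
        unfolding hv by (simp only: times_divide_eq_left) (rule add_divide_distrib[symmetric])
      also have "\<dots> = f' z v"
        unfolding alg3 expand[OF has_derivative_linear[OF f'[OF z]], of v] by simp
      finally show ?thesis by (simp add: algebra_simps)
    qed
    ultimately show ?thesis by simp
  qed
  then have "\<exists>c. \<forall>z\<in>unit_disk. f z - G z - cnj (H z) = c"
    by (intro has_derivative_zero_constant[OF convex_ball])
  then obtain c where c: "\<And>z. z \<in> unit_disk \<Longrightarrow> f z - G z - cnj (H z) = c" by blast
  show thesis
  proof (rule that[of "\<lambda>z. G z + (c + cnj (H 0))" "\<lambda>z. H z - H 0"])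
    show "(\<lambda>z. G z + (c + cnj (H 0))) holomorphic_on unit_disk"
      using G by (intro holomorphic_intros) (unfold holomorphic_on_def field_differentiable_def, blast)
    show "(\<lambda>z. H z - H 0) holomorphic_on unit_disk"
      using H by (intro holomorphic_intros) (unfold holomorphic_on_def field_differentiable_def, blast)
    show "f z = G z + (c + cnj (H 0)) + cnj (H z - H 0)" if "z \<in> unit_disk" for z
      using c[OF that] by (simp add: algebra_simps)
  qed simp
qed

section \<open>Moments of quasihomogeneous functions\<close>

lemma quasihomogeneous_polar:
  assumes "z \<noteq> 0"
  shows "quasihomogeneous k \<phi> z = sgn z powi k * \<phi> (norm z)"
  unfolding quasihomogeneous_def cis_power_int[symmetric] cis_Arg[OF assms] ..

lemma hmono_polar:
  assumes "z \<noteq> 0"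
  shows "hmono n z = sgn z powi n * of_real (norm z ^ nat \<bar>n\<bar>)"
proof -
  have "z = sgn z * of_real (norm z)"
    using assms by (simp add: sgn_eq)
  then have "hmono n z = hmono n (sgn z * of_real (norm z))" by simp
  also have "\<dots> = sgn z powi n * hmono n (of_real (norm z))"
    by (rule hmono_rotate) (simp add: norm_sgn assms)
  also have "hmono n (of_real (norm z)) = of_real (norm z ^ nat \<bar>n\<bar>)"
    by (simp add: hmono_def)
  finally show ?thesis .
qed

lemma quasihomogeneous_measurable:
  assumes "(\<lambda>z. \<phi> (norm z)) \<in> borel_measurable disk_area"
  shows "quasihomogeneous k \<phi> \<in> borel_measurable disk_area"
proof -
  note [measurable] = assms
  have "(\<lambda>z. sgn z powi k * \<phi> (norm z)) \<in> borel_measurable disk_area"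
    unfolding sgn_div_norm by measurable
  then have m: "(\<lambda>z. if z = 0 then \<phi> (norm z) else sgn z powi k * \<phi> (norm z)) \<in> borel_measurable disk_area"
    by measurable
  have "quasihomogeneous k \<phi> z = (if z = 0 then \<phi> (norm z) else sgn z powi k * \<phi> (norm z))" for z
    by (cases "z = 0") (simp_all add: quasihomogeneous_polar, simp add: quasihomogeneous_def Arg_zero)
  then have "quasihomogeneous k \<phi> = (\<lambda>z. if z = 0 then \<phi> (norm z) else sgn z powi k * \<phi> (norm z))"
    by (rule ext)
  then show ?thesis using m by (simp only:)
qed

lemma norm_quasihomogeneous: "norm (quasihomogeneous k \<phi> z) = norm (\<phi> (norm z))"
  by (simp add: quasihomogeneous_def norm_mult)

lemma integrable_quasihomogeneous:
  assumes "integrable disk_area (\<lambda>z. \<phi> (norm z))"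
  shows "integrable disk_area (quasihomogeneous k \<phi>)"
proof -
  have "quasihomogeneous k \<phi> \<in> borel_measurable disk_area"
    using assms by (intro quasihomogeneous_measurable) simp
  then show ?thesis
    by (rule Bochner_Integration.integrable_bound[OF assms]) (simp add: norm_quasihomogeneous)
qed

text \<open>Up to a factor \<open>2\<close> and a shift of the argument, the Mellin transform of \<open>\<phi>\<close> on \<open>[0,1]\<close>.\<close>
definition moment :: "(real \<Rightarrow> complex) \<Rightarrow> nat \<Rightarrow> complex" where
  "moment \<phi> m = (\<integral>z. \<phi> (norm z) * of_real (norm z ^ m) \<partial>disk_area)"

text \<open>The integrand is homogeneous of degree \<open>k + n - m\<close> under rotations. So all but one of the
  products are orthogonal, and in the remaining one the angular factors cancel.\<close>
lemma integral_quasihomogeneous_hmono: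
  assumes \<phi>: "(\<lambda>z. \<phi> (norm z)) \<in> borel_measurable disk_area"
  shows "(\<integral>z. quasihomogeneous k \<phi> z * (hmono n z * cnj (hmono m z)) \<partial>disk_area)
    = (if m = n + k then moment \<phi> (nat \<bar>n\<bar> + nat \<bar>m\<bar>) else 0)"
proof -
  note [measurable] = quasihomogeneous_measurable[OF \<phi>, of k]
  have "(\<lambda>z. hmono n z * cnj (hmono m z)) \<in> borel_measurable disk_area"
    by (rule continuous_measurable_disk_area) (auto simp: cnj_hmono intro!: continuous_intros)
  then have m1 [measurable]: "(\<lambda>z. quasihomogeneous k \<phi> z * (hmono n z * cnj (hmono m z))) \<in> borel_measurable disk_area"
    by measurable
  have eq: "quasihomogeneous k \<phi> z * (hmono n z * cnj (hmono m z))
      = sgn z powi (k + n - m) * (\<phi> (norm z) * of_real (norm z ^ (nat \<bar>n\<bar> + nat \<bar>m\<bar>)))" if "z \<noteq> 0" for z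
  proof -
    have "sgn z \<noteq> 0" using that by (simp add: sgn_zero_iff)
    then have "sgn z powi (k + n - m) = sgn z powi k * (sgn z powi n * sgn z powi (- m))"
      by (simp add: add_diff_eq flip: power_int_add)
    moreover have "cnj (hmono m z) = sgn z powi (- m) * of_real (norm z ^ nat \<bar>m\<bar>)"
      by (subst cnj_hmono, subst hmono_polar[OF that]) simp
    ultimately show ?thesis
      by (simp add: quasihomogeneous_polar[OF that] hmono_polar[OF that, of n] power_add mult_ac)
  qed
  show ?thesis
  proof (cases "m = n + k")
    case True
    have "(\<integral>z. quasihomogeneous k \<phi> z * (hmono n z * cnj (hmono m z)) \<partial>disk_area) = moment \<phi> (nat \<bar>n\<bar> + nat \<bar>m\<bar>)"
      unfolding moment_def
    proof (rule integral_cong_AE)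
      show "AE z in disk_area. quasihomogeneous k \<phi> z * (hmono n z * cnj (hmono m z))
          = \<phi> (norm z) * of_real (norm z ^ (nat \<bar>n\<bar> + nat \<bar>m\<bar>))"
        using AE_disk_area_nonzero by eventually_elim (subst eq, simp, simp add: True)
      show "(\<lambda>z. \<phi> (norm z) * of_real (norm z ^ (nat \<bar>n\<bar> + nat \<bar>m\<bar>))) \<in> borel_measurable disk_area"
        using \<phi>[measurable] by measurable
    qed (rule m1)
    with True show ?thesis by simp
  next
    case False
    have "(\<integral>z. quasihomogeneous k \<phi> z * (hmono n z * cnj (hmono m z)) \<partial>disk_area) = 0"
    proof (rule integral_homogeneous_eq_0[OF m1, where m = "k + n - m"])
      show "k + n - m \<noteq> 0" using False by simp
      fix c z :: complex assume c: "norm c = 1" and z: "z \<noteq> 0"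
      have "c \<noteq> 0" using c by auto
      have "sgn (c * z) = c * sgn z" using c by (simp add: sgn_mult sgn_div_norm[of c])
      then show "quasihomogeneous k \<phi> (c * z) * (hmono n (c * z) * cnj (hmono m (c * z)))
          = c powi (k + n - m) * (quasihomogeneous k \<phi> z * (hmono n z * cnj (hmono m z)))"
        using c z \<open>c \<noteq> 0\<close> by (simp add: eq norm_mult power_int_mult_distrib)
    qed
    with False show ?thesis by simp
  qed
qed

section \<open>Series of harmonic monomials\<close>

text \<open>Absolute convergence of the series with coefficients \<open>a\<close> on every smaller disk.\<close>
definition disk_convergent :: "(int \<Rightarrow> complex) \<Rightarrow> bool" where
  "disk_convergent a \<longleftrightarrow> (\<forall>r. 0 \<le> r \<and> r < 1 \<longrightarrow> (\<lambda>n. norm (a n) * r ^ nat \<bar>n\<bar>) summable_on UNIV)"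

text \<open>The value off the disk is \<open>0\<close>, as for the elements of the harmonic Bergman space, so that equality
  of functions can be used throughout.\<close>
definition hseries :: "(int \<Rightarrow> complex) \<Rightarrow> complex \<Rightarrow> complex" where
  "hseries a z = (if z \<in> unit_disk then \<Sum>\<^sub>\<infinity>n. a n * hmono n z else 0)"

lemma abs_summable_hseries:
  assumes "disk_convergent a" "z \<in> unit_disk"
  shows "(\<lambda>n. norm (a n * hmono n z)) summable_on UNIV"
  using assms by (simp add: disk_convergent_def norm_mult norm_hmono)

lemma has_sum_hseries:
  assumes "disk_convergent a" "z \<in> unit_disk"
  shows "((\<lambda>n. a n * hmono n z) has_sum hseries a z) UNIV"
  using abs_summable_summable[OF abs_summable_hseries[OF assms]] assms(2)
  by (simp add: hseries_def)

lemma UNIV_int_eq: "(UNIV :: int set) = range int \<union> range (\<lambda>n. - int (Suc n))"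
proof -
  have "x \<in> range int \<union> range (\<lambda>n. - int (Suc n))" for x :: int
    by (cases x rule: int_cases) auto
  then show ?thesis by blast
qed

lemma inj_neg_int: "inj (\<lambda>n. - int (Suc n))"
  by (auto simp: inj_def)

lemma has_sum_int_from_nat:
  fixes f :: "int \<Rightarrow> 'a::{topological_ab_group_add, comm_monoid_add}"
  assumes "((\<lambda>n. f (int n)) has_sum A) UNIV" "((\<lambda>n. f (- int (Suc n))) has_sum B) UNIV"
  shows "(f has_sum (A + B)) UNIV"
proof -
  have "(f has_sum A) (range int)"
    using assms(1) by (subst has_sum_reindex) (auto simp: o_def)
  moreover have "(f has_sum B) (range (\<lambda>n. - int (Suc n)))"
    using assms(2) inj_neg_int by (subst has_sum_reindex) (auto simp: o_def)
  ultimately show ?thesis unfolding UNIV_int_eq by (rule has_sum_Un_disjoint) auto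
qed

text \<open>The nonnegative indices give a power series in \<open>z\<close> and the negative ones a power series in \<open>cnj z\<close>.\<close>
lemma hseries_decomposition:
  assumes a: "disk_convergent a"
  shows "\<exists>G H. G holomorphic_on unit_disk \<and> H holomorphic_on unit_disk \<and>
    (\<forall>z\<in>unit_disk. hseries a z = G z + cnj (H z))"
proof -
  define G where "G z = (\<Sum>\<^sub>\<infinity>n::nat. a (int n) * z ^ n)" for z
  define K where "K z = (\<Sum>\<^sub>\<infinity>n::nat. a (- int (Suc n)) * cnj z ^ Suc n)" for z
  define b where "b n = (if n = 0 then 0 else cnj (a (- int n)))" for n
  have sum: "(\<lambda>n. a (int n) * z ^ n) summable_on UNIV" "(\<lambda>n. a (- int (Suc n)) * cnj z ^ Suc n) summable_on UNIV"
    if "z \<in> unit_disk" for z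
  proof -
    have s: "(\<lambda>n. a n * hmono n z) summable_on UNIV"
      using abs_summable_hseries[OF a that] by (rule abs_summable_summable)
    have "(\<lambda>n. a n * hmono n z) summable_on range int"
      by (rule summable_on_subset_banach[OF s]) auto
    then have "(\<lambda>n. a n * hmono n z) \<circ> int summable_on UNIV"
      by (subst (asm) summable_on_reindex) auto
    then show "(\<lambda>n. a (int n) * z ^ n) summable_on UNIV"
      by (simp add: o_def hmono_def)
    have "(\<lambda>n. a n * hmono n z) summable_on range (\<lambda>n. - int (Suc n))"
      by (rule summable_on_subset_banach[OF s]) auto
    then have "(\<lambda>n. a n * hmono n z) \<circ> (\<lambda>n. - int (Suc n)) summable_on UNIV"
      using inj_neg_int by (subst (asm) summable_on_reindex) auto
    moreover have "((\<lambda>n. a n * hmono n z) \<circ> (\<lambda>n. - int (Suc n))) = (\<lambda>n. a (- int (Suc n)) * cnj z ^ Suc n)"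
      by (rule ext) (simp only: o_def hmono_def, simp add: nat_add_distrib)
    ultimately show "(\<lambda>n. a (- int (Suc n)) * cnj z ^ Suc n) summable_on UNIV" by (simp only:)
  qed
  have G: "((\<lambda>n. a (int n) * z ^ n) has_sum G z) UNIV"
    and K: "((\<lambda>n. a (- int (Suc n)) * cnj z ^ Suc n) has_sum K z) UNIV" if "z \<in> unit_disk" for z
    unfolding G_def K_def by (intro has_sum_infsum sum that)+
  have "G holomorphic_on unit_disk"
    by (rule power_series_holomorphic[where a = "\<lambda>n. a (int n)"])
       (use G has_sum_imp_sums in fastforce)
  moreover have "(\<lambda>z. cnj (K z)) holomorphic_on unit_disk"
  proof (rule power_series_holomorphic[where a = b])
    fix z :: complex assume z: "z \<in> unit_disk"
    have "((\<lambda>n. cnj (a (- int (Suc n)) * cnj z ^ Suc n)) has_sum cnj (K z)) UNIV"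
      using K[OF z] by (subst has_sum_cnj_iff)
    then have "(\<lambda>n. b (Suc n) * z ^ Suc n) sums cnj (K z)"
      by (intro has_sum_imp_sums) (simp add: b_def)
    then have "(\<lambda>n. b n * z ^ n) sums (cnj (K z) + b 0 * z ^ 0)"
      by (rule sums_Suc)
    then show "(\<lambda>n. b n * (z - 0) ^ n) sums cnj (K z)"
      by (simp add: b_def)
  qed
  moreover have "hseries a z = G z + cnj (cnj (K z))" if z: "z \<in> unit_disk" for z
  proof -
    have "((\<lambda>n. a n * hmono n z) has_sum (G z + K z)) UNIV"
    proof (rule has_sum_int_from_nat)
      show "((\<lambda>n. a (int n) * hmono (int n) z) has_sum G z) UNIV"
        using G[OF z] by (simp add: hmono_def)
      have "hmono (- int (Suc n)) z = cnj z ^ Suc n" for n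
        by (simp only: hmono_def, simp add: nat_add_distrib)
      then show "((\<lambda>n. a (- int (Suc n)) * hmono (- int (Suc n)) z) has_sum K z) UNIV"
        using K[OF z] by (simp only:)
    qed
    then show ?thesis using has_sum_unique has_sum_hseries[OF a z] by fastforce
  qed
  ultimately show ?thesis by blast
qed

lemma harmonic_hseries: "disk_convergent a \<Longrightarrow> harmonic_on (hseries a) unit_disk"
  using hseries_decomposition harmonic_on_holomorphic_add_cnj[OF open_ball] by metis

lemma abs_summable_powser_disk:
  assumes f: "f holomorphic_on unit_disk" and r: "0 \<le> r" "r < 1"
  shows "(\<lambda>n. norm ((deriv ^^ n) f 0 / fact n) * r ^ n) summable_on UNIV"
proof -
  define x where "x = (1 + r) / 2"
  have x: "r < x" "x < 1" using r by (auto simp: x_def)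
  have "(\<lambda>n. (deriv ^^ n) f 0 / fact n * (of_real x - 0) ^ n) sums f (of_real x)"
    by (rule holomorphic_power_series[OF f]) (use x r in auto)
  then have "summable (\<lambda>n. (deriv ^^ n) f 0 / fact n * of_real x ^ n)"
    by (simp add: sums_iff)
  then have "summable (\<lambda>n. norm ((deriv ^^ n) f 0 / fact n * of_real r ^ n))"
    by (rule powser_insidea) (use x r in simp)
  then show ?thesis
    using r by (subst summable_on_UNIV_nonneg_real_iff) (auto simp: norm_mult norm_power norm_divide)
qed

text \<open>The coefficients are the Taylor coefficients of the two holomorphic parts; \<open>H 0 = 0\<close> keeps the
  constant term from being counted twice.\<close>
lemma harmonic_imp_hseries:
  assumes f: "harmonic_on f unit_disk" and out: "\<And>z. z \<notin> unit_disk \<Longrightarrow> f z = 0"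
  shows "\<exists>a. disk_convergent a \<and> f = hseries a"
proof -
  obtain G H where G: "G holomorphic_on unit_disk" and H: "H holomorphic_on unit_disk" "H 0 = 0"
    and fGH: "\<And>z. z \<in> unit_disk \<Longrightarrow> f z = G z + cnj (H z)"
    using harmonic_on_disk_decomposition[OF f] by metis
  define g where "g n = (deriv ^^ n) G 0 / fact n" for n
  define h where "h n = (deriv ^^ n) H 0 / fact n" for n
  define a where "a n = (if n \<ge> 0 then g (nat n) else cnj (h (nat (- n))))" for n
  have a_neg: "a (- int (Suc n)) = cnj (h (Suc n))" for n
    unfolding a_def by (simp add: nat_add_distrib del: of_nat_Suc) 
  have "disk_convergent a"
    unfolding disk_convergent_def
  proof (intro allI impI, elim conjE)
    fix r :: real assume r: "0 \<le> r" "r < 1"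
    obtain A where A: "((\<lambda>n. norm (g n) * r ^ n) has_sum A) UNIV"
      using abs_summable_powser_disk[OF G r] unfolding g_def summable_on_def by blast
    have "(\<lambda>n. norm (h n) * r ^ n) summable_on range Suc"
      by (rule summable_on_subset_banach) (use abs_summable_powser_disk[OF H(1) r] in \<open>auto simp: h_def\<close>)
    then have "(\<lambda>n. norm (h (Suc n)) * r ^ Suc n) summable_on UNIV"
      by (subst (asm) summable_on_reindex) (auto simp: o_def)
    then obtain B where B: "((\<lambda>n. norm (h (Suc n)) * r ^ Suc n) has_sum B) UNIV"
      unfolding summable_on_def by blast
    have "((\<lambda>n. norm (a n) * r ^ nat \<bar>n\<bar>) has_sum (A + B)) UNIV"
    proof (rule has_sum_int_from_nat)
      show "((\<lambda>n. norm (a (int n)) * r ^ nat \<bar>int n\<bar>) has_sum A) UNIV"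
        using A by (simp add: a_def)
      have "nat \<bar>- int (Suc n)\<bar> = Suc n" for n by simp
      then show "((\<lambda>n. norm (a (- int (Suc n))) * r ^ nat \<bar>- int (Suc n)\<bar>) has_sum B) UNIV"
        using B by (simp only: a_neg complex_mod_cnj)
    qed
    then show "(\<lambda>n. norm (a n) * r ^ nat \<bar>n\<bar>) summable_on UNIV"
      unfolding summable_on_def by blast
  qed
  moreover have "f z = hseries a z" for z
  proof (cases "z \<in> unit_disk")
    case z: True
    then have nz: "norm z < 1" by simp
    have "(\<lambda>n. g n * (z - 0) ^ n) sums G z" unfolding g_def
      by (rule holomorphic_power_series[OF G z])
    moreover have "summable (\<lambda>n. norm (g n * z ^ n))"
      using abs_summable_powser_disk[OF G norm_ge_zero nz]
      by (subst (asm) summable_on_UNIV_nonneg_real_iff) (auto simp: g_def norm_mult norm_power norm_divide)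
    ultimately have Gs: "((\<lambda>n. g n * z ^ n) has_sum G z) UNIV"
      by (intro norm_summable_imp_has_sum) auto
    have hs: "(\<lambda>n. h n * (z - 0) ^ n) sums H z" unfolding h_def
      by (rule holomorphic_power_series[OF H(1) z])
    have "summable (\<lambda>n. norm (h n * z ^ n))"
      using abs_summable_powser_disk[OF H(1) norm_ge_zero nz]
      by (subst (asm) summable_on_UNIV_nonneg_real_iff) (auto simp: h_def norm_mult norm_power norm_divide)
    then have sum_h: "summable (\<lambda>n. norm (h (Suc n) * z ^ Suc n))"
      by (subst summable_Suc_iff)
    have "h 0 = 0" by (simp add: h_def H(2))
    then have "(\<lambda>n. h (Suc n) * z ^ Suc n) sums H z"
      using hs by (subst sums_Suc_iff) simp
    with sum_h have "((\<lambda>n. h (Suc n) * z ^ Suc n) has_sum H z) UNIV"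
      by (rule norm_summable_imp_has_sum)
    then have Hs: "((\<lambda>n. cnj (h (Suc n) * z ^ Suc n)) has_sum cnj (H z)) UNIV"
      by (subst has_sum_cnj_iff)
    have "((\<lambda>n. a n * hmono n z) has_sum (G z + cnj (H z))) UNIV"
    proof (rule has_sum_int_from_nat)
      show "((\<lambda>n. a (int n) * hmono (int n) z) has_sum G z) UNIV"
        using Gs by (simp add: a_def hmono_def)
      have "hmono (- int (Suc n)) z = cnj z ^ Suc n" for n
        by (simp only: hmono_def, simp add: nat_add_distrib)
      then show "((\<lambda>n. a (- int (Suc n)) * hmono (- int (Suc n)) z) has_sum cnj (H z)) UNIV"
        using Hs by (simp only: a_neg complex_cnj_mult complex_cnj_power)
    qed
    then have "(\<Sum>\<^sub>\<infinity>n. a n * hmono n z) = G z + cnj (H z)" by (rule infsumI)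
    then show ?thesis by (simp only: hseries_def z fGH if_True)
  next
    case False
    then show ?thesis using out by (simp add: hseries_def)
  qed
  then have "f = hseries a" by (rule ext)
  ultimately show ?thesis by blast
qed

lemma harmonic_measurable_disk_area:
  assumes "harmonic_on f unit_disk"
  shows "f \<in> borel_measurable disk_area"
proof (rule continuous_measurable_disk_area)
  show "continuous_on unit_disk f"
    using assms unfolding harmonic_on_def
    by (meson continuous_at_imp_continuous_on has_derivative_continuous)
qed

section \<open>Parseval's identity\<close>

text \<open>Turns unordered summation over the integers into a sequence of finite sums, for which the
  convergence theorems of integration apply.\<close>
lemma LIMSEQ_symmetric_sums:
  fixes f :: "int \<Rightarrow> 'a::topological_comm_monoid_add"
  assumes "(f has_sum S) UNIV"
  shows "(\<lambda>N. \<Sum>n\<in>{- int N..int N}. f n) \<longlonglongrightarrow> S"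
proof -
  have "filterlim (\<lambda>N. {- int N..int N}) (finite_subsets_at_top UNIV) sequentially"
    unfolding filterlim_finite_subsets_at_top
  proof (intro allI impI, elim conjE)
    fix X :: "int set" assume "finite X"
    then obtain M where M: "\<And>x. x \<in> X \<Longrightarrow> \<bar>x\<bar> \<le> M"
      using Max_ge[of "abs ` X"] by (meson finite_imageI imageI)
    show "\<forall>\<^sub>F N in sequentially. finite {- int N..int N} \<and> X \<subseteq> {- int N..int N} \<and> {- int N..int N} \<subseteq> UNIV"
      using eventually_ge_at_top[of "nat M"]
    proof eventually_elim
      case (elim N)
      have "x \<in> {- int N..int N}" if "x \<in> X" for x using M[OF that] elim by auto
      then show ?case by auto
    qed
  qed
  then show ?thesis using assms unfolding has_sum_def by (rule filterlim_compose[rotated])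
qed

lemma moment_cutoff:
  assumes "(\<lambda>z::complex. \<omega> (norm z)) \<in> borel_measurable disk_area"
  shows "moment (\<lambda>r. complex_of_real (\<omega> r)) m = of_real (\<integral>z. \<omega> (norm z) * norm z ^ m \<partial>disk_area)"
  unfolding moment_def by (simp flip: of_real_power of_real_mult)

lemma integral_finite_hmono_sum:
  fixes \<omega> :: "real \<Rightarrow> real"
  assumes \<omega>m: "(\<lambda>z::complex. \<omega> (norm z)) \<in> borel_measurable disk_area"
    and \<omega>1: "\<And>r. \<bar>\<omega> r\<bar> \<le> 1" and F: "finite F"
  shows "(\<integral>z. \<omega> (norm z) * (norm (\<Sum>n\<in>F. a n * hmono n z))\<^sup>2 \<partial>disk_area)
    = (\<Sum>n\<in>F. (norm (a n))\<^sup>2 * (\<integral>z. \<omega> (norm z) * norm z ^ (2 * nat \<bar>n\<bar>) \<partial>disk_area))" (is "?L = ?R")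
proof -
  let ?\<omega> = "\<lambda>r. complex_of_real (\<omega> r)"
  have m: "(\<lambda>z. ?\<omega> (norm z)) \<in> borel_measurable disk_area" using \<omega>m by simp
  have int: "integrable disk_area (\<lambda>z. ?\<omega> (norm z) * (hmono n z * cnj (hmono k z)))" for n k
  proof -
    interpret finite_measure disk_area by (rule finite_measure_disk_area)
    have "integrable disk_area (\<lambda>z. ?\<omega> (norm z))"
      by (rule integrable_const_bound[where B = 1]) (use m \<omega>1 in auto)
    moreover have "continuous_on (cball 0 1) (\<lambda>z. hmono n z * cnj (hmono k z))"
      unfolding cnj_hmono by (intro continuous_intros)
    ultimately show ?thesis by (rule integrable_disk_area_mult_continuous)
  qed
  have eq: "complex_of_real (\<omega> (norm z) * (norm (\<Sum>n\<in>F. a n * hmono n z))\<^sup>2)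
      = (\<Sum>n\<in>F. \<Sum>k\<in>F. a n * cnj (a k) * (?\<omega> (norm z) * (hmono n z * cnj (hmono k z))))" for z
  proof -
    let ?p = "\<Sum>n\<in>F. a n * hmono n z"
    have "complex_of_real (\<omega> (norm z) * (norm ?p)\<^sup>2) = ?\<omega> (norm z) * (?p * cnj ?p)"
      by (simp only: of_real_mult complex_norm_square)
    also have "?p * cnj ?p = (\<Sum>n\<in>F. \<Sum>k\<in>F. (a n * hmono n z) * cnj (a k * hmono k z))"
      by (simp only: cnj_sum sum_product)
    also have "?\<omega> (norm z) * \<dots> = (\<Sum>n\<in>F. \<Sum>k\<in>F. ?\<omega> (norm z) * ((a n * hmono n z) * cnj (a k * hmono k z)))"
      by (simp only: sum_distrib_left)
    finally show ?thesis by (simp add: mult_ac)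
  qed
  have "complex_of_real ?L = (\<integral>z. complex_of_real (\<omega> (norm z) * (norm (\<Sum>n\<in>F. a n * hmono n z))\<^sup>2) \<partial>disk_area)"
    by (rule integral_complex_of_real[symmetric])
  also have "\<dots> = (\<Sum>n\<in>F. \<Sum>k\<in>F. a n * cnj (a k) * (\<integral>z. ?\<omega> (norm z) * (hmono n z * cnj (hmono k z)) \<partial>disk_area))"
    unfolding eq using int by (simp add: Bochner_Integration.integral_sum)
  also have "\<dots> = (\<Sum>n\<in>F. \<Sum>k\<in>F. a n * cnj (a k) * (if k = n then moment ?\<omega> (nat \<bar>n\<bar> + nat \<bar>k\<bar>) else 0))"
    using integral_quasihomogeneous_hmono[OF m, of 0] by (simp add: quasihomogeneous_def)
  also have "\<dots> = (\<Sum>n\<in>F. a n * cnj (a n) * moment ?\<omega> (2 * nat \<bar>n\<bar>))"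
    using F by (simp add: if_distrib[of "\<lambda>x. _ * x"] sum.delta mult_2 cong: if_cong)
  also have "\<dots> = complex_of_real ?R"
    unfolding moment_cutoff[OF \<omega>m] complex_norm_square[symmetric] by simp
  finally show ?thesis using of_real_eq_iff by blast
qed

lemma cutoff_measurable: "(\<lambda>z::complex. indicator {..<\<rho>} (norm z) :: real) \<in> borel_measurable disk_area"
  by measurable

text \<open>On a disk of radius \<open>\<rho> < 1\<close> the partial sums are uniformly bounded, so that the identity for finite
  sums passes to the limit by dominated convergence.\<close>
lemma truncated_parseval:
  assumes a: "disk_convergent a" and \<rho>: "0 \<le> \<rho>" "\<rho> < 1"
  shows "integrable disk_area (\<lambda>z. indicator {..<\<rho>} (norm z) * (norm (hseries a z))\<^sup>2)" (is "integrable _ ?f")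
    and "(\<lambda>N. \<Sum>n\<in>{- int N..int N}. (norm (a n))\<^sup>2 *
           (\<integral>z. indicator {..<\<rho>} (norm z) * norm z ^ (2 * nat \<bar>n\<bar>) \<partial>disk_area))
         \<longlonglongrightarrow> (\<integral>z. indicator {..<\<rho>} (norm z) * (norm (hseries a z))\<^sup>2 \<partial>disk_area)" (is ?lim)
proof -
  define B where "B = (\<Sum>\<^sub>\<infinity>n. norm (a n) * \<rho> ^ nat \<bar>n\<bar>)"
  have sum: "(\<lambda>n. norm (a n) * \<rho> ^ nat \<bar>n\<bar>) summable_on UNIV"
    using a \<rho> by (simp add: disk_convergent_def)
  let ?p = "\<lambda>N z. \<Sum>n\<in>{- int N..int N}. a n * hmono n z"
  let ?\<omega> = "\<lambda>z::complex. indicator {..<\<rho>} (norm z) :: real"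
  have pB: "norm (?p N z) \<le> B" if "norm z < \<rho>" for N z
  proof -
    have "norm (?p N z) \<le> (\<Sum>n\<in>{- int N..int N}. norm (a n) * \<rho> ^ nat \<bar>n\<bar>)"
      using that by (intro sum_norm_le) (auto simp: norm_mult norm_hmono intro!: mult_left_mono power_mono)
    also have "\<dots> \<le> B" unfolding B_def
      by (rule finite_sum_le_infsum[OF sum]) (use \<rho> in auto)
    finally show ?thesis .
  qed
  have lim: "(\<lambda>N. ?p N z) \<longlonglongrightarrow> hseries a z" if "z \<in> unit_disk" for z
    by (rule LIMSEQ_symmetric_sums[OF has_sum_hseries[OF a that]])
  have pm: "?p N \<in> borel_measurable disk_area" for N
    by (rule continuous_measurable_disk_area) (intro continuous_intros)
  have hm: "hseries a \<in> borel_measurable disk_area"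
    by (rule harmonic_measurable_disk_area[OF harmonic_hseries[OF a]])
  have const: "integrable disk_area (\<lambda>_. B\<^sup>2)"
    using finite_measure_disk_area by (simp add: finite_measure.integrable_const)
  have m1: "?f \<in> borel_measurable disk_area"
    using cutoff_measurable[measurable] hm[measurable] by measurable
  have m2: "(\<lambda>z. ?\<omega> z * (norm (?p N z))\<^sup>2) \<in> borel_measurable disk_area" for N
    using cutoff_measurable[measurable] pm[measurable] by measurable
  have l: "AE z in disk_area. (\<lambda>N. ?\<omega> z * (norm (?p N z))\<^sup>2) \<longlonglongrightarrow> ?f z"
    by (intro AE_I2 tendsto_intros lim) simp
  have b: "AE z in disk_area. norm (?\<omega> z * (norm (?p N z))\<^sup>2) \<le> B\<^sup>2" for N
    using pB by (intro AE_I2) (auto simp: indicator_def intro!: power_mono)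
  show "integrable disk_area ?f"
    by (rule integrable_dominated_convergence[OF m1 m2 const l b])
  have "(\<lambda>N. \<integral>z. ?\<omega> z * (norm (?p N z))\<^sup>2 \<partial>disk_area) \<longlonglongrightarrow> (\<integral>z. ?f z \<partial>disk_area)"
    by (rule integral_dominated_convergence[OF m1 m2 const l b])
  then show ?lim
    using integral_finite_hmono_sum[OF cutoff_measurable] by (simp add: indicator_def)
qed

abbreviation ell2_term :: "(int \<Rightarrow> complex) \<Rightarrow> int \<Rightarrow> real" where
  "ell2_term a n \<equiv> (norm (a n))\<^sup>2 / (real_of_int \<bar>n\<bar> + 1)"

text \<open>Both sides are suprema in two parameters, the radius \<open>\<rho>\<close> and the number of terms \<open>N\<close>. Each of the two
  inequalities fixes one parameter and lets the other one tend to its limit. Stated in the extended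
  reals, it decides at the same time which series have finite norm.\<close>
lemma nn_integral_hseries:
  assumes a: "disk_convergent a"
  shows "(\<integral>\<^sup>+ z. ennreal ((norm (hseries a z))\<^sup>2) \<partial>disk_area)
    = (SUP N. ennreal (\<Sum>n\<in>{- int N..int N}. ell2_term a n))" (is "?I = ?S")
proof -
  define \<rho> where "\<rho> j = 1 - 1 / (real j + 1)" for j :: nat
  have \<rho>: "0 \<le> \<rho> j" "\<rho> j < 1" for j by (auto simp: \<rho>_def field_simps)
  have \<rho>_mono: "\<rho> i \<le> \<rho> j" if "i \<le> j" for i j using that by (simp add: \<rho>_def frac_le)
  have "\<rho> \<longlonglongrightarrow> 1 - 0" unfolding \<rho>_def
    using LIMSEQ_inverse_real_of_nat by (intro tendsto_intros) (simp add: inverse_eq_divide add.commute)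
  then have \<rho>_ev: "\<forall>\<^sub>F j in sequentially. norm z < \<rho> j" if "z \<in> unit_disk" for z :: complex
    using that by (intro order_tendstoD(1)) auto
  let ?\<omega> = "\<lambda>j z. indicator {..<\<rho> j} (norm (z::complex)) :: real"
  define M where "M j n = (\<integral>z. ?\<omega> j z * norm z ^ (2 * nat \<bar>n\<bar>) \<partial>disk_area)" for j and n :: int
  have powi: "norm z powi (2 * \<bar>n\<bar>) = norm z ^ (2 * nat \<bar>n\<bar>)" for z :: complex and n
    by (simp add: power_int_def nat_mult_distrib)
  have int_pow: "integrable disk_area (\<lambda>z. norm z ^ (2 * nat \<bar>n\<bar>))" for n
    using integrable_norm_powi_iff[of "2 * \<bar>n\<bar>"] unfolding powi by simp
  have pow: "(\<integral>z. norm z ^ (2 * nat \<bar>n\<bar>) \<partial>disk_area) = 1 / (real_of_int \<bar>n\<bar> + 1)" for n :: int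
  proof -
    have "(\<integral>z. norm z ^ (2 * nat \<bar>n\<bar>) \<partial>disk_area) = 2 / (2 * real_of_int \<bar>n\<bar> + 2)"
      using integral_norm_powi[of "2 * \<bar>n\<bar>"] unfolding powi by simp
    also have "\<dots> = 2 * 1 / (2 * (real_of_int \<bar>n\<bar> + 1))" by simp
    also have "\<dots> = 1 / (real_of_int \<bar>n\<bar> + 1)" by (subst mult_divide_mult_cancel_left) auto
    finally show ?thesis by simp
  qed
  have \<omega>_lim: "(\<lambda>j. ?\<omega> j z) \<longlonglongrightarrow> 1" if "z \<in> unit_disk" for z
    by (rule tendsto_eventually) (use \<rho>_ev[OF that] in eventually_elim, simp)
  have Mm: "(\<lambda>z. ?\<omega> j z * norm z ^ (2 * nat \<bar>n\<bar>)) \<in> borel_measurable disk_area" for j n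
    using cutoff_measurable[measurable] by measurable
  have M_bound: "AE z in disk_area. norm (?\<omega> j z * norm z ^ (2 * nat \<bar>n\<bar>)) \<le> norm z ^ (2 * nat \<bar>n\<bar>)" for j n
    by (intro AE_I2) (auto simp: indicator_def)
  have M_le: "M j n \<le> 1 / (real_of_int \<bar>n\<bar> + 1)" for j n
    unfolding M_def pow[symmetric]
    by (intro integral_mono int_pow Bochner_Integration.integrable_bound[OF int_pow Mm])
       (use M_bound in \<open>auto simp: indicator_def\<close>)
  have M_lim: "(\<lambda>j. M j n) \<longlonglongrightarrow> 1 / (real_of_int \<bar>n\<bar> + 1)" for n
    unfolding M_def pow[symmetric]
  proof (rule integral_dominated_convergence[OF _ Mm int_pow _ M_bound])
    show "AE z in disk_area. (\<lambda>j. ?\<omega> j z * norm z ^ (2 * nat \<bar>n\<bar>)) \<longlonglongrightarrow> norm z ^ (2 * nat \<bar>n\<bar>)"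
      using \<omega>_lim by (intro AE_I2) (auto intro!: tendsto_eq_intros)
  qed measurable
  let ?f = "\<lambda>j z. ?\<omega> j z * (norm (hseries a z))\<^sup>2"
  note tp = truncated_parseval[OF a \<rho>]
  have nn: "(\<integral>\<^sup>+ z. ennreal (?f j z) \<partial>disk_area) = ennreal (\<integral>z. ?f j z \<partial>disk_area)" for j
    by (rule nn_integral_eq_integral[OF tp(1)]) auto
  have "?I = (\<integral>\<^sup>+ z. (SUP j. ennreal (?f j z)) \<partial>disk_area)"
  proof (rule nn_integral_cong)
    fix z assume "z \<in> space disk_area"
    then have z: "z \<in> unit_disk" by simp
    have inc: "incseq (\<lambda>j. ennreal (?f j z))"
      using \<rho>_mono by (intro incseq_SucI ennreal_leI mult_right_mono)
        (auto simp: indicator_def intro: order.strict_trans2)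
    have "(\<lambda>j. ennreal (?f j z)) \<longlonglongrightarrow> ennreal (1 * (norm (hseries a z))\<^sup>2)"
      by (intro tendsto_ennrealI tendsto_intros \<omega>_lim z)
    from LIMSEQ_unique[OF this LIMSEQ_SUP[OF inc]]
    show "ennreal ((norm (hseries a z))\<^sup>2) = (SUP j. ennreal (?f j z))" by (simp only: mult_1)
  qed
  also have "\<dots> = (SUP j. \<integral>\<^sup>+ z. ennreal (?f j z) \<partial>disk_area)"
  proof (rule nn_integral_monotone_convergence_SUP)
    show "incseq (\<lambda>j z. ennreal (?f j z))"
      using \<rho>_mono by (intro incseq_SucI le_funI ennreal_leI mult_right_mono)
        (auto simp: indicator_def intro: order.strict_trans2)
    show "(\<lambda>z. ennreal (?f j z)) \<in> borel_measurable disk_area" for j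
      using tp(1)[of j] by (intro measurable_compose[OF _ measurable_ennreal]) simp
  qed
  finally have I: "?I = (SUP j. ennreal (\<integral>z. ?f j z \<partial>disk_area))" by (simp only: nn)
  show ?thesis
  proof (rule antisym)
    show "?I \<le> ?S" unfolding I
    proof (rule SUP_least)
      fix j
      have "(\<lambda>N. ennreal (\<Sum>n\<in>{- int N..int N}. (norm (a n))\<^sup>2 * M j n)) \<longlonglongrightarrow> ennreal (\<integral>z. ?f j z \<partial>disk_area)"
        using tp(2)[of j] unfolding M_def by (rule tendsto_ennrealI)
      then show "ennreal (\<integral>z. ?f j z \<partial>disk_area) \<le> ?S"
      proof (rule LIMSEQ_le_const2, intro exI[of _ 0] allI impI)
        fix N
        have "(\<Sum>n\<in>{- int N..int N}. (norm (a n))\<^sup>2 * M j n) \<le> (\<Sum>n\<in>{- int N..int N}. ell2_term a n)"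
          using M_le by (intro sum_mono) (metis mult_left_mono times_divide_eq_right mult.right_neutral zero_le_power2)
        then show "ennreal (\<Sum>n\<in>{- int N..int N}. (norm (a n))\<^sup>2 * M j n) \<le> ?S"
          by (intro SUP_upper2[of N] ennreal_leI) auto
      qed
    qed
    show "?S \<le> ?I"
    proof (rule SUP_least)
      fix N
      have "(\<lambda>j. ennreal (\<Sum>n\<in>{- int N..int N}. (norm (a n))\<^sup>2 * M j n))
          \<longlonglongrightarrow> ennreal (\<Sum>n\<in>{- int N..int N}. (norm (a n))\<^sup>2 * (1 / (real_of_int \<bar>n\<bar> + 1)))"
        by (intro tendsto_ennrealI tendsto_intros M_lim)
      then have "ennreal (\<Sum>n\<in>{- int N..int N}. (norm (a n))\<^sup>2 * (1 / (real_of_int \<bar>n\<bar> + 1))) \<le> ?I"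
      proof (rule LIMSEQ_le_const2, intro exI[of _ 0] allI impI)
        fix j
        have M0: "M j n \<ge> 0" for n unfolding M_def by (intro integral_nonneg_AE AE_I2) auto
        have "incseq (\<lambda>N. \<Sum>n\<in>{- int N..int N}. (norm (a n))\<^sup>2 * M j n)"
          using M0 by (intro incseq_SucI sum_mono2) auto
        then have "(\<Sum>n\<in>{- int N..int N}. (norm (a n))\<^sup>2 * M j n) \<le> (\<integral>z. ?f j z \<partial>disk_area)"
          using tp(2)[of j] unfolding M_def by (rule incseq_le)
        then show "ennreal (\<Sum>n\<in>{- int N..int N}. (norm (a n))\<^sup>2 * M j n) \<le> ?I"
          unfolding I by (intro SUP_upper2[of j] ennreal_leI) auto
      qed
      then show "ennreal (\<Sum>n\<in>{- int N..int N}. ell2_term a n) \<le> ?I" by simp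
    qed
  qed
qed

text \<open>The weighted sequence space that corresponds to the harmonic Bergman space.\<close>
definition ell2 :: "(int \<Rightarrow> complex) \<Rightarrow> bool" where
  "ell2 a \<longleftrightarrow> (\<lambda>n. ell2_term a n) summable_on UNIV"

lemma summable_on_int_geometric:
  fixes r :: real
  assumes "0 \<le> r" "r < 1"
  shows "(\<lambda>n::int. (real_of_int \<bar>n\<bar> + 1) * r ^ nat \<bar>n\<bar>) summable_on UNIV"
proof -
  have s: "summable (\<lambda>n. real (Suc n) * r ^ n)"
    using geometric_deriv_sums[of r] assms by (auto simp: sums_iff)
  then have s': "summable (\<lambda>n. real (Suc (Suc n)) * r ^ Suc n)"
    using summable_Suc_iff[of "\<lambda>n. real (Suc n) * r ^ n"] by simp
  have "(\<lambda>n. real (Suc n) * r ^ n) summable_on UNIV" "(\<lambda>n. real (Suc (Suc n)) * r ^ Suc n) summable_on UNIV"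
    using s s' assms by (subst summable_on_UNIV_nonneg_real_iff; simp)+
  then obtain A B where A: "((\<lambda>n. real (Suc n) * r ^ n) has_sum A) UNIV"
    and B: "((\<lambda>n. real (Suc (Suc n)) * r ^ Suc n) has_sum B) UNIV"
    unfolding summable_on_def by blast
  have "((\<lambda>n::int. (real_of_int \<bar>n\<bar> + 1) * r ^ nat \<bar>n\<bar>) has_sum (A + B)) UNIV"
  proof (rule has_sum_int_from_nat)
    show "((\<lambda>n. (real_of_int \<bar>int n\<bar> + 1) * r ^ nat \<bar>int n\<bar>) has_sum A) UNIV"
      using A by (simp add: add.commute)
    have "nat \<bar>- int (Suc n)\<bar> = Suc n" "real_of_int \<bar>- int (Suc n)\<bar> + 1 = real (Suc (Suc n))" for n by simp_all
    then show "((\<lambda>n. (real_of_int \<bar>- int (Suc n)\<bar> + 1) * r ^ nat \<bar>- int (Suc n)\<bar>) has_sum B) UNIV"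
      using B by (simp only:)
  qed
  then show ?thesis unfolding summable_on_def by blast
qed

lemma ell2_imp_disk_convergent:
  assumes "ell2 a"
  shows "disk_convergent a"
  unfolding disk_convergent_def
proof (intro allI impI, elim conjE)
  fix r :: real assume r: "0 \<le> r" "r < 1"
  have "(\<lambda>n::int. (real_of_int \<bar>n\<bar> + 1) * (r\<^sup>2) ^ nat \<bar>n\<bar>) summable_on UNIV"
    by (rule summable_on_int_geometric) (use r in \<open>auto simp: power_less_one_iff\<close>)
  then have "(\<lambda>n. ell2_term a n + (real_of_int \<bar>n\<bar> + 1) * (r\<^sup>2) ^ nat \<bar>n\<bar>) summable_on UNIV"
    using assms unfolding ell2_def by (intro summable_on_add) auto
  then show "(\<lambda>n. norm (a n) * r ^ nat \<bar>n\<bar>) summable_on UNIV"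
  proof (rule summable_on_comparison_test)
    fix n :: int
    define x where "x = norm (a n)"
    define y where "y = r ^ nat \<bar>n\<bar>"
    \<comment> \<open>the inequality of arithmetic and geometric means, with \<open>|n| + 1\<close> balancing the two factors\<close>
    define h where "h = sqrt (real_of_int \<bar>n\<bar> + 1)"
    have h: "h > 0" "h\<^sup>2 = real_of_int \<bar>n\<bar> + 1" by (auto simp: h_def)
    have "2 * ((x / h) * (h * y)) \<le> (x / h)\<^sup>2 + (h * y)\<^sup>2"
      using sum_squares_bound[of "x / h" "h * y"] by (simp only: mult.assoc)
    then have "2 * (x * y) \<le> x\<^sup>2 / h\<^sup>2 + h\<^sup>2 * y\<^sup>2"
      using h by (simp add: power_mult_distrib power_divide)
    moreover have "0 \<le> x * y" using r by (simp add: x_def y_def)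
    moreover have "(r\<^sup>2) ^ nat \<bar>n\<bar> = y\<^sup>2" by (simp add: y_def mult.commute flip: power_mult)
    ultimately show "norm (a n) * r ^ nat \<bar>n\<bar> \<le> ell2_term a n + (real_of_int \<bar>n\<bar> + 1) * (r\<^sup>2) ^ nat \<bar>n\<bar>"
      unfolding x_def[symmetric] y_def[symmetric] h(2) by simp
  qed (use r in auto)
qed

lemma hseries_bergman_norm:
  assumes "ell2 a"
  shows "integrable disk_area (\<lambda>z. (norm (hseries a z))\<^sup>2)"
    and "(bergman_norm (hseries a))\<^sup>2 = (\<Sum>\<^sub>\<infinity>n. ell2_term a n)"
proof -
  define S where "S = (\<Sum>\<^sub>\<infinity>n. ell2_term a n)"
  have dc: "disk_convergent a" using assms by (rule ell2_imp_disk_convergent)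
  have "((\<lambda>n. ell2_term a n) has_sum S) UNIV"
    using assms unfolding S_def ell2_def by (rule has_sum_infsum)
  then have lim: "(\<lambda>N. \<Sum>n\<in>{- int N..int N}. ell2_term a n) \<longlonglongrightarrow> S"
    by (rule LIMSEQ_symmetric_sums)
  have "S \<ge> 0" unfolding S_def by (intro infsum_nonneg) auto
  have inc: "incseq (\<lambda>N. ennreal (\<Sum>n\<in>{- int N..int N}. ell2_term a n))"
    by (intro incseq_SucI ennreal_leI sum_mono2) auto
  have "(SUP N. ennreal (\<Sum>n\<in>{- int N..int N}. ell2_term a n)) = ennreal S"
    by (rule LIMSEQ_unique[OF LIMSEQ_SUP[OF inc] tendsto_ennrealI[OF lim]])
  then have nn: "(\<integral>\<^sup>+ z. ennreal ((norm (hseries a z))\<^sup>2) \<partial>disk_area) = ennreal S"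
    using nn_integral_hseries[OF dc] by simp
  have m: "(\<lambda>z. (norm (hseries a z))\<^sup>2) \<in> borel_measurable disk_area"
    using harmonic_measurable_disk_area[OF harmonic_hseries[OF dc], measurable] by measurable
  show "integrable disk_area (\<lambda>z. (norm (hseries a z))\<^sup>2)"
    by (rule integrableI_bounded[OF m]) (simp add: nn)
  have "(\<integral>z. (norm (hseries a z))\<^sup>2 \<partial>disk_area) = S"
    using m nn \<open>S \<ge> 0\<close> by (subst integral_eq_nn_integral) auto
  then show "(bergman_norm (hseries a))\<^sup>2 = (\<Sum>\<^sub>\<infinity>n. ell2_term a n)"
    using \<open>S \<ge> 0\<close> by (simp add: bergman_norm_def S_def)
qed

lemma hseries_in_harmonic_bergman:
  assumes "ell2 a"
  shows "hseries a \<in> harmonic_bergman"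
  using hseries_bergman_norm(1)[OF assms] harmonic_hseries[OF ell2_imp_disk_convergent[OF assms]]
  by (simp add: harmonic_bergman_def hseries_def)

lemma harmonic_bergman_imp_hseries:
  assumes "f \<in> harmonic_bergman"
  obtains a where "ell2 a" "f = hseries a"
proof -
  have "harmonic_on f unit_disk" "\<And>z. z \<notin> unit_disk \<Longrightarrow> f z = 0"
    and int: "integrable disk_area (\<lambda>z. (norm (f z))\<^sup>2)"
    using assms by (auto simp: harmonic_bergman_def)
  then obtain a where a: "disk_convergent a" "f = hseries a"
    using harmonic_imp_hseries by blast
  define C where "C = (\<integral>z. (norm (f z))\<^sup>2 \<partial>disk_area)"
  have "C \<ge> 0" by (simp add: C_def)
  have "(\<integral>\<^sup>+ z. ennreal ((norm (hseries a z))\<^sup>2) \<partial>disk_area) = ennreal C"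
    unfolding C_def a(2)[symmetric] by (rule nn_integral_eq_integral[OF int]) auto
  then have C: "(SUP N. ennreal (\<Sum>n\<in>{- int N..int N}. ell2_term a n)) = ennreal C"
    unfolding nn_integral_hseries[OF a(1)] .
  have "ennreal (\<Sum>n\<in>{- int N..int N}. ell2_term a n) \<le> ennreal C" for N
    unfolding C[symmetric] by (rule SUP_upper) simp
  then have le: "(\<Sum>n\<in>{- int N..int N}. ell2_term a n) \<le> C" for N
    using \<open>C \<ge> 0\<close> by (simp add: ennreal_le_iff)
  have "ell2 a" unfolding ell2_def
  proof (rule nonneg_bdd_above_summable_on)
    show "bdd_above (sum (\<lambda>n. ell2_term a n) ` {F. F \<subseteq> UNIV \<and> finite F})"
    proof (rule bdd_aboveI2)
      fix F :: "int set" assume "F \<in> {F. F \<subseteq> UNIV \<and> finite F}"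
      then have "finite F" by simp
      then obtain M where M: "\<And>x. x \<in> F \<Longrightarrow> \<bar>x\<bar> \<le> M"
        using Max_ge[of "abs ` F"] by (meson finite_imageI imageI)
      have "F \<subseteq> {- int (nat M)..int (nat M)}" using M by fastforce
      then have "(\<Sum>n\<in>F. ell2_term a n) \<le> (\<Sum>n\<in>{- int (nat M)..int (nat M)}. ell2_term a n)"
        by (intro sum_mono2) auto
      also have "\<dots> \<le> C" by (rule le)
      finally show "(\<Sum>n\<in>F. ell2_term a n) \<le> C" .
    qed
  qed auto
  then show thesis using a(2) that by blast
qed

lemma hseries_add:
  assumes "disk_convergent a" "disk_convergent b"
  shows "hseries (\<lambda>n. a n + b n) = (\<lambda>z. hseries a z + hseries b z)"
proof
  fix z
  show "hseries (\<lambda>n. a n + b n) z = hseries a z + hseries b z"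
  proof (cases "z \<in> unit_disk")
    case True
    from has_sum_add[OF has_sum_hseries[OF assms(1) True] has_sum_hseries[OF assms(2) True]]
    have "(\<Sum>\<^sub>\<infinity>n. (a n + b n) * hmono n z) = hseries a z + hseries b z"
      by (intro infsumI) (simp add: distrib_right)
    with True show ?thesis by (simp only: hseries_def if_True)
  qed (simp add: hseries_def)
qed

lemma hseries_scale: "hseries (\<lambda>n. c * a n) = (\<lambda>z. c * hseries a z)"
  by (auto simp: hseries_def mult.assoc infsum_cmult_right')

lemma bergman_norm_hseries_eq_0_iff:
  assumes "ell2 a"
  shows "bergman_norm (hseries a) = 0 \<longleftrightarrow> a = (\<lambda>_. 0)"
proof
  assume "bergman_norm (hseries a) = 0"
  then have "(\<Sum>\<^sub>\<infinity>n. ell2_term a n) = 0" using hseries_bergman_norm(2)[OF assms] by simp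
  then have "ell2_term a n = 0" for n
    using assms unfolding ell2_def by (intro nonneg_infsum_le_0D[where A = UNIV]) auto
  then show "a = (\<lambda>_. 0)" by (auto simp: fun_eq_iff add_nonneg_eq_0_iff)
next
  assume "a = (\<lambda>_. 0)"
  then show "bergman_norm (hseries a) = 0"
    using hseries_bergman_norm(2)[OF assms] by simp
qed

lemma ell2_scale: "ell2 a \<Longrightarrow> ell2 (\<lambda>n. c * a n)"
  unfolding ell2_def norm_mult power_mult_distrib times_divide_eq_right[symmetric]
  by (rule summable_on_cmult_right)

lemma ell2_add:
  assumes "ell2 a" "ell2 b"
  shows "ell2 (\<lambda>n. a n + b n)"
  unfolding ell2_def
proof (rule summable_on_comparison_test)
  show "(\<lambda>n. 2 * (ell2_term a n) + 2 * (ell2_term b n)) summable_on UNIV"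
    using assms unfolding ell2_def by (intro summable_on_add summable_on_cmult_right)
  fix n :: int
  have "(norm (a n + b n))\<^sup>2 \<le> (norm (a n) + norm (b n))\<^sup>2"
    by (intro power_mono norm_triangle_ineq) auto
  also have "\<dots> \<le> 2 * (norm (a n))\<^sup>2 + 2 * (norm (b n))\<^sup>2"
    using sum_squares_bound[of "norm (a n)" "norm (b n)"] by (simp add: power2_sum)
  finally show "(norm (a n + b n))\<^sup>2 / (real_of_int \<bar>n\<bar> + 1) \<le> 2 * (ell2_term a n) + 2 * (ell2_term b n)"
    by (simp add: divide_right_mono flip: add_divide_distrib)
qed auto

lemma ell2_diff: "ell2 a \<Longrightarrow> ell2 b \<Longrightarrow> ell2 (\<lambda>n. a n - b n)"
  using ell2_add[of a "\<lambda>n. - 1 * b n"] ell2_scale[of b "- 1"] by simp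

lemma hseries_diff:
  assumes "ell2 a" "ell2 b"
  shows "hseries (\<lambda>n. a n - b n) = (\<lambda>z. hseries a z - hseries b z)"
proof -
  have "hseries (\<lambda>n. a n + - 1 * b n) = (\<lambda>z. hseries a z + hseries (\<lambda>n. - 1 * b n) z)"
    using assms ell2_scale[of b "- 1"] by (intro hseries_add ell2_imp_disk_convergent) auto
  then show ?thesis unfolding hseries_scale by simp
qed

lemma hseries_inject:
  assumes "ell2 a" "ell2 b"
  shows "hseries a = hseries b \<longleftrightarrow> a = b"
proof
  assume "hseries a = hseries b"
  then have "bergman_norm (hseries (\<lambda>n. a n - b n)) = 0"
    by (simp add: hseries_diff[OF assms] bergman_norm_def)
  then have "(\<lambda>n. a n - b n) = (\<lambda>_. 0)" using bergman_norm_hseries_eq_0_iff ell2_diff[OF assms] by blast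
  then show "a = b" by (auto simp: fun_eq_iff)
qed simp

section \<open>Weighted shifts\<close>

definition hcoeffs :: "(complex \<Rightarrow> complex) \<Rightarrow> int \<Rightarrow> complex" where
  "hcoeffs f = (THE a. ell2 a \<and> f = hseries a)"

definition wshift :: "int \<Rightarrow> (int \<Rightarrow> complex) \<Rightarrow> (complex \<Rightarrow> complex) \<Rightarrow> complex \<Rightarrow> complex" where
  "wshift k w = (\<lambda>f\<in>harmonic_bergman. hseries (\<lambda>n. w (n - k) * hcoeffs f (n - k)))"

lemma hcoeffs_hseries: "ell2 a \<Longrightarrow> hcoeffs (hseries a) = a"
  unfolding hcoeffs_def by (rule the_equality) (auto simp: hseries_inject)

lemma wshift_hseries:
  "ell2 a \<Longrightarrow> wshift k w (hseries a) = hseries (\<lambda>n. w (n - k) * a (n - k))"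
  by (simp add: wshift_def hseries_in_harmonic_bergman hcoeffs_hseries)

lemma bij_int_add: "bij_betw (\<lambda>n::int. n + k) UNIV UNIV"
  by (rule bij_betwI[where g = "\<lambda>n. n - k"]) auto

text \<open>Shifting by \<open>k\<close> changes the norms \<open>1 / (|n| + 1)\<close> of the basis by a factor of at most \<open>|k| + 1\<close>.\<close>
lemma wshift_term_le:
  fixes n k :: int and w :: "int \<Rightarrow> complex"
  assumes "norm (w n) \<le> M"
  shows "(norm (w n * x))\<^sup>2 / (real_of_int \<bar>n + k\<bar> + 1)
    \<le> M\<^sup>2 * (real_of_int \<bar>k\<bar> + 1) * ((norm x)\<^sup>2 / (real_of_int \<bar>n\<bar> + 1))"
proof -
  have "real_of_int \<bar>n\<bar> + 1 \<le> (real_of_int \<bar>k\<bar> + 1) * (real_of_int \<bar>n + k\<bar> + 1)"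
  proof -
    have "real_of_int \<bar>n\<bar> \<le> real_of_int \<bar>n + k\<bar> + real_of_int \<bar>k\<bar>" by linarith
    moreover have "0 \<le> real_of_int \<bar>k\<bar> * real_of_int \<bar>n + k\<bar>" by simp
    moreover have "(real_of_int \<bar>k\<bar> + 1) * (real_of_int \<bar>n + k\<bar> + 1)
        = real_of_int \<bar>k\<bar> * real_of_int \<bar>n + k\<bar> + real_of_int \<bar>k\<bar> + real_of_int \<bar>n + k\<bar> + 1"
      by (simp only: distrib_left distrib_right) simp
    ultimately show ?thesis by linarith
  qed
  then have 1: "1 / (real_of_int \<bar>n + k\<bar> + 1) \<le> (real_of_int \<bar>k\<bar> + 1) / (real_of_int \<bar>n\<bar> + 1)"
    by (simp add: field_simps)
  have "0 \<le> M" using assms norm_ge_zero order_trans by blast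
  then have "(norm (w n * x))\<^sup>2 \<le> M\<^sup>2 * (norm x)\<^sup>2"
    unfolding norm_mult power_mult_distrib using assms by (intro mult_right_mono power_mono) auto
  then have "(norm (w n * x))\<^sup>2 * (1 / (real_of_int \<bar>n + k\<bar> + 1))
      \<le> (M\<^sup>2 * (norm x)\<^sup>2) * ((real_of_int \<bar>k\<bar> + 1) / (real_of_int \<bar>n\<bar> + 1))"
    using 1 by (intro mult_mono) auto
  then show ?thesis by (simp add: mult_ac)
qed

lemma
  assumes a: "ell2 a" and w: "\<And>n. norm (w n) \<le> M"
  shows ell2_wshift: "ell2 (\<lambda>n. w (n - k) * a (n - k))"
    and bergman_norm_wshift: "(bergman_norm (hseries (\<lambda>n. w (n - k) * a (n - k))))\<^sup>2
      \<le> M\<^sup>2 * (real_of_int \<bar>k\<bar> + 1) * (bergman_norm (hseries a))\<^sup>2"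
proof -
  let ?b = "\<lambda>n. w (n - k) * a (n - k)"
  let ?g = "\<lambda>n. M\<^sup>2 * (real_of_int \<bar>k\<bar> + 1) * (ell2_term a n)"
  let ?f = "\<lambda>n. (norm (w n * a n))\<^sup>2 / (real_of_int \<bar>n + k\<bar> + 1)"
  have g: "?g summable_on UNIV" using a unfolding ell2_def by (rule summable_on_cmult_right)
  have le: "?f n \<le> ?g n" for n by (rule wshift_term_le[OF w])
  have f: "?f summable_on UNIV"
    by (rule summable_on_comparison_test[OF g]) (use le in auto)
  have shift: "?f n = (norm (?b (n + k)))\<^sup>2 / (real_of_int \<bar>n + k\<bar> + 1)" for n by simp
  show b: "ell2 ?b"
    using f unfolding ell2_def shift summable_on_reindex_bij_betw[OF bij_int_add, of "\<lambda>n. (norm (?b n))\<^sup>2 / (real_of_int \<bar>n\<bar> + 1)"] .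
  have "(bergman_norm (hseries ?b))\<^sup>2 = (\<Sum>\<^sub>\<infinity>n. ?f n)"
    unfolding hseries_bergman_norm(2)[OF b] shift
    by (rule infsum_reindex_bij_betw[OF bij_int_add, symmetric])
  also have "\<dots> \<le> (\<Sum>\<^sub>\<infinity>n. ?g n)" by (rule infsum_mono[OF f g le])
  also have "\<dots> = M\<^sup>2 * (real_of_int \<bar>k\<bar> + 1) * (bergman_norm (hseries a))\<^sup>2"
    unfolding hseries_bergman_norm(2)[OF a] by (rule infsum_cmult_right')
  finally show "(bergman_norm (hseries ?b))\<^sup>2 \<le> M\<^sup>2 * (real_of_int \<bar>k\<bar> + 1) * (bergman_norm (hseries a))\<^sup>2" .
qed

lemma bergman_norm_nonneg: "bergman_norm f \<ge> 0"
  by (simp add: bergman_norm_def)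

lemma bounded_operator_wshift:
  assumes w: "\<And>n. norm (w n) \<le> M"
  shows "bounded_operator (wshift k w)"
  unfolding bounded_operator_def
proof (intro conjI ballI allI)
  show "wshift k w \<in> harmonic_bergman \<rightarrow>\<^sub>E harmonic_bergman"
  proof (rule PiE_I)
    fix f assume "f \<in> harmonic_bergman"
    then obtain a where "ell2 a" "f = hseries a" by (rule harmonic_bergman_imp_hseries)
    then show "wshift k w f \<in> harmonic_bergman"
      using hseries_in_harmonic_bergman[OF ell2_wshift[where k = k and w = w, OF _ w]] by (simp add: wshift_hseries)
  qed (simp add: wshift_def)
next
  fix f g assume "f \<in> harmonic_bergman" "g \<in> harmonic_bergman"
  then obtain a b where a: "ell2 a" "f = hseries a" and b: "ell2 b" "g = hseries b"
    by (metis harmonic_bergman_imp_hseries)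
  note dc = ell2_imp_disk_convergent
  have "(\<lambda>z. f z + g z) = hseries (\<lambda>n. a n + b n)"
    using a b by (simp add: hseries_add dc)
  then have "wshift k w (\<lambda>z. f z + g z) = hseries (\<lambda>n. w (n - k) * (a (n - k) + b (n - k)))"
    using a b by (simp add: wshift_hseries ell2_add)
  also have "\<dots> = hseries (\<lambda>n. w (n - k) * a (n - k) + w (n - k) * b (n - k))"
    by (simp only: distrib_left)
  also have "\<dots> = (\<lambda>z. wshift k w f z + wshift k w g z)"
    using a b hseries_add[OF ell2_wshift[where k = k and w = w, OF a(1) w, THEN dc] ell2_wshift[where k = k and w = w, OF b(1) w, THEN dc]]
    by (simp add: wshift_hseries)
  finally show "wshift k w (\<lambda>z. f z + g z) = (\<lambda>z. wshift k w f z + wshift k w g z)" .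
next
  fix c f assume "f \<in> harmonic_bergman"
  then obtain a where a: "ell2 a" "f = hseries a" by (rule harmonic_bergman_imp_hseries)
  have "(\<lambda>z. c * f z) = hseries (\<lambda>n. c * a n)" using a by (simp add: hseries_scale)
  then have "wshift k w (\<lambda>z. c * f z) = hseries (\<lambda>n. w (n - k) * (c * a (n - k)))"
    using a by (simp add: wshift_hseries ell2_scale)
  also have "\<dots> = hseries (\<lambda>n. c * (w (n - k) * a (n - k)))" by (simp only: mult.left_commute)
  also have "\<dots> = (\<lambda>z. c * wshift k w f z)"
    using a by (simp add: wshift_hseries hseries_scale)
  finally show "wshift k w (\<lambda>z. c * f z) = (\<lambda>z. c * wshift k w f z)" .
next
  show "\<exists>C. \<forall>f\<in>harmonic_bergman. bergman_norm (wshift k w f) \<le> C * bergman_norm f"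
  proof (intro exI ballI)
    fix f assume "f \<in> harmonic_bergman"
    then obtain a where a: "ell2 a" "f = hseries a" by (rule harmonic_bergman_imp_hseries)
    have "(bergman_norm (wshift k w f))\<^sup>2 \<le> M\<^sup>2 * (real_of_int \<bar>k\<bar> + 1) * (bergman_norm f)\<^sup>2"
      using bergman_norm_wshift[where k = k and w = w, OF a(1) w] by (simp add: a wshift_hseries)
    also have "\<dots> = (sqrt (M\<^sup>2 * (real_of_int \<bar>k\<bar> + 1)) * bergman_norm f)\<^sup>2"
      by (simp add: power_mult_distrib)
    finally show "bergman_norm (wshift k w f) \<le> sqrt (M\<^sup>2 * (real_of_int \<bar>k\<bar> + 1)) * bergman_norm f"
      by (rule power2_le_imp_le) (simp add: bergman_norm_nonneg)
  qed
qed

section \<open>Toeplitz operators as weighted shifts\<close>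

lemma has_sum_finite_support:
  fixes f :: "int \<Rightarrow> 'a :: {topological_comm_monoid_add, t2_space}"
  assumes "finite F" "\<And>n. n \<notin> F \<Longrightarrow> f n = 0"
  shows "(f has_sum (\<Sum>n\<in>F. f n)) UNIV"
  by (rule has_sum_finite_neutralI[of F]) (use assms in auto)

lemma ell2_finite_support:
  assumes "finite F" "\<And>n. n \<notin> F \<Longrightarrow> a n = 0"
  shows "ell2 a"
  unfolding ell2_def summable_on_def
  using has_sum_finite_support[OF assms(1), of "\<lambda>n. ell2_term a n"] assms(2) by auto

lemma hseries_finite_support:
  assumes "finite F" "\<And>n. n \<notin> F \<Longrightarrow> a n = 0" "z \<in> unit_disk"
  shows "hseries a z = (\<Sum>n\<in>F. a n * hmono n z)"
  using infsumI[OF has_sum_finite_support[OF assms(1), of "\<lambda>n. a n * hmono n z"]] assms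
  by (simp add: hseries_def)

lemma sum_symmetric_interval:
  fixes f :: "int \<Rightarrow> 'a :: comm_monoid_add"
  shows "(\<Sum>n\<in>{- int N..int N}. f n) = (\<Sum>k\<le>N. f (int k)) + (\<Sum>k\<le>N. if k = 0 then 0 else f (- int k))"
proof (induction N)
  case (Suc N)
  have "{- int (Suc N)..int (Suc N)} = insert (int (Suc N)) (insert (- int (Suc N)) {- int N..int N})" by auto
  then have "(\<Sum>n\<in>{- int (Suc N)..int (Suc N)}. f n)
      = f (int (Suc N)) + (f (- int (Suc N)) + (\<Sum>n\<in>{- int N..int N}. f n))"
    by (simp only:) (subst sum.insert, simp, simp, subst sum.insert, auto)
  then show ?case using Suc by (simp add: add_ac)
qed simp

lemma harmonic_polynomials_eq:
  "harmonic_polynomials = {hseries a |a. finite {n. a n \<noteq> 0}}"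
proof (intro set_eqI iffI)
  fix p assume "p \<in> harmonic_polynomials"
  then obtain N A B where p: "p = (\<lambda>z. if z \<in> unit_disk
      then (\<Sum>k\<le>N. A k * z ^ k) + (\<Sum>k\<le>N. B k * cnj z ^ k) else 0)"
    unfolding harmonic_polynomials_def by blast
  define a where "a n = (if 0 \<le> n \<and> n \<le> int N then A (nat n) else 0) + (if n \<le> 0 \<and> - int N \<le> n then B (nat (- n)) else 0)" for n
  have supp: "a n = 0" if "n \<notin> {- int N..int N}" for n using that by (auto simp: a_def)
  have "hseries a z = p z" for z
  proof (cases "z \<in> unit_disk")
    case True
    have "(\<Sum>k\<le>N. a (int k) * hmono (int k) z) = (\<Sum>k\<le>N. A k * z ^ k) + (\<Sum>k\<le>N. if k = 0 then B 0 else 0)"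
      unfolding sum.distrib[symmetric] by (rule sum.cong) (auto simp: a_def hmono_def)
    moreover have "(\<Sum>k\<le>N. if k = 0 then 0 else a (- int k) * hmono (- int k) z)
        = (\<Sum>k\<le>N. if k = 0 then 0 else B k * cnj z ^ k)"
      by (rule sum.cong) (auto simp: a_def hmono_def)
    moreover have "(\<Sum>k\<le>N. if k = 0 then B 0 else 0) + (\<Sum>k\<le>N. if k = 0 then 0 else B k * cnj z ^ k)
        = (\<Sum>k\<le>N. B k * cnj z ^ k)"
      unfolding sum.distrib[symmetric] by (rule sum.cong) auto
    ultimately have "(\<Sum>n\<in>{- int N..int N}. a n * hmono n z) = (\<Sum>k\<le>N. A k * z ^ k) + (\<Sum>k\<le>N. B k * cnj z ^ k)"
      unfolding sum_symmetric_interval by (simp add: add.assoc)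
    then show ?thesis
      using hseries_finite_support[of "{- int N..int N}" a z] supp True by (simp add: p)
  qed (simp add: hseries_def p)
  moreover have "finite {n. a n \<noteq> 0}"
    by (rule finite_subset[of _ "{- int N..int N}"]) (use supp in blast, simp)
  ultimately show "p \<in> {hseries a |a. finite {n. a n \<noteq> 0}}" by (auto intro: exI[of _ a] simp: fun_eq_iff)
next
  fix p assume "p \<in> {hseries a |a. finite {n. a n \<noteq> 0}}"
  then obtain a where p: "p = hseries a" and fin: "finite {n. a n \<noteq> 0}" by blast
  define N where "N = nat (Max (insert 0 (abs ` {n. a n \<noteq> 0})))"
  have supp: "a n = 0" if "n \<notin> {- int N..int N}" for n
  proof (rule ccontr)
    assume "a n \<noteq> 0"
    then have "\<bar>n\<bar> \<le> Max (insert 0 (abs ` {n. a n \<noteq> 0}))" using fin by (intro Max_ge) auto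
    then have "\<bar>n\<bar> \<le> int N" unfolding N_def by linarith
    with that show False by auto
  qed
  have "p z = (\<Sum>k\<le>N. a (int k) * z ^ k) + (\<Sum>k\<le>N. (if k = 0 then 0 else a (- int k)) * cnj z ^ k)"
    if z: "z \<in> unit_disk" for z
  proof -
    have "p z = (\<Sum>n\<in>{- int N..int N}. a n * hmono n z)"
      unfolding p by (rule hseries_finite_support[OF finite_atLeastAtMost_int supp z])
    also have "\<dots> = (\<Sum>k\<le>N. a (int k) * z ^ k) + (\<Sum>k\<le>N. (if k = 0 then 0 else a (- int k)) * cnj z ^ k)"
      unfolding sum_symmetric_interval
      by (intro arg_cong2[where f = "(+)"] sum.cong) (auto simp: hmono_def)
    finally show ?thesis .
  qed
  then have "p = (\<lambda>z. if z \<in> unit_disk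
      then (\<Sum>k\<le>N. a (int k) * z ^ k) + (\<Sum>k\<le>N. (if k = 0 then 0 else a (- int k)) * cnj z ^ k) else 0)"
    by (auto simp: fun_eq_iff p hseries_def)
  then show "p \<in> harmonic_polynomials" unfolding harmonic_polynomials_def
    by (intro CollectI exI)
qed

text \<open>The coefficient of \<open>e\<^bsub>n+k\<^esub>\<close> in the projection of \<open>e\<^bsup>ik\<theta>\<^esup> \<phi>(r) e\<^sub>n\<close>.\<close>
definition weight :: "int \<Rightarrow> (real \<Rightarrow> complex) \<Rightarrow> int \<Rightarrow> complex" where
  "weight k \<phi> n = of_int (\<bar>n + k\<bar> + 1) * moment \<phi> (nat \<bar>n\<bar> + nat \<bar>n + k\<bar>)"

text \<open>Both squares are sums of the differentiated geometric series; the term \<open>-1\<close> removes the constant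
  that they have in common.\<close>
lemma bergman_kernel_has_sum:
  assumes z: "z \<in> unit_disk" and w: "w \<in> unit_disk"
  shows "((\<lambda>m. of_int (\<bar>m\<bar> + 1) * hmono m z * cnj (hmono m w)) has_sum
    (1 / (1 - z * cnj w)\<^sup>2 + 1 / (1 - cnj z * w)\<^sup>2 - 1)) UNIV"
proof -
  have lt: "norm (z * cnj w) < 1" "norm (cnj z * w) < 1"
    using z w mult_strict_mono'[of "norm z" 1 "norm w" 1] by (auto simp: norm_mult)
  have *: "((\<lambda>n. of_nat (Suc n) * x ^ n) has_sum 1 / (1 - x)\<^sup>2) UNIV" if "norm x < 1" for x :: complex
  proof (rule norm_summable_imp_has_sum)
    show "(\<lambda>n. of_nat (Suc n) * x ^ n) sums (1 / (1 - x)\<^sup>2)"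
      by (rule geometric_deriv_sums[OF that])
    have "summable (\<lambda>n. real (Suc n) * norm x ^ n)"
      using geometric_deriv_sums[of "norm x"] that by (auto simp: sums_iff)
    then show "summable (\<lambda>n. norm (of_nat (Suc n) * x ^ n))" by (simp only: norm_mult norm_power norm_of_nat)
  qed
  have "((\<lambda>n. of_nat (Suc n) * (cnj z * w) ^ n) has_sum (1 / (1 - cnj z * w)\<^sup>2 - 1)) (UNIV - {0})"
    using has_sum_Diff[OF *[OF lt(2)] has_sum_finite[of "{0::nat}"]] by simp
  moreover have "UNIV - {0} = range Suc" by (auto simp: image_iff) (metis not0_implies_Suc)
  ultimately have neg: "((\<lambda>n. of_nat (Suc (Suc n)) * (cnj z * w) ^ Suc n) has_sum (1 / (1 - cnj z * w)\<^sup>2 - 1)) UNIV"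
    by (simp only:) (subst (asm) has_sum_reindex, auto simp: o_def)
  have "((\<lambda>m. of_int (\<bar>m\<bar> + 1) * hmono m z * cnj (hmono m w)) has_sum
    (1 / (1 - z * cnj w)\<^sup>2 + (1 / (1 - cnj z * w)\<^sup>2 - 1))) UNIV"
  proof (rule has_sum_int_from_nat)
    show "((\<lambda>n. of_int (\<bar>int n\<bar> + 1) * hmono (int n) z * cnj (hmono (int n) w)) has_sum 1 / (1 - z * cnj w)\<^sup>2) UNIV"
      using *[OF lt(1)] by (simp add: hmono_def power_mult_distrib mult.assoc add.commute)
    have "of_int (\<bar>- int (Suc n)\<bar> + 1) * hmono (- int (Suc n)) z * cnj (hmono (- int (Suc n)) w)
        = of_nat (Suc (Suc n)) * (cnj z * w) ^ Suc n" for n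
    proof -
      have "hmono (- int (Suc n)) x = cnj x ^ Suc n" for x
        by (simp only: hmono_def, simp add: nat_add_distrib)
      moreover have "of_int (\<bar>- int (Suc n)\<bar> + 1) = (of_nat (Suc (Suc n)) :: complex)" by simp
      ultimately show ?thesis by (simp only: power_mult_distrib mult.assoc complex_cnj_power complex_cnj_cnj)
    qed
    then show "((\<lambda>n. of_int (\<bar>- int (Suc n)\<bar> + 1) * hmono (- int (Suc n)) z * cnj (hmono (- int (Suc n)) w))
        has_sum (1 / (1 - cnj z * w)\<^sup>2 - 1)) UNIV"
      using neg by (simp only:)
  qed
  then show ?thesis by (simp add: add_diff_eq)
qed

text \<open>For fixed \<open>z\<close> the partial sums of the kernel are bounded uniformly in \<open>w\<close>, so the expansion of the
  kernel can be integrated term by term against any integrable function.\<close>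
lemma bergman_Q_eq_limit:
  assumes g: "integrable disk_area g" and z: "z \<in> unit_disk"
  shows "(\<lambda>N. \<Sum>m\<in>{- int N..int N}. of_int (\<bar>m\<bar> + 1) * hmono m z * (\<integral>w. g w * cnj (hmono m w) \<partial>disk_area))
    \<longlonglongrightarrow> bergman_Q g z"
proof -
  let ?K = "\<lambda>w. 1 / (1 - z * cnj w)\<^sup>2 + 1 / (1 - cnj z * w)\<^sup>2 - 1"
  let ?t = "\<lambda>m w. of_int (\<bar>m\<bar> + 1) * hmono m z * cnj (hmono m w)"
  let ?s = "\<lambda>N w. \<Sum>m\<in>{- int N..int N}. ?t m w"
  define B where "B = (\<Sum>\<^sub>\<infinity>m. (real_of_int \<bar>m\<bar> + 1) * norm z ^ nat \<bar>m\<bar>)"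
  have sum: "(\<lambda>m. (real_of_int \<bar>m\<bar> + 1) * norm z ^ nat \<bar>m\<bar>) summable_on UNIV"
    by (rule summable_on_int_geometric) (use z in auto)
  have s_le: "norm (?s N w) \<le> B" if w: "w \<in> unit_disk" for N w
  proof -
    have "norm (?s N w) \<le> (\<Sum>m\<in>{- int N..int N}. (real_of_int \<bar>m\<bar> + 1) * norm z ^ nat \<bar>m\<bar>)"
    proof (rule sum_norm_le)
      fix m :: int
      have "norm (of_int (\<bar>m\<bar> + 1) :: complex) = real_of_int \<bar>m\<bar> + 1"
        unfolding norm_of_int by simp
      then have "norm (?t m w) = (real_of_int \<bar>m\<bar> + 1) * norm z ^ nat \<bar>m\<bar> * norm w ^ nat \<bar>m\<bar>"
        by (simp only: norm_mult complex_mod_cnj norm_hmono)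
      also have "\<dots> \<le> (real_of_int \<bar>m\<bar> + 1) * norm z ^ nat \<bar>m\<bar> * 1"
        using w by (intro mult_left_mono power_le_one) auto
      finally show "norm (?t m w) \<le> (real_of_int \<bar>m\<bar> + 1) * norm z ^ nat \<bar>m\<bar>" by simp
    qed
    also have "\<dots> \<le> B" unfolding B_def by (rule finite_sum_le_infsum[OF sum]) auto
    finally show ?thesis .
  qed
  have gm: "g \<in> borel_measurable disk_area" using g by simp
  have sm: "?s N \<in> borel_measurable disk_area" for N
    by (rule continuous_measurable_disk_area) (auto simp: cnj_hmono intro!: continuous_intros)
  have Km: "?K \<in> borel_measurable disk_area"
  proof (rule continuous_measurable_disk_area)
    have "z * cnj w \<noteq> 1" "cnj z * w \<noteq> 1" if "norm w < 1" for w
    proof -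
      have "norm (z * cnj w) < 1" "norm (cnj z * w) < 1"
        using z that mult_strict_mono'[of "norm z" 1 "norm w" 1] by (auto simp: norm_mult)
      then show "z * cnj w \<noteq> 1" "cnj z * w \<noteq> 1" by (metis norm_one order_less_irrefl)+
    qed
    then show "continuous_on unit_disk ?K" by (intro continuous_intros) auto
  qed
  have "(\<lambda>N. \<integral>w. ?s N w * g w \<partial>disk_area) \<longlonglongrightarrow> (\<integral>w. ?K w * g w \<partial>disk_area)"
  proof (rule integral_dominated_convergence[where w = "\<lambda>w. B * norm (g w)"])
    show "AE w in disk_area. (\<lambda>N. ?s N w * g w) \<longlonglongrightarrow> ?K w * g w"
      by (intro AE_I2 tendsto_intros LIMSEQ_symmetric_sums bergman_kernel_has_sum z) simp
    show "AE w in disk_area. norm (?s N w * g w) \<le> B * norm (g w)" for N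
      using s_le by (intro AE_I2) (simp add: norm_mult mult_right_mono)
    show "(\<lambda>w. ?K w * g w) \<in> borel_measurable disk_area" by (intro borel_measurable_times Km gm)
    show "(\<lambda>w. ?s N w * g w) \<in> borel_measurable disk_area" for N by (intro borel_measurable_times sm gm)
  qed (use g in simp)
  moreover have "(\<integral>w. ?s N w * g w \<partial>disk_area)
      = (\<Sum>m\<in>{- int N..int N}. of_int (\<bar>m\<bar> + 1) * hmono m z * (\<integral>w. g w * cnj (hmono m w) \<partial>disk_area))" for N
  proof -
    have int: "integrable disk_area (\<lambda>w. g w * cnj (hmono m w))" for m
      unfolding cnj_hmono by (rule integrable_disk_area_mult_continuous[OF g continuous_on_hmono])
    have "?s N w * g w = (\<Sum>m\<in>{- int N..int N}. (of_int (\<bar>m\<bar> + 1) * hmono m z) * (g w * cnj (hmono m w)))" for w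
      unfolding sum_distrib_right by (intro sum.cong) (simp_all add: mult_ac)
    then show ?thesis using int by (simp add: Bochner_Integration.integral_sum)
  qed
  ultimately show ?thesis using z by (simp add: bergman_Q_def)
qed

lemma bergman_Q_quasihomogeneous:
  assumes \<phi>: "integrable disk_area (\<lambda>z. \<phi> (norm z))" and a: "finite {n. a n \<noteq> 0}"
  shows "bergman_Q (\<lambda>z. quasihomogeneous k \<phi> z * hseries a z)
    = hseries (\<lambda>n. weight k \<phi> (n - k) * a (n - k))"
proof
  fix z
  let ?g = "\<lambda>z. quasihomogeneous k \<phi> z * hseries a z"
  let ?F = "{n. a n \<noteq> 0}"
  show "bergman_Q ?g z = hseries (\<lambda>n. weight k \<phi> (n - k) * a (n - k)) z"
  proof (cases "z \<in> unit_disk")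
    case z: True
    note q = integrable_quasihomogeneous[OF \<phi>, of k]
    have h: "hseries a w = (\<Sum>n\<in>?F. a n * hmono n w)" if "w \<in> unit_disk" for w
      by (rule hseries_finite_support[OF a _ that]) simp
    have int0: "integrable disk_area (\<lambda>w. quasihomogeneous k \<phi> w * (\<Sum>n\<in>?F. a n * hmono n w))"
      by (intro integrable_disk_area_mult_continuous[OF q] continuous_intros)
    have g: "integrable disk_area ?g"
      using int0 by (subst Bochner_Integration.integrable_cong[OF refl]) (simp_all add: h)
    have "(\<integral>w. ?g w * cnj (hmono m w) \<partial>disk_area) = moment \<phi> (nat \<bar>m - k\<bar> + nat \<bar>m\<bar>) * a (m - k)" for m
    proof -
      have int: "integrable disk_area (\<lambda>w. quasihomogeneous k \<phi> w * (hmono n w * cnj (hmono m w)))" for n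
        unfolding cnj_hmono by (intro integrable_disk_area_mult_continuous[OF q] continuous_intros)
      have "(\<integral>w. ?g w * cnj (hmono m w) \<partial>disk_area)
          = (\<integral>w. (\<Sum>n\<in>?F. a n * (quasihomogeneous k \<phi> w * (hmono n w * cnj (hmono m w)))) \<partial>disk_area)"
        by (rule Bochner_Integration.integral_cong)
           (simp_all add: h sum_distrib_left sum_distrib_right mult_ac)
      also have "\<dots> = (\<Sum>n\<in>?F. a n * (\<integral>w. quasihomogeneous k \<phi> w * (hmono n w * cnj (hmono m w)) \<partial>disk_area))"
        using int by (simp add: Bochner_Integration.integral_sum)
      also have "\<dots> = (\<Sum>n\<in>?F. if n = m - k then a n * moment \<phi> (nat \<bar>n\<bar> + nat \<bar>m\<bar>) else 0)"
        using \<phi> by (intro sum.cong) (auto simp: integral_quasihomogeneous_hmono)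
      also have "\<dots> = moment \<phi> (nat \<bar>m - k\<bar> + nat \<bar>m\<bar>) * a (m - k)"
        using a by (simp add: sum.delta mult.commute)
      finally show ?thesis .
    qed
    with bergman_Q_eq_limit[OF g z]
    have "(\<lambda>N. \<Sum>m\<in>{- int N..int N}. weight k \<phi> (m - k) * a (m - k) * hmono m z) \<longlonglongrightarrow> bergman_Q ?g z"
      by (simp add: weight_def mult_ac)
    moreover have "ell2 (\<lambda>m. weight k \<phi> (m - k) * a (m - k))"
    proof (rule ell2_finite_support)
      show "finite ((\<lambda>n. n + k) ` ?F)" using a by simp
      fix m assume "m \<notin> (\<lambda>n. n + k) ` ?F"
      moreover have "m = (m - k) + k" by simp
      ultimately have "m - k \<notin> ?F" by (metis imageI)
      then show "weight k \<phi> (m - k) * a (m - k) = 0" by simp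
    qed
    then have "(\<lambda>N. \<Sum>m\<in>{- int N..int N}. weight k \<phi> (m - k) * a (m - k) * hmono m z)
        \<longlonglongrightarrow> hseries (\<lambda>m. weight k \<phi> (m - k) * a (m - k)) z"
      by (intro LIMSEQ_symmetric_sums has_sum_hseries ell2_imp_disk_convergent z)
    ultimately show ?thesis by (rule LIMSEQ_unique)
  qed (simp add: bergman_Q_def hseries_def)
qed

lemma bergman_norm_diff_le:
  assumes "ell2 a" "ell2 b"
  shows "(bergman_norm (hseries (\<lambda>n. a n - b n)))\<^sup>2
    \<le> 2 * (bergman_norm (hseries a))\<^sup>2 + 2 * (bergman_norm (hseries b))\<^sup>2"
proof -
  have s: "(\<lambda>n. ell2_term a n) summable_on UNIV"
    "(\<lambda>n. ell2_term b n) summable_on UNIV"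
    "(\<lambda>n. (norm (a n - b n))\<^sup>2 / (real_of_int \<bar>n\<bar> + 1)) summable_on UNIV"
    using assms ell2_diff[OF assms] by (simp_all add: ell2_def)
  have "(\<Sum>\<^sub>\<infinity>n. (norm (a n - b n))\<^sup>2 / (real_of_int \<bar>n\<bar> + 1))
      \<le> (\<Sum>\<^sub>\<infinity>n. 2 * (ell2_term a n) + 2 * (ell2_term b n))"
  proof (rule infsum_mono)
    fix n :: int
    have "(norm (a n - b n))\<^sup>2 \<le> (norm (a n) + norm (b n))\<^sup>2"
      by (intro power_mono norm_triangle_ineq4) auto
    also have "\<dots> \<le> 2 * (norm (a n))\<^sup>2 + 2 * (norm (b n))\<^sup>2"
      using sum_squares_bound[of "norm (a n)" "norm (b n)"] by (simp add: power2_sum)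
    finally show "(norm (a n - b n))\<^sup>2 / (real_of_int \<bar>n\<bar> + 1)
        \<le> 2 * (ell2_term a n) + 2 * (ell2_term b n)"
      by (simp add: divide_right_mono flip: add_divide_distrib)
  qed (intro s summable_on_add summable_on_cmult_right)+
  also have "\<dots> = 2 * (\<Sum>\<^sub>\<infinity>n. ell2_term a n) + 2 * (\<Sum>\<^sub>\<infinity>n. ell2_term b n)"
    by (simp only: infsum_add[OF summable_on_cmult_right[OF s(1)] summable_on_cmult_right[OF s(2)]] infsum_cmult_right')
  finally show ?thesis
    by (simp only: hseries_bergman_norm(2)[OF assms(1)] hseries_bergman_norm(2)[OF assms(2)]
        hseries_bergman_norm(2)[OF ell2_diff[OF assms]])
qed

lemma harmonic_polynomials_dense:
  assumes a: "ell2 a"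
  shows "(\<lambda>N. (bergman_norm (hseries (\<lambda>n. if \<bar>n\<bar> \<le> int N then 0 else a n)))\<^sup>2) \<longlonglongrightarrow> 0"
proof -
  let ?t = "\<lambda>n. ell2_term a n"
  define S where "S = (\<Sum>\<^sub>\<infinity>n. ?t n)"
  have S: "(?t has_sum S) UNIV" using a unfolding ell2_def S_def by (rule has_sum_infsum)
  have "(bergman_norm (hseries (\<lambda>n. if \<bar>n\<bar> \<le> int N then 0 else a n)))\<^sup>2 = S - (\<Sum>n\<in>{- int N..int N}. ?t n)" for N
  proof -
    have "(?t has_sum (S - (\<Sum>n\<in>{- int N..int N}. ?t n))) (UNIV - {- int N..int N})"
      by (rule has_sum_Diff[OF S has_sum_finite]) auto
    then have hs: "((\<lambda>n. (norm (if \<bar>n\<bar> \<le> int N then 0 else a n))\<^sup>2 / (real_of_int \<bar>n\<bar> + 1))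
        has_sum (S - (\<Sum>n\<in>{- int N..int N}. ?t n))) UNIV"
      by (rule has_sum_cong_neutral[THEN iffD1, rotated -1]) auto
    then have "ell2 (\<lambda>n. if \<bar>n\<bar> \<le> int N then 0 else a n)" unfolding ell2_def summable_on_def by blast
    from hseries_bergman_norm(2)[OF this] show ?thesis using infsumI[OF hs] by simp
  qed
  moreover have "(\<lambda>N. S - (\<Sum>n\<in>{- int N..int N}. ?t n)) \<longlonglongrightarrow> S - S"
    by (intro tendsto_intros LIMSEQ_symmetric_sums S)
  ultimately show ?thesis by simp
qed

text \<open>The tail \<open>r\<close> of the series of \<open>f\<close> tends to zero in norm, and on the remaining polynomial the two operators
  agree; so \<open>T f - U f = T r - U r\<close> has arbitrarily small norm.\<close>
lemma bounded_operator_eqI: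
  assumes T: "bounded_operator T" and U: "bounded_operator U"
    and eq: "\<And>p. p \<in> harmonic_polynomials \<Longrightarrow> T p = U p"
  shows "T = U"
proof
  fix f
  show "T f = U f"
  proof (cases "f \<in> harmonic_bergman")
    case False
    then show ?thesis using T U by (auto simp: bounded_operator_def PiE_def extensional_def)
  next
    case True
    then obtain a where a: "ell2 a" "f = hseries a" by (rule harmonic_bergman_imp_hseries)
    obtain C where C: "\<And>f. f \<in> harmonic_bergman \<Longrightarrow> bergman_norm (T f) \<le> C * bergman_norm f"
      using T unfolding bounded_operator_def by blast
    obtain D where D: "\<And>f. f \<in> harmonic_bergman \<Longrightarrow> bergman_norm (U f) \<le> D * bergman_norm f"
      using U unfolding bounded_operator_def by blast
    have in_hb: "T g \<in> harmonic_bergman" "U g \<in> harmonic_bergman" if "g \<in> harmonic_bergman" for g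
      using T U that by (auto simp: bounded_operator_def)
    obtain t where t: "ell2 t" "T f = hseries t" using harmonic_bergman_imp_hseries[OF in_hb(1)[OF True]] .
    obtain u where u: "ell2 u" "U f = hseries u" using harmonic_bergman_imp_hseries[OF in_hb(2)[OF True]] .
    define d where "d = (bergman_norm (hseries (\<lambda>n. t n - u n)))\<^sup>2"
    have "d \<le> (2 * C\<^sup>2 + 2 * D\<^sup>2) * (bergman_norm (hseries (\<lambda>n. if \<bar>n\<bar> \<le> int N then 0 else a n)))\<^sup>2" for N
    proof -
      define p where "p n = (if \<bar>n\<bar> \<le> int N then a n else 0)" for n
      define r where "r n = (if \<bar>n\<bar> \<le> int N then 0 else a n)" for n
      have fin: "finite {n. p n \<noteq> 0}"
        by (rule finite_subset[of _ "{- int N..int N}"]) (auto simp: p_def)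
      have p: "ell2 p" by (rule ell2_finite_support[OF fin]) auto
      have "r = (\<lambda>n. a n - p n)" by (auto simp: r_def p_def)
      then have r: "ell2 r" using ell2_diff[OF a(1) p] by simp
      have "a = (\<lambda>n. p n + r n)" by (auto simp: p_def r_def)
      then have f: "f = (\<lambda>z. hseries p z + hseries r z)"
        using a(2) hseries_add[OF p[THEN ell2_imp_disk_convergent] r[THEN ell2_imp_disk_convergent]] by simp
      note hb = hseries_in_harmonic_bergman[OF p] hseries_in_harmonic_bergman[OF r]
      have Tf: "T f = (\<lambda>z. T (hseries p) z + T (hseries r) z)"
        and Uf: "U f = (\<lambda>z. U (hseries p) z + U (hseries r) z)"
        using T U hb by (auto simp: bounded_operator_def f)
      have "T (hseries p) = U (hseries p)"
        by (rule eq) (use fin in \<open>auto simp: harmonic_polynomials_eq\<close>)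
      with Tf Uf have diff: "(\<lambda>z. hseries t z - hseries u z) = (\<lambda>z. T (hseries r) z - U (hseries r) z)"
        by (simp add: t u fun_eq_iff)
      obtain t' where t': "ell2 t'" "T (hseries r) = hseries t'"
        using harmonic_bergman_imp_hseries[OF in_hb(1)[OF hb(2)]] .
      obtain u' where u': "ell2 u'" "U (hseries r) = hseries u'"
        using harmonic_bergman_imp_hseries[OF in_hb(2)[OF hb(2)]] .
      have "d = (bergman_norm (hseries (\<lambda>n. t' n - u' n)))\<^sup>2"
        unfolding d_def hseries_diff[OF t(1) u(1)] diff hseries_diff[OF t'(1) u'(1)] t' u' ..
      also have "\<dots> \<le> 2 * (bergman_norm (T (hseries r)))\<^sup>2 + 2 * (bergman_norm (U (hseries r)))\<^sup>2"
        using bergman_norm_diff_le[OF t'(1) u'(1)] by (simp add: t' u')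
      also have "\<dots> \<le> 2 * (C * bergman_norm (hseries r))\<^sup>2 + 2 * (D * bergman_norm (hseries r))\<^sup>2"
        using C[OF hb(2)] D[OF hb(2)] by (intro add_mono mult_left_mono power_mono bergman_norm_nonneg) auto
      also have "\<dots> = (2 * C\<^sup>2 + 2 * D\<^sup>2) * (bergman_norm (hseries r))\<^sup>2"
        by (simp add: power_mult_distrib algebra_simps)
      also have "r = (\<lambda>n. if \<bar>n\<bar> \<le> int N then 0 else a n)" by (rule ext) (rule r_def)
      finally show ?thesis .
    qed
    moreover have "(\<lambda>N. (2 * C\<^sup>2 + 2 * D\<^sup>2) * (bergman_norm (hseries (\<lambda>n. if \<bar>n\<bar> \<le> int N then 0 else a n)))\<^sup>2)
        \<longlonglongrightarrow> (2 * C\<^sup>2 + 2 * D\<^sup>2) * 0"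
      by (intro tendsto_intros harmonic_polynomials_dense a)
    ultimately have "d \<le> 0"
      by (intro LIMSEQ_le_const) auto
    then have "bergman_norm (hseries (\<lambda>n. t n - u n)) = 0" by (simp add: d_def)
    then have "(\<lambda>n. t n - u n) = (\<lambda>_. 0)" using bergman_norm_hseries_eq_0_iff ell2_diff[OF t(1) u(1)] by blast
    then have "t = u" by (auto simp: fun_eq_iff)
    then show ?thesis by (simp add: t u)
  qed
qed

text \<open>The weighted shift is a bounded operator with the prescribed values on the harmonic polynomials,
  and such an operator is unique because these are dense.\<close>
lemma toeplitz_quasihomogeneous:
  assumes \<phi>: "integrable disk_area (\<lambda>z. \<phi> (norm z))" and M: "\<And>n. norm (weight k \<phi> n) \<le> M"
  shows "toeplitz (quasihomogeneous k \<phi>) = wshift k (weight k \<phi>)"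
  unfolding toeplitz_def
proof (rule the_equality)
  have poly: "wshift k (weight k \<phi>) p = bergman_Q (\<lambda>z. quasihomogeneous k \<phi> z * p z)"
    if p: "p \<in> harmonic_polynomials" for p
  proof -
    obtain a where a: "p = hseries a" "finite {n. a n \<noteq> 0}"
      using p unfolding harmonic_polynomials_eq by blast
    have "ell2 a" by (rule ell2_finite_support[OF a(2)]) auto
    then show ?thesis by (simp add: a bergman_Q_quasihomogeneous[OF \<phi> a(2)] wshift_hseries)
  qed
  have bo: "bounded_operator (wshift k (weight k \<phi>))"
    by (rule bounded_operator_wshift[where w = "weight k \<phi>", OF M])
  with poly show "bounded_operator (wshift k (weight k \<phi>)) \<and>
    (\<forall>p\<in>harmonic_polynomials. wshift k (weight k \<phi>) p = bergman_Q (\<lambda>z. quasihomogeneous k \<phi> z * p z))"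
    by blast
  fix T assume "bounded_operator T \<and> (\<forall>p\<in>harmonic_polynomials. T p = bergman_Q (\<lambda>z. quasihomogeneous k \<phi> z * p z))"
  then show "T = wshift k (weight k \<phi>)"
    using bounded_operator_eqI[OF _ bo, of T] poly by auto
qed

section \<open>Commutators and finite rank\<close>

lemma commutator_wshift:
  assumes w1: "\<And>n. norm (w1 n) \<le> M1" and w2: "\<And>n. norm (w2 n) \<le> M2"
  shows "commutator (wshift k1 w1) (wshift k2 w2)
    = wshift (k1 + k2) (\<lambda>n. w1 (n + k2) * w2 n - w2 (n + k1) * w1 n)"
proof
  fix f
  show "commutator (wshift k1 w1) (wshift k2 w2) f
    = wshift (k1 + k2) (\<lambda>n. w1 (n + k2) * w2 n - w2 (n + k1) * w1 n) f"
  proof (cases "f \<in> harmonic_bergman")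
    case True
    then obtain a where a: "ell2 a" "f = hseries a" by (rule harmonic_bergman_imp_hseries)
    have e1: "ell2 (\<lambda>n. w1 (n - k1) * a (n - k1))"
      by (rule ell2_wshift[where w = w1, OF a(1) w1])
    have e2: "ell2 (\<lambda>n. w2 (n - k2) * a (n - k2))"
      by (rule ell2_wshift[where w = w2, OF a(1) w2])
    have e12: "ell2 (\<lambda>n. w1 (n - k1) * (w2 (n - k1 - k2) * a (n - k1 - k2)))"
      by (rule ell2_wshift[where w = w1, OF e2 w1])
    have e21: "ell2 (\<lambda>n. w2 (n - k2) * (w1 (n - k2 - k1) * a (n - k2 - k1)))"
      by (rule ell2_wshift[where w = w2, OF e1 w2])
    have "commutator (wshift k1 w1) (wshift k2 w2) f = (\<lambda>z.
        hseries (\<lambda>n. w1 (n - k1) * (w2 (n - k1 - k2) * a (n - k1 - k2))) z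
        - hseries (\<lambda>n. w2 (n - k2) * (w1 (n - k2 - k1) * a (n - k2 - k1))) z)"
      using True by (simp add: commutator_def a(2) wshift_hseries[OF a(1)] wshift_hseries[OF e1] wshift_hseries[OF e2])
    also have "\<dots> = hseries (\<lambda>n. w1 (n - k1) * (w2 (n - k1 - k2) * a (n - k1 - k2))
        - w2 (n - k2) * (w1 (n - k2 - k1) * a (n - k2 - k1)))"
      by (rule hseries_diff[OF e12 e21, symmetric])
    also have "\<dots> = hseries (\<lambda>n. (w1 (n - (k1 + k2) + k2) * w2 (n - (k1 + k2))
        - w2 (n - (k1 + k2) + k1) * w1 (n - (k1 + k2))) * a (n - (k1 + k2)))"
      by (rule arg_cong[where f = hseries]) (simp add: fun_eq_iff algebra_simps)
    also have "\<dots> = wshift (k1 + k2) (\<lambda>n. w1 (n + k2) * w2 n - w2 (n + k1) * w1 n) f"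
      by (simp add: a wshift_hseries)
    finally show ?thesis .
  qed (simp add: commutator_def wshift_def)
qed

definition hbasis :: "int \<Rightarrow> complex \<Rightarrow> complex" where
  "hbasis m = hseries (\<lambda>n. if n = m then 1 else 0)"

lemma ell2_single: "ell2 (\<lambda>n. if n = m then c else 0)"
  by (rule ell2_finite_support[of "{m}"]) auto

lemma hbasis_inject: "hbasis m = hbasis n \<longleftrightarrow> m = n"
  unfolding hbasis_def hseries_inject[OF ell2_single ell2_single] by (auto simp: fun_eq_iff)

lemma hseries_finite_eq_sum_hbasis:
  assumes "finite F" "\<And>n. n \<notin> F \<Longrightarrow> a n = 0"
  shows "hseries a z = (\<Sum>n\<in>F. a n * hbasis n z)"
proof (cases "z \<in> unit_disk")
  case True
  have "hbasis n z = hmono n z" for n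
    unfolding hbasis_def using hseries_finite_support[of "{n}" "\<lambda>k. if k = n then 1 else 0" z] True by simp
  then show ?thesis using hseries_finite_support[OF assms True] by simp
qed (simp add: hbasis_def hseries_def)

lemma bergman_closure_superset:
  assumes "S \<subseteq> harmonic_bergman"
  shows "S \<subseteq> bergman_closure S"
proof
  fix f assume f: "f \<in> S"
  show "f \<in> bergman_closure S"
    unfolding bergman_closure_def
  proof (intro CollectI conjI allI impI bexI[OF _ f])
    show "f \<in> harmonic_bergman" using assms f by blast
  qed (simp add: bergman_norm_def)
qed

lemma hcoeffs_le_bergman_norm:
  assumes "ell2 a"
  shows "(norm (a m))\<^sup>2 / (real_of_int \<bar>m\<bar> + 1) \<le> (bergman_norm (hseries a))\<^sup>2"
proof -
  have "(\<Sum>n\<in>{m}. ell2_term a n) \<le> (bergman_norm (hseries a))\<^sup>2"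
    unfolding hseries_bergman_norm(2)[OF assms]
    by (rule finite_sum_le_infsum) (use assms in \<open>auto simp: ell2_def\<close>)
  then show ?thesis by simp
qed

text \<open>Each coefficient is a continuous functional, so its vanishing is preserved by closure.\<close>
lemma bergman_closure_coeff_eq_0:
  assumes b: "ell2 b" "hseries b \<in> bergman_closure S"
    and S: "\<And>f. f \<in> S \<Longrightarrow> \<exists>a. ell2 a \<and> f = hseries a \<and> a m = 0"
  shows "b m = 0"
proof (rule ccontr)
  assume "b m \<noteq> 0"
  \<comment> \<open>the norm of the \<open>m\<close>-th term: no series without this term comes closer than \<open>e\<close>\<close>
  define e where "e = norm (b m) / sqrt (real_of_int \<bar>m\<bar> + 1)"
  have e2: "e\<^sup>2 = (norm (b m))\<^sup>2 / (real_of_int \<bar>m\<bar> + 1)" by (simp add: e_def power_divide)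
  have "e > 0" using \<open>b m \<noteq> 0\<close> by (simp add: e_def add_nonneg_pos)
  then obtain f where f: "f \<in> S" "bergman_norm (\<lambda>z. f z - hseries b z) < e"
    using b(2) unfolding bergman_closure_def by auto
  then obtain a where a: "ell2 a" "f = hseries a" "a m = 0" using S by blast
  have "e\<^sup>2 = (norm (a m - b m))\<^sup>2 / (real_of_int \<bar>m\<bar> + 1)" by (simp add: e2 a)
  also have "\<dots> \<le> (bergman_norm (hseries (\<lambda>n. a n - b n)))\<^sup>2"
    by (rule hcoeffs_le_bergman_norm[OF ell2_diff[OF a(1) b(1)]])
  also have "\<dots> < e\<^sup>2"
    using f(2) unfolding a(2) hseries_diff[OF a(1) b(1)]
    by (intro power_strict_mono bergman_norm_nonneg) auto
  finally show False by simp
qed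

text \<open>The basis functions are linearly independent, and a finite set spans no infinite independent set.\<close>
lemma finite_dimensional_imp_finite_hbasis:
  assumes V: "finite_dimensional V" and M: "\<And>m. m \<in> M \<Longrightarrow> hbasis m \<in> V"
  shows "finite M"
proof -
  interpret vs: vector_space "\<lambda>c (f :: complex \<Rightarrow> complex) z. c * f z"
    by unfold_locales (auto simp: fun_eq_iff algebra_simps)
  have sum_apply: "(\<Sum>b\<in>B. F b) z = (\<Sum>b\<in>B. F b z)" for B and F :: "'b \<Rightarrow> complex \<Rightarrow> complex" and z
    by (induction B rule: infinite_finite_induct) auto
  obtain B where B: "finite B" "B \<subseteq> V" "\<And>f. f \<in> V \<Longrightarrow> \<exists>c. f = (\<lambda>z. \<Sum>b\<in>B. c b * b z)"
    using V unfolding finite_dimensional_def by blast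
  have "V \<subseteq> vs.span B"
  proof
    fix f assume "f \<in> V"
    then obtain c where "f = (\<lambda>z. \<Sum>b\<in>B. c b * b z)" using B(3) by blast
    then have "f = (\<Sum>b\<in>B. (\<lambda>z. c b * b z))" by (simp add: fun_eq_iff sum_apply)
    also have "\<dots> \<in> vs.span B" by (intro vs.span_sum vs.span_scale vs.span_base)
    finally show "f \<in> vs.span B" .
  qed
  then have span: "hbasis ` M \<subseteq> vs.span B" using M by blast
  have inj: "inj_on hbasis A" for A by (auto simp: inj_on_def hbasis_inject)
  have "vs.independent (hbasis ` M)"
    unfolding vs.independent_explicit_finite_subsets
  proof (intro allI impI ballI)
    fix A u v assume A: "A \<subseteq> hbasis ` M" "finite A" and sum: "(\<Sum>v\<in>A. (\<lambda>z. u v * v z)) = 0" and v: "v \<in> A"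
    obtain N where N: "A = hbasis ` N" using A(1) by (metis subset_imageE)
    then have fN: "finite N" using A(2) finite_imageD[OF _ inj] by blast
    let ?a = "\<lambda>n. if n \<in> N then u (hbasis n) else 0"
    have ell: "ell2 ?a" by (rule ell2_finite_support[OF fN]) simp
    have "hseries ?a z = 0" for z
    proof -
      have "hseries ?a z = (\<Sum>n\<in>N. u (hbasis n) * hbasis n z)"
        by (subst hseries_finite_eq_sum_hbasis[OF fN]) auto
      also have "\<dots> = (\<Sum>v\<in>A. u v * v z)" unfolding N by (subst sum.reindex[OF inj]) simp
      also have "\<dots> = (\<Sum>v\<in>A. (\<lambda>z. u v * v z)) z" by (simp add: sum_apply)
      also have "\<dots> = 0" by (simp add: sum)
      finally show ?thesis .
    qed
    then have "bergman_norm (hseries ?a) = 0" by (simp add: bergman_norm_def)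
    then have "?a = (\<lambda>_. 0)" using bergman_norm_hseries_eq_0_iff[OF ell] by blast
    moreover obtain n where "n \<in> N" "v = hbasis n" using v N by blast
    ultimately show "u v = 0" by (auto dest: fun_cong[of _ _ n])
  qed
  from vs.independent_span_bound[OF B(1) this span] have "finite (hbasis ` M)" by simp
  then show ?thesis using finite_imageD[OF _ inj] by blast
qed

text \<open>The range contains \<open>e\<^bsub>n+k\<^esub>\<close> for every nonzero weight \<open>d\<^sub>n\<close>, and functions in its closure have no other
  coefficients. So with finitely many nonzero weights the closure of the range is spanned by these \<open>e\<^bsub>n+k\<^esub>\<close>.\<close>
lemma finite_rank_wshift_iff:
  assumes d: "\<And>n. norm (d n) \<le> M"
  shows "finite_rank (wshift k d) \<longleftrightarrow> finite {n. d n \<noteq> 0}"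
proof -
  let ?F = "{n. d n \<noteq> 0}" and ?R = "wshift k d ` harmonic_bergman"
  have R: "?R \<subseteq> harmonic_bergman"
    using bounded_operator_wshift[where w = d and k = k, OF d] by (auto simp: bounded_operator_def)
  have mem: "hbasis (n + k) \<in> ?R" if "d n \<noteq> 0" for n
  proof -
    have "(\<lambda>z. inverse (d n) * hbasis n z) = hseries (\<lambda>m. inverse (d n) * (if m = n then 1 else 0))"
      unfolding hbasis_def hseries_scale ..
    moreover have ell: "ell2 (\<lambda>m. inverse (d n) * (if m = n then 1 else 0))" by (rule ell2_scale[OF ell2_single])
    moreover have "wshift k d (hseries (\<lambda>m. inverse (d n) * (if m = n then 1 else 0))) = hbasis (n + k)"
      unfolding wshift_hseries[OF ell] hbasis_def
      by (rule arg_cong[where f = hseries]) (use that in \<open>auto simp: fun_eq_iff\<close>)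
    ultimately show ?thesis by (metis hseries_in_harmonic_bergman imageI)
  qed
  then have cl: "hbasis (n + k) \<in> bergman_closure ?R" if "d n \<noteq> 0" for n
    using bergman_closure_superset[OF R] that by blast
  show ?thesis
  proof
    assume "finite_rank (wshift k d)"
    then have "finite ((\<lambda>n. n + k) ` ?F)"
      unfolding finite_rank_def by (rule finite_dimensional_imp_finite_hbasis) (use cl in auto)
    then show "finite ?F" by (rule finite_imageD) (auto simp: inj_on_def)
  next
    assume fin: "finite ?F"
    let ?G = "(\<lambda>n. n + k) ` ?F"
    have inj: "inj_on hbasis ?G" by (auto simp: inj_on_def hbasis_inject)
    show "finite_rank (wshift k d)"
      unfolding finite_rank_def finite_dimensional_def
    proof (intro exI[of _ "hbasis ` ?G"] conjI ballI)
      show "finite (hbasis ` ?G)" using fin by simp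
      show "hbasis ` ?G \<subseteq> bergman_closure ?R" using cl by auto
      fix f assume f: "f \<in> bergman_closure ?R"
      then have "f \<in> harmonic_bergman" by (simp add: bergman_closure_def)
      then obtain b where b: "ell2 b" "f = hseries b" by (rule harmonic_bergman_imp_hseries)
      have b0: "b m = 0" if m: "m \<notin> ?G" for m
      proof (rule bergman_closure_coeff_eq_0[OF b(1)])
        show "hseries b \<in> bergman_closure ?R" using f b by simp
        have "m = (m - k) + k" by simp
        with m have "m - k \<notin> ?F" by (metis imageI)
        then have dm: "d (m - k) = 0" by simp
        fix g assume "g \<in> ?R"
        then obtain h where "h \<in> harmonic_bergman" "g = wshift k d h" by blast
        then obtain a where a: "ell2 a" "g = wshift k d (hseries a)" by (metis harmonic_bergman_imp_hseries)
        show "\<exists>a. ell2 a \<and> g = hseries a \<and> a m = 0"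
          by (intro exI[of _ "\<lambda>n. d (n - k) * a (n - k)"] conjI)
             (use ell2_wshift[where w = d and k = k, OF a(1) d] a dm in \<open>auto simp: wshift_hseries\<close>)
      qed
      show "\<exists>c. f = (\<lambda>z. \<Sum>b\<in>hbasis ` ?G. c b * b z)"
      proof (intro exI ext)
        fix z
        have "f z = (\<Sum>n\<in>?G. b n * hbasis n z)"
          unfolding b(2) by (rule hseries_finite_eq_sum_hbasis) (use fin b0 in auto)
        also have "\<dots> = (\<Sum>g\<in>hbasis ` ?G. b (inv_into ?G hbasis g) * g z)"
          by (subst sum.reindex[OF inj]) (simp add: inv_into_f_f[OF inj])
        finally show "f z = (\<Sum>g\<in>hbasis ` ?G. b (inv_into ?G hbasis g) * g z)" .
      qed
    qed
  qed
qed

section \<open>Boundedness of the weights\<close>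

text \<open>\<open>r\<^sup>m\<close> is the smallest of the \<open>m + 1\<close> terms of the geometric sum \<open>1 + r + \<dots> + r\<^sup>m\<close>.\<close>
lemma power_mult_one_minus_le:
  fixes r :: real
  assumes "0 \<le> r" "r \<le> 1"
  shows "(real m + 1) * (r ^ m * (1 - r)) \<le> 1"
proof -
  have "(real m + 1) * r ^ m = (\<Sum>i<Suc m. r ^ m)" by simp
  also have "\<dots> \<le> (\<Sum>i<Suc m. r ^ i)"
    using assms by (intro sum_mono power_decreasing) auto
  finally have "(real m + 1) * r ^ m * (1 - r) \<le> (\<Sum>i<Suc m. r ^ i) * (1 - r)"
    using assms by (intro mult_right_mono) auto
  also have "\<dots> = 1 - r ^ Suc m"
    using one_diff_power_eq[of r "Suc m"] by (simp add: mult.commute)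
  also have "\<dots> \<le> 1" using assms by simp
  finally show ?thesis by (simp add: mult.assoc)
qed

lemma integrable_moment:
  fixes \<phi> :: "real \<Rightarrow> complex"
  assumes "integrable disk_area (\<lambda>z. \<phi> (norm z))"
  shows "integrable disk_area (\<lambda>z. \<phi> (norm z) * of_real (norm z ^ m))"
  by (intro integrable_disk_area_mult_continuous assms continuous_intros)

text \<open>Testing the radial operator on \<open>e\<^sub>n\<close> bounds its weights, which are \<open>(n + 1)\<close> times the moment of order
  \<open>2n\<close>. A moment of odd order differs from the preceding one by at most the \<open>L\<^sup>1\<close> norm over the order,
  by \<open>power_mult_one_minus_le\<close>.\<close>
lemma T_function_moment_bound:
  assumes T: "T_function (\<lambda>z. \<phi> (norm z))"
  shows "\<exists>M. \<forall>m. (real m + 2) * norm (moment \<phi> m) \<le> M"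
proof -
  have \<phi>: "integrable disk_area (\<lambda>z. \<phi> (norm z))" using T by (simp add: T_function_def)
  obtain C0 where C0: "\<And>p. p \<in> harmonic_polynomials \<Longrightarrow>
      bergman_norm (bergman_Q (\<lambda>z. \<phi> (norm z) * p z)) \<le> C0 * bergman_norm p"
    using T unfolding T_function_def by blast
  define C where "C = \<bar>C0\<bar>"
  have even: "(real n + 1) * norm (moment \<phi> (2 * n)) \<le> C" for n :: nat
  proof -
    let ?a = "\<lambda>k. if k = int n then (1::complex) else 0"
    let ?b = "\<lambda>k. weight 0 \<phi> (k - 0) * ?a (k - 0)"
    have fin: "finite {k. ?a k \<noteq> 0}" by simp
    have q: "(\<lambda>z. \<phi> (norm z) * hseries ?a z) = (\<lambda>z. quasihomogeneous 0 \<phi> z * hseries ?a z)"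
      by (simp add: quasihomogeneous_def)
    have b_eq: "?b = (\<lambda>k. weight 0 \<phi> (int n) * ?a k)" by auto
    have pos: "bergman_norm (hseries ?a) > 0"
      using bergman_norm_hseries_eq_0_iff[OF ell2_single, of "int n" 1] bergman_norm_nonneg[of "hseries ?a"]
      by (auto simp: fun_eq_iff less_le)
    have "bergman_norm (bergman_Q (\<lambda>z. \<phi> (norm z) * hseries ?a z)) \<le> C0 * bergman_norm (hseries ?a)"
      by (rule C0) (use fin in \<open>unfold harmonic_polynomials_eq, blast\<close>)
    also have "bergman_Q (\<lambda>z. \<phi> (norm z) * hseries ?a z) = (\<lambda>z. weight 0 \<phi> (int n) * hseries ?a z)"
      unfolding q bergman_Q_quasihomogeneous[OF \<phi> fin] b_eq hseries_scale ..
    also have "bergman_norm \<dots> = norm (weight 0 \<phi> (int n)) * bergman_norm (hseries ?a)"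
      by (simp add: bergman_norm_def norm_mult power_mult_distrib real_sqrt_mult)
    finally have "norm (weight 0 \<phi> (int n)) \<le> C0" using pos by simp
    moreover have "norm (weight 0 \<phi> (int n)) = (real n + 1) * norm (moment \<phi> (2 * n))"
    proof -
      have "(of_int (\<bar>int n + 0\<bar> + 1) :: complex) = of_real (real n + 1)" by simp
      then show ?thesis unfolding weight_def by (simp only: norm_mult norm_of_real) (simp add: mult_2)
    qed
    ultimately show ?thesis by (simp add: C_def)
  qed
  define I where "I = (\<integral>z. norm (\<phi> (norm z)) \<partial>disk_area)"
  have "I \<ge> 0" by (simp add: I_def)
  have "C \<ge> 0" by (simp add: C_def)
  have step: "(real m + 1) * norm (moment \<phi> m - moment \<phi> (Suc m)) \<le> I" for m
  proof -
    have "moment \<phi> m - moment \<phi> (Suc m) = (\<integral>z. \<phi> (norm z) * of_real (norm z ^ m) - \<phi> (norm z) * of_real (norm z ^ Suc m) \<partial>disk_area)"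
      unfolding moment_def by (rule Bochner_Integration.integral_diff[symmetric]) (intro integrable_moment \<phi>)+
    also have "norm \<dots> \<le> (\<integral>z. norm (\<phi> (norm z) * of_real (norm z ^ m) - \<phi> (norm z) * of_real (norm z ^ Suc m)) \<partial>disk_area)"
      by (rule integral_norm_bound)
    also have "\<dots> \<le> (\<integral>z. norm (\<phi> (norm z)) * (1 / (real m + 1)) \<partial>disk_area)"
    proof (rule integral_mono)
      show "integrable disk_area (\<lambda>z. norm (\<phi> (norm z) * of_real (norm z ^ m) - \<phi> (norm z) * of_real (norm z ^ Suc m)))"
        by (intro integrable_norm Bochner_Integration.integrable_diff integrable_moment \<phi>)
      show "integrable disk_area (\<lambda>z. norm (\<phi> (norm z)) * (1 / (real m + 1)))" using \<phi> by simp
      fix z assume "z \<in> space disk_area"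
      then have r: "0 \<le> norm z" "norm z \<le> 1" by auto
      have "\<phi> (norm z) * of_real (norm z ^ m) - \<phi> (norm z) * of_real (norm z ^ Suc m)
          = \<phi> (norm z) * of_real (norm z ^ m * (1 - norm z))" by (simp add: algebra_simps)
      also have "norm \<dots> = norm (\<phi> (norm z)) * (norm z ^ m * (1 - norm z))"
        using r by (simp only: norm_mult norm_of_real) (simp add: abs_mult)
      also have "\<dots> \<le> norm (\<phi> (norm z)) * (1 / (real m + 1))"
        using power_mult_one_minus_le[OF r, of m] by (intro mult_left_mono) (simp_all add: field_simps)
      finally show "norm (\<phi> (norm z) * of_real (norm z ^ m) - \<phi> (norm z) * of_real (norm z ^ Suc m))
          \<le> norm (\<phi> (norm z)) * (1 / (real m + 1))" .
    qed
    also have "\<dots> = I * (1 / (real m + 1))" by (simp add: I_def)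
    finally show ?thesis by (simp add: field_simps)
  qed
  have "(real m + 2) * norm (moment \<phi> m) \<le> 3 * C + 3 * I" for m
  proof (cases "even m")
    case True
    then obtain n where n: "m = 2 * n" by (elim evenE)
    have "(real m + 2) * norm (moment \<phi> m) = 2 * ((real n + 1) * norm (moment \<phi> (2 * n)))"
      by (simp add: n algebra_simps)
    also have "\<dots> \<le> 2 * C" using even[of n] by simp
    finally show ?thesis using \<open>C \<ge> 0\<close> \<open>I \<ge> 0\<close> by linarith
  next
    case False
    then obtain n where n: "m = Suc (2 * n)" by (elim oddE) simp
    define x where "x = norm (moment \<phi> (2 * n))"
    define y where "y = norm (moment \<phi> (2 * n) - moment \<phi> m)"
    have "norm (moment \<phi> m) \<le> x + y"
      unfolding x_def y_def using norm_triangle_ineq4[of "moment \<phi> (2 * n)" "moment \<phi> (2 * n) - moment \<phi> m"] by simp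
    then have "(real m + 2) * norm (moment \<phi> m) \<le> (real m + 2) * (x + y)"
      by (intro mult_left_mono) auto
    also have "\<dots> = (2 * real n + 3) * x + (2 * real n + 3) * y" by (simp add: n algebra_simps)
    also have "(2 * real n + 3) * x \<le> 3 * ((real n + 1) * x)"
      by (simp add: x_def algebra_simps mult_right_mono)
    also have "\<dots> \<le> 3 * C" using even[of n] by (simp add: x_def)
    also have "(2 * real n + 3) * y \<le> 3 * ((real (2 * n) + 1) * y)"
      by (simp add: y_def algebra_simps mult_right_mono)
    also have "\<dots> \<le> 3 * I" using step[of "2 * n"] by (simp add: y_def n)
    finally show ?thesis by simp
  qed
  then show ?thesis by blast
qed

lemma of_int_plus_1_eq_of_real: "(of_int (i + 1) :: complex) = of_real (real_of_int i + 1)"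
  by simp

lemma weight_bound:
  assumes M: "\<And>m. (real m + 2) * norm (moment \<phi> m) \<le> M"
  shows "norm (weight k \<phi> n) \<le> M"
proof -
  define m where "m = nat \<bar>n\<bar> + nat \<bar>n + k\<bar>"
  have "norm (weight k \<phi> n) = (real_of_int \<bar>n + k\<bar> + 1) * norm (moment \<phi> m)"
    unfolding weight_def m_def of_int_plus_1_eq_of_real by (simp only: norm_mult norm_of_real) simp
  also have "\<dots> \<le> (real m + 2) * norm (moment \<phi> m)"
    by (intro mult_right_mono) (auto simp: m_def)
  also have "\<dots> \<le> M" by (rule M)
  finally show ?thesis .
qed

section \<open>The weights of powers\<close>

definition radial_power :: "int \<Rightarrow> real \<Rightarrow> complex" where
  "radial_power j r = of_real (r powi j)"

lemma moment_radial_power: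
  assumes "j > -2"
  shows "moment (radial_power j) m = of_real (2 / (real_of_int (j + int m) + 2))"
proof -
  have "moment (radial_power j) m = (\<integral>z. complex_of_real (norm z powi (j + int m)) \<partial>disk_area)"
    unfolding moment_def
  proof (rule integral_cong_AE)
    show "AE z in disk_area. radial_power j (norm z) * of_real (norm z ^ m) = complex_of_real (norm z powi (j + int m))"
      using AE_disk_area_nonzero by eventually_elim (simp add: power_int_add radial_power_def)
  qed (unfold radial_power_def, measurable)
  also have "\<dots> = of_real (\<integral>z. norm z powi (j + int m) \<partial>disk_area)"
    by (rule integral_complex_of_real)
  also have "(\<integral>z. norm z powi (j + int m) \<partial>disk_area) = 2 / (real_of_int (j + int m) + 2)"
    using assms by (intro integral_norm_powi) simp
  finally show ?thesis .
qed

lemma radial_power_moment_bound: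
  assumes "j > -2"
  shows "(real m + 2) * norm (moment (radial_power j) m) \<le> 4"
proof -
  have pos: "real_of_int (j + int m) + 2 \<ge> 1" using assms by simp
  have "(real m + 2) * 2 \<le> 4 * (real_of_int (j + int m) + 2)" using assms by simp
  then have "(real m + 2) * (2 / (real_of_int (j + int m) + 2)) \<le> 4"
    using pos by (simp add: divide_le_eq)
  then show ?thesis unfolding moment_radial_power[OF assms] norm_of_real using pos by simp
qed

lemma weight_radial_power:
  assumes "j > -2"
  shows "weight j (radial_power j) n
    = of_real ((real_of_int \<bar>n + j\<bar> + 1) * 2 / (real_of_int \<bar>n\<bar> + real_of_int \<bar>n + j\<bar> + real_of_int j + 2))"
proof -
  have "real_of_int (j + int (nat \<bar>n\<bar> + nat \<bar>n + j\<bar>)) + 2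
      = real_of_int \<bar>n\<bar> + real_of_int \<bar>n + j\<bar> + real_of_int j + 2" by simp
  then show ?thesis
    unfolding weight_def moment_radial_power[OF assms] of_int_plus_1_eq_of_real
    by (simp only: of_real_mult[symmetric] times_divide_eq_right)
qed

lemma weight_radial_power_pos:
  assumes "j > -2" "n \<ge> \<bar>j\<bar>"
  shows "weight j (radial_power j) n = 1"
proof -
  have "\<bar>n + j\<bar> = n + j" "\<bar>n\<bar> = n" using assms by auto
  then have "(real_of_int \<bar>n + j\<bar> + 1) * 2 = real_of_int \<bar>n\<bar> + real_of_int \<bar>n + j\<bar> + real_of_int j + 2"
    by simp_all
  moreover have "real_of_int \<bar>n + j\<bar> + 1 > 0" by linarith
  then have "(real_of_int \<bar>n + j\<bar> + 1) * 2 \<noteq> 0" by simp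
  ultimately have eq: "(real_of_int \<bar>n + j\<bar> + 1) * 2 = real_of_int \<bar>n\<bar> + real_of_int \<bar>n + j\<bar> + real_of_int j + 2"
    and nz: "real_of_int \<bar>n\<bar> + real_of_int \<bar>n + j\<bar> + real_of_int j + 2 \<noteq> 0"
    by simp_all
  have "(real_of_int \<bar>n + j\<bar> + 1) * 2 / (real_of_int \<bar>n\<bar> + real_of_int \<bar>n + j\<bar> + real_of_int j + 2) = 1"
    unfolding eq by (rule divide_self[OF nz])
  then show ?thesis unfolding weight_radial_power[OF assms(1)] by (simp only: of_real_1)
qed

lemma weight_radial_power_neg:
  assumes "j > -2" "n \<le> - \<bar>j\<bar>"
  shows "weight j (radial_power j) n = of_int (1 - n - j) / of_int (1 - n)"
proof -
  have "\<bar>n + j\<bar> = - n - j" "\<bar>n\<bar> = - n" using assms by auto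
  then have num: "(real_of_int \<bar>n + j\<bar> + 1) * 2 = 2 * real_of_int (1 - n - j)"
    and den: "real_of_int \<bar>n\<bar> + real_of_int \<bar>n + j\<bar> + real_of_int j + 2 = 2 * real_of_int (1 - n)" by simp_all
  have "weight j (radial_power j) n = of_real (real_of_int (1 - n - j) / real_of_int (1 - n))"
    unfolding weight_radial_power[OF assms(1)] num den by (subst mult_divide_mult_cancel_left) simp_all
  then show ?thesis by (simp only: of_real_divide of_real_of_int_eq)
qed

section \<open>Finiteness of the commutator weights\<close>

lemma moment_cong_scale:
  assumes "AE z in disk_area. \<phi> (norm z) = C * \<psi> (norm z)"
    and [measurable]: "(\<lambda>z. \<phi> (norm z)) \<in> borel_measurable disk_area" "(\<lambda>z. \<psi> (norm z)) \<in> borel_measurable disk_area"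
  shows "moment \<phi> m = C * moment \<psi> m"
proof -
  have "moment \<phi> m = (\<integral>z. C * (\<psi> (norm z) * of_real (norm z ^ m)) \<partial>disk_area)"
    unfolding moment_def
  proof (rule integral_cong_AE)
    show "AE z in disk_area. \<phi> (norm z) * of_real (norm z ^ m) = C * (\<psi> (norm z) * of_real (norm z ^ m))"
      using assms(1) by eventually_elim simp
  qed measurable
  also have "\<dots> = C * moment \<psi> m" unfolding moment_def by simp
  finally show ?thesis .
qed

text \<open>For large positive \<open>n\<close> all weights are \<open>1\<close>. For large negative \<open>n\<close> both products are equal to
  \<open>(1 - n - k1 - k2) / (1 - n)\<close>.\<close>
lemma finite_commutator_weights_if_radial_power:
  assumes k1: "k1 > -2" and k2: "k2 > -2"
  defines "w1 \<equiv> weight k1 (radial_power k1)" and "w2 \<equiv> weight k2 (radial_power k2)"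
  shows "finite {n. w1 (n + k2) * w2 n - w2 (n + k1) * w1 n \<noteq> 0}"
proof -
  \<comment> \<open>beyond \<open>L\<close>, the indices \<open>n\<close>, \<open>n + k1\<close> and \<open>n + k2\<close> are all in the range of the explicit formulas\<close>
  define L where "L = \<bar>k1\<bar> + \<bar>k2\<bar> + 1"
  have "w1 (n + k2) * w2 n - w2 (n + k1) * w1 n = 0" if n: "n \<notin> {- L..L}" for n
  proof -
    consider "n > L" | "n < - L" using n by fastforce
    then show ?thesis
    proof cases
      case 1
      then have "n \<ge> \<bar>k1\<bar>" "n \<ge> \<bar>k2\<bar>" "n + k1 \<ge> \<bar>k2\<bar>" "n + k2 \<ge> \<bar>k1\<bar>" by (auto simp: L_def)
      then show ?thesis using k1 k2 by (simp add: w1_def w2_def weight_radial_power_pos)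
    next
      case 2
      then have le: "n \<le> - \<bar>k1\<bar>" "n \<le> - \<bar>k2\<bar>" "n + k1 \<le> - \<bar>k2\<bar>" "n + k2 \<le> - \<bar>k1\<bar>" by (auto simp: L_def)
      define A B E where "A = (of_int (1 - n - k2) :: complex)" and "B = (of_int (1 - n - k1) :: complex)"
        and "E = (of_int (1 - n - k1 - k2) :: complex)"
      have nz: "A \<noteq> 0" "B \<noteq> 0" using 2 unfolding A_def B_def of_int_eq_0_iff by (auto simp: L_def)
      have "w1 (n + k2) = E / A" "w2 n = A / of_int (1 - n)" "w2 (n + k1) = E / B" "w1 n = B / of_int (1 - n)"
        using le k1 k2 by (simp_all add: w1_def w2_def weight_radial_power_neg A_def B_def E_def algebra_simps)
      then show ?thesis using nz by simp
    qed
  qed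
  then have "{n. w1 (n + k2) * w2 n - w2 (n + k1) * w1 n \<noteq> 0} \<subseteq> {- L..L}" by blast
  then show ?thesis by (rule finite_subset) simp
qed

text \<open>For \<open>n\<close> beyond all nonzero commutator weights and beyond \<open>|k1|\<close> and \<open>|k2|\<close>, the weights \<open>w2\<close> satisfy
  \<open>w2 (n + k1) = w2 n\<close>. So they have a constant value \<open>c\<close> along steps of length \<open>q = |k1|\<close>, and since
  the weights of \<open>e\<^bsup>ik2\<theta>\<^esup> r\<^bsup>k2\<^esup>\<close> are \<open>1\<close> there, the moments of \<open>\<phi> - c r\<^bsup>k2\<^esup>\<close> vanish along exponents
  with difference \<open>2q\<close>.\<close>
lemma radial_power_if_finite_commutator_weights:
  fixes k1 k2 :: int
  assumes k1: "k1 > 0 \<or> k1 = -1" and \<phi>: "integrable disk_area (\<lambda>z. \<phi> (norm z))"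
  defines "w1 \<equiv> weight k1 (radial_power k1)" and "w2 \<equiv> weight k2 \<phi>"
  assumes fin: "finite {n. w1 (n + k2) * w2 n - w2 (n + k1) * w1 n \<noteq> 0}"
  shows "\<exists>C. AE z in disk_area. \<phi> (norm z) = C * of_real (norm z powi k2)"
proof -
  let ?F = "{n. w1 (n + k2) * w2 n - w2 (n + k1) * w1 n \<noteq> 0}"
  \<comment> \<open>beyond all nonzero commutator weights, with room for shifts by \<open>k1\<close> and \<open>k2\<close>\<close>
  define N where "N = \<bar>Max (insert 0 ?F)\<bar> + 2 * \<bar>k1\<bar> + 2 * \<bar>k2\<bar> + 2"
  have k1': "k1 > -2" "k1 \<noteq> 0" using k1 by auto
  have step: "w2 (n + k1) = w2 n" if n: "n \<ge> N - \<bar>k1\<bar>" for n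
  proof -
    have "n > Max (insert 0 ?F)" using n by (simp add: N_def)
    moreover have "n \<le> Max (insert 0 ?F)" if "n \<in> ?F"
      using that by (intro Max_ge finite.insertI fin insertI2)
    ultimately have "n \<notin> ?F" by linarith
    moreover have "w1 n = 1" "w1 (n + k2) = 1"
      using n k1' by (auto simp: w1_def N_def intro!: weight_radial_power_pos)
    ultimately show ?thesis by simp
  qed
  define q where "q = nat \<bar>k1\<bar>"
  have q: "q > 0" using k1' by (simp add: q_def)
  have const: "w2 (N + int q * int j) = w2 N" for j
  proof (induction j)
    case (Suc j)
    have ge: "0 \<le> int q * int j" by simp
    have "w2 (N + int q * int (Suc j)) = w2 (N + int q * int j)"
    proof (cases "k1 > 0")
      case True
      then have "N + int q * int (Suc j) = (N + int q * int j) + k1" by (simp add: q_def algebra_simps)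
      moreover have "N + int q * int j \<ge> N - \<bar>k1\<bar>" using ge by linarith
      ultimately show ?thesis using step by metis
    next
      case False
      then have "N + int q * int j = (N + int q * int (Suc j)) + k1" by (simp add: q_def algebra_simps)
      moreover have "0 \<le> int q * int (Suc j)" by simp
      then have "N + int q * int (Suc j) \<ge> N - \<bar>k1\<bar>" by linarith
      ultimately show ?thesis using step by metis
    qed
    with Suc show ?case by simp
  qed simp
  define c where "c = w2 N"
  \<comment> \<open>the order of the moment in the weight at \<open>N\<close>; it makes \<open>r\<^bsup>k2 + m\<^esup>\<close> bounded even if \<open>k2 < 0\<close>\<close>
  define m where "m = nat (2 * N + k2)"
  have mN: "int m = 2 * N + k2" by (auto simp: m_def N_def)
  have mk: "int m + k2 \<ge> 0" unfolding mN by (auto simp: N_def)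
  have mom: "moment \<phi> (m + 2 * q * j) = c * of_real (2 / (real_of_int (k2 + int (m + 2 * q * j)) + 2))" for j
  proof -
    define n where "n = N + int q * int j"
    have "0 \<le> int q * int j" "N \<ge> 0" "N + k2 \<ge> 0" by (simp_all add: N_def)
    then have n: "n \<ge> 0" "n + k2 \<ge> 0" unfolding n_def by linarith+
    then have "nat \<bar>n\<bar> + nat \<bar>n + k2\<bar> = nat (2 * n + k2)" by (simp add: nat_add_distrib[symmetric])
    also have "2 * n + k2 = int (m + 2 * q * j)" by (simp add: mN n_def algebra_simps)
    finally have idx: "nat \<bar>n\<bar> + nat \<bar>n + k2\<bar> = m + 2 * q * j" by (simp only: nat_int)
    have "c = w2 n" using const[of j] by (simp add: c_def n_def)
    then have c: "c = of_int (n + k2 + 1) * moment \<phi> (m + 2 * q * j)"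
      unfolding w2_def weight_def idx using n by simp
    define y where "y = real_of_int (n + k2 + 1)"
    have "real_of_int (k2 + int (m + 2 * q * j)) + 2 = 2 * y"
      by (simp add: mN n_def y_def algebra_simps)
    moreover have "y \<noteq> 0" using n unfolding y_def of_int_eq_0_iff by linarith
    moreover have "c = of_real y * moment \<phi> (m + 2 * q * j)"
      unfolding y_def of_real_of_int_eq by (rule c)
    ultimately show ?thesis by simp
  qed
  define \<psi> where "\<psi> r = \<phi> r * of_real (r ^ m) - c * of_real (r powi (k2 + int m))" for r
  have int1: "integrable disk_area (\<lambda>z. \<phi> (norm z) * of_real (norm z ^ m))" by (rule integrable_moment[OF \<phi>])
  have int2: "integrable disk_area (\<lambda>z. complex_of_real (norm z powi i))" if "i \<ge> 0" for i
    using integrable_norm_powi_iff[of i] that by (intro integrable_of_real) simp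
  have int: "integrable disk_area (\<lambda>z. \<psi> (norm z))"
    unfolding \<psi>_def using mk by (intro Bochner_Integration.integrable_diff int1 integrable_mult_right int2) simp
  have "AE z in disk_area. \<psi> (norm z) = 0"
  proof (rule AE_radial_eq_0[OF int q])
    fix j
    have nn: "k2 + int (m + 2 * q * j) \<ge> 0" using mk unfolding of_nat_add by linarith
    have "(\<integral>z. \<psi> (norm z) * of_real (norm z ^ (2 * q * j)) \<partial>disk_area)
        = (\<integral>z. \<phi> (norm z) * of_real (norm z ^ (m + 2 * q * j)) - c * of_real (norm z powi (k2 + int (m + 2 * q * j))) \<partial>disk_area)"
    proof (rule integral_cong_AE)
      show "AE z in disk_area. \<psi> (norm z) * of_real (norm z ^ (2 * q * j))
          = \<phi> (norm z) * of_real (norm z ^ (m + 2 * q * j)) - c * of_real (norm z powi (k2 + int (m + 2 * q * j)))"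
        using AE_disk_area_nonzero
      proof eventually_elim
        case (elim z)
        have "norm z powi (k2 + int (m + 2 * q * j)) = norm z powi (k2 + int m) * norm z ^ (2 * q * j)"
        proof -
          have "k2 + int (m + 2 * q * j) = (k2 + int m) + int (2 * q * j)" by simp
          then have "norm z powi (k2 + int (m + 2 * q * j)) = norm z powi (k2 + int m) * norm z powi int (2 * q * j)"
            using elim by (simp only:) (rule power_int_add, simp)
          then show ?thesis by (simp only: power_int_of_nat)
        qed
        then show ?case by (simp add: \<psi>_def power_add left_diff_distrib mult.assoc)
      qed
      show "(\<lambda>z. \<psi> (norm z) * of_real (norm z ^ (2 * q * j))) \<in> borel_measurable disk_area"
        using integrable_moment[OF int] by simp
      show "(\<lambda>z. \<phi> (norm z) * of_real (norm z ^ (m + 2 * q * j)) - c * of_real (norm z powi (k2 + int (m + 2 * q * j)))) \<in> borel_measurable disk_area"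
        by (intro borel_measurable_diff borel_measurable_times borel_measurable_const
            borel_measurable_integrable[OF integrable_moment[OF \<phi>]] borel_measurable_integrable[OF int2[OF nn]]
            borel_measurable_integrable[OF \<phi>]) measurable
    qed
    also have "\<dots> = moment \<phi> (m + 2 * q * j) - c * of_real (\<integral>z. norm z powi (k2 + int (m + 2 * q * j)) \<partial>disk_area)"
      unfolding moment_def integral_complex_of_real[symmetric] integral_mult_right_zero[symmetric]
      by (rule Bochner_Integration.integral_diff[OF integrable_moment[OF \<phi>] integrable_mult_right[OF int2[OF nn]]])
    also have "(\<integral>z. norm z powi (k2 + int (m + 2 * q * j)) \<partial>disk_area) = 2 / (real_of_int (k2 + int (m + 2 * q * j)) + 2)"
      by (rule integral_norm_powi) (use nn in linarith)
    finally show "(\<integral>z. \<psi> (norm z) * of_real (norm z ^ (2 * q * j)) \<partial>disk_area) = 0"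
      by (simp only: mom) simp
  qed
  then have "AE z in disk_area. \<phi> (norm z) = c * of_real (norm z powi k2)"
    using AE_disk_area_nonzero
  proof eventually_elim
    case (elim z)
    then have "(\<phi> (norm z) - c * of_real (norm z powi k2)) * of_real (norm z ^ m) = 0"
      by (simp add: \<psi>_def power_int_add left_diff_distrib mult.assoc)
    with elim show ?case by simp
  qed
  then show ?thesis by blast
qed

text \<open>The condition \<open>k2 > -2\<close> is forced by the integrability of \<open>\<phi>\<close>, because \<open>C \<noteq> 0\<close>.\<close>
lemma finite_commutator_weights_iff:
  fixes k1 k2 :: int
  assumes k1: "k1 > 0 \<or> k1 = -1" and \<phi>: "integrable disk_area (\<lambda>z. \<phi> (norm z))"
    and nz: "\<not> (AE z in disk_area. \<phi> (norm z) = 0)"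
  defines "w1 \<equiv> weight k1 (radial_power k1)" and "w2 \<equiv> weight k2 \<phi>"
  shows "finite {n. w1 (n + k2) * w2 n - w2 (n + k1) * w1 n \<noteq> 0} \<longleftrightarrow>
    k2 > -2 \<and> (\<exists>C. AE z in disk_area. \<phi> (norm z) = C * of_real (norm z powi k2))" (is "?lhs \<longleftrightarrow> ?rhs")
proof
  assume ?lhs
  then obtain C where C: "AE z in disk_area. \<phi> (norm z) = C * of_real (norm z powi k2)"
    using radial_power_if_finite_commutator_weights[OF k1 \<phi>, of k2] unfolding w1_def w2_def by blast
  have "C \<noteq> 0" using C nz by auto
  have "integrable disk_area (\<lambda>z. C * complex_of_real (norm z powi k2))"
  proof (rule integrable_cong_AE_imp[OF \<phi>])
    show "AE z in disk_area. \<phi> (norm z) = C * complex_of_real (norm z powi k2)" by (rule C)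
  qed measurable
  then have "integrable disk_area (\<lambda>z. norm (C * complex_of_real (norm z powi k2)) / norm C)"
    by (intro integrable_divide integrable_norm)
  then have "integrable disk_area (\<lambda>z. norm z powi k2)"
    using \<open>C \<noteq> 0\<close> by (simp add: norm_mult norm_power_int)
  then have "k2 > -2" by (simp add: integrable_norm_powi_iff)
  with C show ?rhs by blast
next
  assume ?rhs
  then obtain C where k2: "k2 > -2" and C: "AE z in disk_area. \<phi> (norm z) = C * radial_power k2 (norm z)"
    unfolding radial_power_def by blast
  have "moment \<phi> m = C * moment (radial_power k2) m" for m
    by (rule moment_cong_scale[OF C]) (use \<phi> in simp, unfold radial_power_def, measurable)
  then have w2: "w2 n = C * weight k2 (radial_power k2) n" for n
    by (simp add: w2_def weight_def)
  have "finite {n. w1 (n + k2) * weight k2 (radial_power k2) n - weight k2 (radial_power k2) (n + k1) * w1 n \<noteq> 0}"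
    unfolding w1_def by (rule finite_commutator_weights_if_radial_power) (use k1 k2 in auto)
  moreover have "w1 (n + k2) * w2 n - w2 (n + k1) * w1 n
      = C * (w1 (n + k2) * weight k2 (radial_power k2) n - weight k2 (radial_power k2) (n + k1) * w1 n)" for n
    by (simp add: w2 algebra_simps)
  ultimately show ?lhs by (auto elim: finite_subset[rotated])
qed

lemma finite_rank_commutator_iff:
  assumes u: "integrable disk_area (\<lambda>z. u (norm z))" "\<And>m. (real m + 2) * norm (moment u m) \<le> M"
    and v: "integrable disk_area (\<lambda>z. v (norm z))" "\<And>m. (real m + 2) * norm (moment v m) \<le> N"
  shows "finite_rank (commutator (toeplitz (quasihomogeneous k1 u)) (toeplitz (quasihomogeneous k2 v)))
    \<longleftrightarrow> finite {n. weight k1 u (n + k2) * weight k2 v n - weight k2 v (n + k1) * weight k1 u n \<noteq> 0}"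
proof -
  have wu: "norm (weight k1 u n) \<le> M" for n by (rule weight_bound[OF u(2)])
  have wv: "norm (weight k2 v n) \<le> N" for n by (rule weight_bound[OF v(2)])
  have "norm (weight k1 u (n + k2) * weight k2 v n - weight k2 v (n + k1) * weight k1 u n) \<le> M * N + N * M" for n
  proof -
    have "0 \<le> M" "0 \<le> N" using wu wv norm_ge_zero order_trans by blast+
    then have "norm (weight k1 u (n + k2) * weight k2 v n) \<le> M * N"
      "norm (weight k2 v (n + k1) * weight k1 u n) \<le> N * M"
      unfolding norm_mult by (intro mult_mono wu wv; simp)+
    then show ?thesis by (rule order_trans[OF norm_triangle_ineq4 add_mono])
  qed
  then show ?thesis
    unfolding toeplitz_quasihomogeneous[OF u(1) wu] toeplitz_quasihomogeneous[OF v(1) wv]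
      commutator_wshift[where ?w1.0 = "weight k1 u" and ?w2.0 = "weight k2 v", OF wu wv]
    by (rule finite_rank_wshift_iff)
qed

text \<open>The reflection \<open>z \<mapsto> cnj z\<close> exchanges \<open>e\<^sub>n\<close> and \<open>e\<^bsub>-n\<^esub>\<close> and fixes radial functions.\<close>
lemma weight_uminus: "weight (- k) \<phi> n = weight k \<phi> (- n)"
proof -
  have "\<bar>n - k\<bar> = \<bar>k - n\<bar>" by simp
  then show ?thesis by (simp add: weight_def)
qed

theorem corollary4p6:
  fixes k1 k2 :: int and \<phi> :: "real \<Rightarrow> complex"
  assumes "k1 > 0 \<or> k1 = -1"
    and "T_function (\<lambda>z. \<phi> (norm z))"
    and "\<not> (AE z in disk_area. \<phi> (norm z) = 0)"
  shows "(finite_rank (commutator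
             (toeplitz (quasihomogeneous k1 (\<lambda>r. of_real (r powi k1))))
             (toeplitz (quasihomogeneous k2 \<phi>)))
          \<longleftrightarrow> k2 > -2 \<and> (\<exists>C. AE z in disk_area. \<phi> (norm z) = C * of_real (norm z powi k2)))
       \<and> (finite_rank (commutator
             (toeplitz (quasihomogeneous (- k1) (\<lambda>r. of_real (r powi k1))))
             (toeplitz (quasihomogeneous k2 \<phi>)))
          \<longleftrightarrow> k2 < 2 \<and> (\<exists>C. AE z in disk_area. \<phi> (norm z) = C * of_real (norm z powi (- k2))))"
proof -
  have k1: "k1 > -2" using assms(1) by auto
  have u: "integrable disk_area (\<lambda>z. radial_power k1 (norm z))"
    unfolding radial_power_def using k1 integrable_norm_powi_iff[of k1] by (intro integrable_of_real) simp
  have \<phi>: "integrable disk_area (\<lambda>z. \<phi> (norm z))" using assms(2) by (simp add: T_function_def)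
  obtain M where M: "\<And>m. (real m + 2) * norm (moment \<phi> m) \<le> M"
    using T_function_moment_bound[OF assms(2)] by blast
  note fr = finite_rank_commutator_iff[OF u radial_power_moment_bound[OF k1] \<phi> M]
  note iff = finite_commutator_weights_iff[OF assms(1) \<phi> assms(3)]
  let ?d = "\<lambda>k n. weight k1 (radial_power k1) (n + k) * weight k \<phi> n - weight k \<phi> (n + k1) * weight k1 (radial_power k1) n"
  have "weight (- k1) (radial_power k1) (n + k2) * weight k2 \<phi> n
      - weight k2 \<phi> (n + - k1) * weight (- k1) (radial_power k1) n = ?d (- k2) (- n)" for n
    using weight_uminus[of "- k2" \<phi>] by (simp add: weight_uminus[of k1] add.commute)
  moreover have img: "{n. P (- n)} = uminus ` {n. P n}" for P :: "int \<Rightarrow> bool"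
  proof (intro set_eqI iffI)
    fix n assume "n \<in> {n. P (- n)}"
    then show "n \<in> uminus ` {n. P n}" by (intro image_eqI[where x = "- n"]) auto
  qed auto
  moreover have "finite (uminus ` A) \<longleftrightarrow> finite A" for A :: "int set"
    by (rule finite_image_iff) auto
  moreover have rp: "(\<lambda>r. complex_of_real (r powi k1)) = radial_power k1"
    by (rule ext) (rule radial_power_def[symmetric])
  ultimately have "finite {n. weight (- k1) (radial_power k1) (n + k2) * weight k2 \<phi> n
      - weight k2 \<phi> (n + - k1) * weight (- k1) (radial_power k1) n \<noteq> 0} \<longleftrightarrow> finite {n. ?d (- k2) n \<noteq> 0}"
    by (simp only: img[of "\<lambda>n. ?d (- k2) n \<noteq> 0"])
  then show ?thesis
    unfolding rp fr iff by auto
qed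

end
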